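(* Let $m$ be large and let $\mathcal{F}=\{\varphi_a\}_{a\in\Omega_m}$ be a family of $m$-periodic complex valued functions satisfying Assumptions 2 and 3. Uniformly for $V$ in the range $1\le V\le\frac N\pi\left(\log\log m-2\log\log\log m-B\right)$ we have $$\Psi_{\mathcal{F}}(V)=\exp\left(-A_0\exp\left(\frac\pi NV\right)\left(1+O\left(Ve^{-\pi V/(2N)}\right)\right)\right),$$ and in the same range $$\Psi^-_{\mathcal{F}}(V)=\exp\left(-A_0\exp\left(\frac\pi NV\right)\left(1+O\left(Ve^{-\pi V/(2N)}\right)\right)\right),$$ where $$A_0=\frac N2\exp\left(-\gamma-1-\frac1{2N}\int_{-\infty}^\infty\frac{f_{\mathbb{X}}(u)}{u^2}\,du\right),\qquad B=\log A_0+9.$$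
   Context: Let $m\ge2$ be an integer, $e(z)=\exp(2\pi i z)$, $e_m(z)=e(z/m)$, $\gamma$ the Euler–Mascheroni constant. For an $m$-periodic $\varphi:\mathbb{Z}\to\mathbb{C}$ put $\widehat{\varphi}(h)=m^{-1/2}\sum_{n\bmod m}\varphi(n)e_m(hn)$. A family $\mathcal{F}=\{\varphi_a\}_{a\in\Omega_m}$ consists of a nonempty finite set $\Omega_m$ and $m$-periodic functions $\varphi_a$. Define $\Psi_{\mathcal{F}}(t)$ (resp. $\Psi^-_{\mathcal{F}}(t)$) as the proportion of $a\in\Omega_m$ with $\frac1{\sqrt m}\mathrm{Im}\sum_{0\le n\le m/2}\varphi_a(n)>t$ (resp. $<-t$). "Absolute constant" means independent of $m$. Assumption 2: there is an absolute constant $N>0$ with $\widehat{\varphi_a}(h)\in[-N,N]$ for all $a\in\Omega_m$, $h\in\mathbb{Z}/m\mathbb{Z}$. Assumption 3: there exist i.i.d. real random variables $\{\mathbb{X}(h)\}_{h\in\mathbb{Z}\setminus\{0\}}$ supported on $[-N,N]$ and absolute constants $\eta\ge1/2$, $C_1>1$ such that for all positive integers $k\le\log m/\log\log m$ and all integer tuples $(h_1,\dots,h_k)\in(-m/2,m/2]^k$ with all $h_i\ne0$, $$\frac{1}{|\Omega_m|}\sum_{a\in\Omega_m}\widehat{\varphi_a}(h_1)\cdots\widehat{\varphi_a}(h_k)=\mathbb{E}(\mathbb{X}(h_1)\cdots\mathbb{X}(h_k))+O\!\left(\frac{C_1^k}{m^\eta}\right);$$ moreover a random variable $\mathbb{X}$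 with the common distribution satisfies (3a) there is $A>0$ with $\mathbb{P}(\mathbb{X}>N-\varepsilon)\gg\varepsilon^A$ and $\mathbb{P}(\mathbb{X}<-N+\varepsilon)\gg\varepsilon^A$ for all $\varepsilon\in(0,1]$, and (3b) $\mathbb{E}(\mathbb{X}^{2\ell+1})=0$ for all integers $\ell\ge0$. $f_{\mathbb{X}}(t)=\log\mathbb{E}(e^{t\mathbb{X}})$ if $|t|<1$ and $f_{\mathbb{X}}(t)=\log\mathbb{E}(e^{t\mathbb{X}})-N|t|$ if $|t|\ge1$. *)

theory Defs
  imports "HOL-Probability.Probability"
begin

definition fourier :: "nat \<Rightarrow> (int \<Rightarrow> complex) \<Rightarrow> int \<Rightarrow> complex" where
  "fourier m \<phi> h = complex_of_real (1 / sqrt (real m)) *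
     (\<Sum>n\<in>{0..<int m}. \<phi> n * exp (2 * complex_of_real pi * \<i> * (of_int (h * n) / of_nat m)))"

definition periodic_family :: "nat \<Rightarrow> 'a set \<Rightarrow> ('a \<Rightarrow> int \<Rightarrow> complex) \<Rightarrow> bool" where
  "periodic_family m \<Omega> \<phi> \<longleftrightarrow> m \<ge> 2 \<and> finite \<Omega> \<and> \<Omega> \<noteq> {} \<and>
     (\<forall>a\<in>\<Omega>. \<forall>n. \<phi> a (n + int m) = \<phi> a n)"

definition half_sum :: "nat \<Rightarrow> (int \<Rightarrow> complex) \<Rightarrow> real" where
  "half_sum m \<phi> = 1 / sqrt (real m) * Im (\<Sum>n\<in>{0..\<lfloor>real m / 2\<rfloor>}. \<phi> n)"

definition Psi_plus :: "nat \<Rightarrow> 'a set \<Rightarrow> ('a \<Rightarrow> int \<Rightarrow> complex) \<Rightarrow> real \<Rightarrow> real" where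
  "Psi_plus m \<Omega> \<phi> t = real (card {a\<in>\<Omega>. half_sum m (\<phi> a) > t}) / real (card \<Omega>)"

definition Psi_minus :: "nat \<Rightarrow> 'a set \<Rightarrow> ('a \<Rightarrow> int \<Rightarrow> complex) \<Rightarrow> real \<Rightarrow> real" where
  "Psi_minus m \<Omega> \<phi> t = real (card {a\<in>\<Omega>. half_sum m (\<phi> a) < - t}) / real (card \<Omega>)"

text \<open>Membership in the image of the real interval says that the complex number
  \<open>fourier m (\<phi> a) h\<close> is real and of absolute value at most \<open>N\<close>.\<close>

definition assumption2 :: "real \<Rightarrow> nat \<Rightarrow> 'a set \<Rightarrow> ('a \<Rightarrow> int \<Rightarrow> complex) \<Rightarrow> bool" where
  "assumption2 N m \<Omega> \<phi> \<longleftrightarrow>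
     (\<forall>a\<in>\<Omega>. \<forall>h. fourier m (\<phi> a) h \<in> complex_of_real ` {-N..N})"

text \<open>The value \<open>X 0\<close> is junk; only indices \<open>h \<noteq> 0\<close> are constrained.\<close>

definition iid_supported :: "'w measure \<Rightarrow> (int \<Rightarrow> 'w \<Rightarrow> real) \<Rightarrow> real \<Rightarrow> bool" where
  "iid_supported M X N \<longleftrightarrow> prob_space M \<and>
     prob_space.indep_vars M (\<lambda>_. borel) X (UNIV - {0}) \<and>
     (\<forall>h h'. h \<noteq> 0 \<longrightarrow> h' \<noteq> 0 \<longrightarrow> distr M borel (X h) = distr M borel (X h')) \<and>
     (\<forall>h. h \<noteq> 0 \<longrightarrow> (AE w in M. X h w \<in> {-N..N}))"

definition condition3a :: "'w measure \<Rightarrow> ('w \<Rightarrow> real) \<Rightarrow> real \<Rightarrow> bool" where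
  "condition3a M Y N \<longleftrightarrow> (\<exists>A>0. \<exists>c>0. \<forall>\<epsilon>\<in>{0<..1}.
     measure M {w\<in>space M. Y w > N - \<epsilon>} \<ge> c * \<epsilon> powr A \<and>
     measure M {w\<in>space M. Y w < - N + \<epsilon>} \<ge> c * \<epsilon> powr A)"

definition condition3b :: "'w measure \<Rightarrow> ('w \<Rightarrow> real) \<Rightarrow> bool" where
  "condition3b M Y \<longleftrightarrow> (\<forall>l::nat. (\<integral>w. Y w ^ (2 * l + 1) \<partial>M) = 0)"

text \<open>Here \<open>K\<close> is the implied constant of the error term.\<close>

definition moment_condition ::
  "'w measure \<Rightarrow> (int \<Rightarrow> 'w \<Rightarrow> real) \<Rightarrow> real \<Rightarrow> real \<Rightarrow> real \<Rightarrow> nat \<Rightarrow> 'a set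
     \<Rightarrow> ('a \<Rightarrow> int \<Rightarrow> complex) \<Rightarrow> bool" where
  "moment_condition M X \<eta> C\<^sub>1 K m \<Omega> \<phi> \<longleftrightarrow>
     (\<forall>k::nat. 1 \<le> k \<longrightarrow> real k \<le> ln (real m) / ln (ln (real m)) \<longrightarrow>
       (\<forall>h :: nat \<Rightarrow> int.
         (\<forall>i\<in>{1..k}. - real m / 2 < real_of_int (h i) \<and> real_of_int (h i) \<le> real m / 2 \<and> h i \<noteq> 0) \<longrightarrow>
         norm ((\<Sum>a\<in>\<Omega>. \<Prod>i=1..k. fourier m (\<phi> a) (h i)) / of_nat (card \<Omega>)
               - complex_of_real (\<integral>w. (\<Prod>i=1..k. X (h i) w) \<partial>M))
           \<le> K * (C\<^sub>1 ^ k / real m powr \<eta>)))"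

definition f_rv :: "'w measure \<Rightarrow> ('w \<Rightarrow> real) \<Rightarrow> real \<Rightarrow> real \<Rightarrow> real" where
  "f_rv M Y N t =
     (if \<bar>t\<bar> < 1 then ln (\<integral>w. exp (t * Y w) \<partial>M)
      else ln (\<integral>w. exp (t * Y w) \<partial>M) - N * \<bar>t\<bar>)"

definition A_zero :: "'w measure \<Rightarrow> ('w \<Rightarrow> real) \<Rightarrow> real \<Rightarrow> real" where
  "A_zero M Y N = N / 2 *
     exp (- euler_mascheroni - 1 - 1 / (2 * N) * (\<integral>u. f_rv M Y N u / u\<^sup>2 \<partial>lborel))"

definition B_const :: "'w measure \<Rightarrow> ('w \<Rightarrow> real) \<Rightarrow> real \<Rightarrow> real" where
  "B_const M Y N = ln (A_zero M Y N) + 9"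

end

theory Submission
  imports Defs "HOL-Real_Asymp.Real_Asymp"
begin

text \<open>
  Fourier inversion writes the half sum of \<open>\<phi>\<^sub>a\<close> as a linear form in the real numbers \<open>fourier m (\<phi> a) h\<close>
  whose coefficients are close to \<open>1 / (\<pi> h)\<close> for odd \<open>h\<close> and to \<open>0\<close> for even \<open>h\<close>. The same linear form
  \<open>Y\<close> in the independent variables \<open>X h\<close> has cumulant generating function
  \<open>\<kappa> s (ln s + D) + O(ln s)\<close> with \<open>\<kappa> = N / \<pi>\<close>, and the saddle point of this function at \<open>V\<close> satisfies
  \<open>\<kappa> s = A\<^sub>0 exp (\<pi> V / N)\<close>, which is the claimed exponent.

  The moment condition does not control exponentials, since a half sum can be of size \<open>ln m\<close>. They are
  replaced by the Taylor polynomial of \<open>exp\<close> of even degree \<open>n\<close> close to \<open>ln m / (8 ln ln m)\<close>. It is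
  positive and on the positive axis it is increasing and at most \<open>exp\<close>, so Markov's inequality and
  the usual tilting argument work for it on the family itself, without removing exceptional
  parameters; in the stated range of \<open>V\<close> the truncation error is negligible.
\<close>

section \<open>The log-moment generating function\<close>

text \<open>The moment condition fixes every scale. The error in degree \<open>n\<close> is at most
  about \<open>(ln m)^(3 n) / m^(1/2)\<close>, so \<open>n\<close> must be a small multiple of
  \<open>ln m / ln ln m\<close>. At tilt \<open>s\<close> the polynomial is faithful as long as
  \<open>exp (- n)\<close> times the exponential moment at \<open>e s\<close> stays bounded; since
  the cumulant is about \<kappa> s ln s, this allows \<open>s\<close> up to a small multiple of
  \<open>ln m / (ln ln m)^2\<close>. Inserting the saddle point turns this into the upper limit for
  V: the term \<open>2 ln ln ln m\<close> comes from the square, the summand \<open>ln A_0\<close>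
  of B cancels the factor of the exponential, and the 9 pays for numerical constants. The error term
  comes from the lower bound. The cumulant is known up to \<open>O(ln s) = O(V)\<close>, so a window
  of width \<delta> around V can be isolated only if \<delta>^2 s exceeds a multiple of V. For
  \<delta> = V exp(- \<pi> V / (2N)) this product has order V^2, and the price s \<delta> of the
  window has order V exp(\<pi> V / (2N)), which is the stated error.\<close>

locale centered_bounded_variable = prob_space M for M :: "'w measure" +
  fixes Z :: "'w \<Rightarrow> real" and N :: real
  assumes N_pos: "N > 0"
    and Z_measurable [measurable]: "Z \<in> borel_measurable M"
    and Z_bounded: "AE w in M. Z w \<in> {-N..N}"
    and Z_mean: "expectation Z = 0"
    and Z_tails: "condition3a M Z N"
begin

definition mgf :: "real \<Rightarrow> real" where
  "mgf t = expectation (\<lambda>w. exp (t * Z w))"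

text \<open>The coefficients of the half sum at \<open>h\<close> and \<open>- h\<close> are
  opposite, so the two independent variables contribute this even function together. Being even, it
  also makes the upper and the lower tail look alike.\<close>

definition sym_log_mgf :: "real \<Rightarrow> real" where
  "sym_log_mgf t = ln (mgf t) + ln (mgf (- t))"

lemma mult_Z_le: "AE w in M. t * Z w \<le> N * \<bar>t\<bar>"
  using Z_bounded
proof eventually_elim
  case (elim w)
  have "t * Z w \<le> \<bar>t\<bar> * \<bar>Z w\<bar>" by (metis abs_ge_self abs_mult)
  also have "\<dots> \<le> \<bar>t\<bar> * N" using elim by (intro mult_left_mono) auto
  finally show ?case by (simp add: mult.commute)
qed

lemma Z_integrable: "integrable M Z"
proof (rule integrable_const_bound)
  show "AE w in M. norm (Z w) \<le> N"
    using Z_bounded by eventually_elim auto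
qed auto

lemma exp_Z_integrable [simp]: "integrable M (\<lambda>w. exp (t * Z w))"
  by (rule integrable_const_bound[of _ "exp (N * \<bar>t\<bar>)"])
    (use mult_Z_le[of t] in \<open>auto elim!: eventually_mono\<close>)

lemma mgf_ge_1: "mgf t \<ge> 1"
proof -
  have "expectation (\<lambda>w. 1 + t * Z w) \<le> mgf t"
    unfolding mgf_def by (intro integral_mono) (auto intro!: Z_integrable exp_ge_add_one_self)
  moreover have "expectation (\<lambda>w. 1 + t * Z w) = 1"
    by (subst Bochner_Integration.integral_add) (auto simp: prob_space Z_mean Z_integrable)
  ultimately show ?thesis by simp
qed

lemma mgf_pos [simp]: "mgf t > 0"
  using mgf_ge_1[of t] by linarith

lemma mgf_0 [simp]: "mgf 0 = 1"
  by (simp add: mgf_def prob_space)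

lemma mgf_le_shift: "mgf t \<le> exp (N * \<bar>t - t'\<bar>) * mgf t'"
proof -
  have "mgf t \<le> expectation (\<lambda>w. exp (N * \<bar>t - t'\<bar>) * exp (t' * Z w))"
    unfolding mgf_def
  proof (intro integral_mono_AE)
    show "AE w in M. exp (t * Z w) \<le> exp (N * \<bar>t - t'\<bar>) * exp (t' * Z w)"
      using mult_Z_le[of "t - t'"]
      by eventually_elim (simp add: exp_add[symmetric] algebra_simps)
  qed auto
  thus ?thesis by (simp add: mgf_def)
qed

lemma ln_mgf_lipschitz: "\<bar>ln (mgf t) - ln (mgf t')\<bar> \<le> N * \<bar>t - t'\<bar>"
proof -
  have *: "ln (mgf t) \<le> N * \<bar>t - t'\<bar> + ln (mgf t')" for t t'
  proof -
    have "ln (mgf t) \<le> ln (exp (N * \<bar>t - t'\<bar>) * mgf t')"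
      using mgf_le_shift[of t t'] by (subst ln_le_cancel_iff) auto
    thus ?thesis by (simp add: ln_mult_pos)
  qed
  from *[of t t'] *[of t' t] show ?thesis by (simp add: abs_minus_commute)
qed

lemma ln_mgf_le_square: "ln (mgf t) \<le> N\<^sup>2 * t\<^sup>2 / 2"
proof (cases "t = 0")
  case False
  \<comment> \<open>Hoeffding's lemma wants a positive parameter, so the sign of \<open>t\<close> is
    moved into the variable.\<close>
  define \<sigma> where "\<sigma> = sgn t"
  have \<sigma>: "\<bar>\<sigma>\<bar> = 1" "\<bar>t\<bar> * \<sigma> = t"
    using False by (auto simp: \<sigma>_def abs_mult_sgn abs_sgn_eq)
  interpret interval_bounded_random_variable M "\<lambda>w. \<sigma> * Z w" "- N" N
  proof
    show "AE w in M. \<sigma> * Z w \<in> {- N..N}"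
      using mult_Z_le[of \<sigma>] mult_Z_le[of "- \<sigma>"] by eventually_elim (auto simp: \<sigma>(1))
  qed auto
  have "expectation (\<lambda>w. \<sigma> * Z w) = 0" by (simp add: Z_mean)
  hence "(\<integral>\<^sup>+w. exp (\<bar>t\<bar> * (\<sigma> * Z w)) \<partial>M) \<le> ennreal (exp (\<bar>t\<bar>\<^sup>2 * (N - - N)\<^sup>2 / 8))"
    using False by (intro Hoeffdings_lemma_nn_integral_0) auto
  also have "(\<lambda>w. \<bar>t\<bar> * (\<sigma> * Z w)) = (\<lambda>w. t * Z w)"
    by (simp add: mult.assoc[symmetric] \<sigma>)
  also have "(\<integral>\<^sup>+w. exp (t * Z w) \<partial>M) = ennreal (mgf t)"
    unfolding mgf_def by (intro nn_integral_eq_integral) auto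
  also have "\<bar>t\<bar>\<^sup>2 * (N - - N)\<^sup>2 / 8 = N\<^sup>2 * t\<^sup>2 / 2"
    by (simp add: power2_eq_square)
  finally have "mgf t \<le> exp (N\<^sup>2 * t\<^sup>2 / 2)" by (simp add: ennreal_le_iff)
  hence "ln (mgf t) \<le> ln (exp (N\<^sup>2 * t\<^sup>2 / 2))" by (subst ln_le_cancel_iff) auto
  thus ?thesis by simp
qed auto

lemma exp_mult_prob_le_mgf:
  assumes "\<And>w. w \<in> S \<Longrightarrow> t * Z w \<ge> y" and [measurable]: "S \<in> sets M"
  shows "exp y * prob S \<le> mgf t"
proof -
  have "exp y * prob S = expectation (\<lambda>w. exp y * indicator S w)"
    by simp
  also have "\<dots> \<le> mgf t"
    unfolding mgf_def using assms
    by (intro integral_mono integrable_mult_right integrable_real_indicator)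
      (auto simp: indicator_def emeasure_finite less_top[symmetric])
  finally show ?thesis .
qed

text \<open>Restrict the expectation to the event that \<open>Z\<close> lies within
  \<open>1 / \<bar>t\<bar>\<close> of the endpoint favoured by the sign of \<open>t\<close>. There
  the exponent loses at most 1, and the event has probability at least
  \<open>c * \<bar>t\<bar> powr (- A)\<close>, so the total loss is only logarithmic.\<close>

lemma ln_mgf_lower:
  obtains C where "C \<ge> 0" "\<And>t. \<bar>t\<bar> \<ge> 1 \<Longrightarrow> ln (mgf t) \<ge> N * \<bar>t\<bar> - C * (1 + ln \<bar>t\<bar>)"
proof -
  from Z_tails obtain A c where A: "A > 0" "c > 0"
    and tails: "\<And>\<epsilon>. \<epsilon> \<in> {0<..1} \<Longrightarrow> prob {w\<in>space M. Z w > N - \<epsilon>} \<ge> c * \<epsilon> powr A"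
      "\<And>\<epsilon>. \<epsilon> \<in> {0<..1} \<Longrightarrow> prob {w\<in>space M. Z w < - N + \<epsilon>} \<ge> c * \<epsilon> powr A"
    unfolding condition3a_def by blast
  have one: "ln (mgf \<tau>) \<ge> N * t - (1 + \<bar>ln c\<bar> + A * ln t)"
    if t: "t \<ge> 1" and \<tau>: "\<tau> = t \<or> \<tau> = - t" for t \<tau>
  proof -
    define S where "S = (if \<tau> = t then {w\<in>space M. Z w > N - 1 / t} else {w\<in>space M. Z w < - N + 1 / t})"
    have 1: "exp (N * t - 1) * prob S \<le> mgf \<tau>"
    proof (rule exp_mult_prob_le_mgf)
      fix w assume w: "w \<in> S"
      hence "N - 1 / t \<le> (if \<tau> = t then 1 else -1) * Z w"
        by (auto simp: S_def split: if_splits)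
      hence "t * (N - 1 / t) \<le> t * ((if \<tau> = t then 1 else -1) * Z w)"
        using t by (intro mult_left_mono) auto
      thus "\<tau> * Z w \<ge> N * t - 1" using \<tau> t by (auto simp: algebra_simps split: if_splits)
    qed (auto simp: S_def)
    have "c * (1 / t) powr A \<le> prob S"
      using tails[of "1 / t"] t by (auto simp: S_def)
    hence "exp (N * t - 1) * (c * (1 / t) powr A) \<le> mgf \<tau>"
      using 1 by (meson exp_ge_zero mult_left_mono order_trans)
    moreover have pos: "c * (1 / t) powr A > 0" using A t by simp
    ultimately have "ln (exp (N * t - 1) * (c * (1 / t) powr A)) \<le> ln (mgf \<tau>)"
      by (subst ln_le_cancel_iff) auto
    moreover have "ln (exp (N * t - 1) * (c * (1 / t) powr A)) = N * t - 1 + (ln c - A * ln t)"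
      using A t pos by (simp add: ln_mult ln_powr ln_div)
    ultimately show ?thesis using abs_ge_minus_self[of "ln c"] by linarith
  qed
  show ?thesis
  proof (rule that[of "1 + \<bar>ln c\<bar> + A"])
    fix t :: real assume t: "\<bar>t\<bar> \<ge> 1"
    have "1 + \<bar>ln c\<bar> + A * ln \<bar>t\<bar> \<le> (1 + \<bar>ln c\<bar> + A) * (1 + ln \<bar>t\<bar>)"
      using t A by (simp add: algebra_simps)
    thus "ln (mgf t) \<ge> N * \<bar>t\<bar> - (1 + \<bar>ln c\<bar> + A) * (1 + ln \<bar>t\<bar>)"
      using one[of "\<bar>t\<bar>" t] t by linarith
  qed (use A in auto)
qed

lemma sym_log_mgf_nonneg: "sym_log_mgf t \<ge> 0"
  unfolding sym_log_mgf_def using mgf_ge_1[of t] mgf_ge_1[of "- t"] by simp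

lemma sym_log_mgf_minus [simp]: "sym_log_mgf (- t) = sym_log_mgf t"
  by (simp add: sym_log_mgf_def)

lemma sym_log_mgf_lipschitz: "\<bar>sym_log_mgf t - sym_log_mgf t'\<bar> \<le> 2 * N * \<bar>t - t'\<bar>"
  using ln_mgf_lipschitz[of t t'] ln_mgf_lipschitz[of "- t" "- t'"]
  unfolding sym_log_mgf_def by (simp add: abs_minus_commute)

lemma sym_log_mgf_le_square: "sym_log_mgf t \<le> N\<^sup>2 * t\<^sup>2"
  using ln_mgf_le_square[of t] ln_mgf_le_square[of "- t"]
  unfolding sym_log_mgf_def by simp

lemma f_rv_sym:
  assumes "u > 0"
  shows "f_rv M Z N u + f_rv M Z N (- u) =
    (if u < 1 then sym_log_mgf u else sym_log_mgf u - 2 * N * u)"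
  using assms by (simp add: f_rv_def sym_log_mgf_def mgf_def)

lemma f_rv_measurable [measurable]: "f_rv M Z N \<in> borel_measurable borel"
proof -
  have "continuous_on UNIV (\<lambda>t. ln (mgf t))"
  proof (rule lipschitz_on_continuous_on)
    show "N-lipschitz_on UNIV (\<lambda>t. ln (mgf t))"
      using ln_mgf_lipschitz N_pos by (intro lipschitz_onI) (auto simp: dist_real_def)
  qed
  hence [measurable]: "(\<lambda>t. ln (mgf t)) \<in> borel_measurable borel"
    by (rule borel_measurable_continuous_onI)
  have "f_rv M Z N = (\<lambda>t. if \<bar>t\<bar> < 1 then ln (mgf t) else ln (mgf t) - N * \<bar>t\<bar>)"
    by (auto simp: f_rv_def mgf_def)
  thus ?thesis by simp
qed

text \<open>Quadratic decay at 0 and logarithmic growth at infinity are what makes the quotient by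
  \<open>u\<^sup>2\<close> integrable. They come from Hoeffding's bound and from
  \<open>ln_mgf_lower\<close>.\<close>

lemma f_rv_bound:
  obtains C where "C \<ge> 0" "\<And>t. \<bar>t\<bar> < 1 \<Longrightarrow> \<bar>f_rv M Z N t\<bar> \<le> C * t\<^sup>2"
    "\<And>t. \<bar>t\<bar> \<ge> 1 \<Longrightarrow> \<bar>f_rv M Z N t\<bar> \<le> C * (1 + ln \<bar>t\<bar>)"
proof -
  obtain C where C: "C \<ge> 0" "\<And>t. \<bar>t\<bar> \<ge> 1 \<Longrightarrow> ln (mgf t) \<ge> N * \<bar>t\<bar> - C * (1 + ln \<bar>t\<bar>)"
    using ln_mgf_lower by blast
  show ?thesis
  proof (rule that[of "max C (N\<^sup>2)"])
    fix t :: real assume t: "\<bar>t\<bar> < 1"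
    have "\<bar>f_rv M Z N t\<bar> \<le> N\<^sup>2 * t\<^sup>2 / 2"
      using t ln_mgf_le_square[of t] mgf_ge_1[of t] by (simp add: f_rv_def mgf_def)
    also have "\<dots> \<le> N\<^sup>2 * t\<^sup>2" by simp
    also have "\<dots> \<le> max C (N\<^sup>2) * t\<^sup>2" by (intro mult_right_mono) auto
    finally show "\<bar>f_rv M Z N t\<bar> \<le> max C (N\<^sup>2) * t\<^sup>2" .
  next
    fix t :: real assume t: "\<bar>t\<bar> \<ge> 1"
    have "\<bar>f_rv M Z N t\<bar> \<le> C * (1 + ln \<bar>t\<bar>)"
      using t C(2)[of t] ln_mgf_lipschitz[of t 0] by (simp add: f_rv_def mgf_def prob_space)
    also have "\<dots> \<le> max C (N\<^sup>2) * (1 + ln \<bar>t\<bar>)" using t by (intro mult_right_mono) auto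
    finally show "\<bar>f_rv M Z N t\<bar> \<le> max C (N\<^sup>2) * (1 + ln \<bar>t\<bar>)" .
  qed (use C in auto)
qed

end

section \<open>Sums over odd integers and the integral of f\<close>

lemma inverse_square_has_integral:
  fixes a b :: real
  assumes "0 < a" "a \<le> b"
  shows "has_bochner_integral lborel (\<lambda>u. indicator {a<..b} u / u\<^sup>2) (1 / a - 1 / b)"
proof -
  have "has_bochner_integral lborel (\<lambda>u. 1 / u\<^sup>2 * indicator {a..b} u) (- 1 / b - (- 1 / a))"
    using assms
    by (intro has_bochner_integral_FTC_Icc_real)
      (auto intro!: derivative_eq_intros continuous_intros simp: power2_eq_square field_simps)
  also have "- 1 / b - (- 1 / a) = 1 / a - 1 / b" by simp
  also have "has_bochner_integral lborel (\<lambda>u. 1 / u\<^sup>2 * indicator {a..b} u) (1 / a - 1 / b) \<longleftrightarrow>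
      has_bochner_integral lborel (\<lambda>u. indicator {a<..b} u / u\<^sup>2) (1 / a - 1 / b)"
  proof (intro has_bochner_integral_cong_AE)
    show "AE u in lborel. 1 / u\<^sup>2 * indicator {a..b} u = indicator {a<..b} u / u\<^sup>2"
      using AE_lborel_singleton[of a] by eventually_elim (auto simp: indicator_def)
  qed auto
  finally show ?thesis .
qed

lemma log_over_square_has_integral:
  fixes b :: real
  assumes "b \<ge> 1"
  shows "has_bochner_integral lborel (\<lambda>u. (1 + ln u) / u\<^sup>2 * indicator {b..} u) ((2 + ln b) / b)"
proof -
  have "(\<integral>\<^sup>+u. ennreal ((1 + ln u) / u\<^sup>2) * indicator {b..} u \<partial>lborel) =
      ennreal (0 - - ((2 + ln b) / b))"
  proof (rule nn_integral_FTC_atLeast)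
    show "((\<lambda>u::real. - ((2 + ln u) / u)) \<longlongrightarrow> 0) at_top"
      by real_asymp
    show "((\<lambda>u. - ((2 + ln u) / u)) has_real_derivative (1 + ln x) / x\<^sup>2) (at x)" if "b \<le> x" for x
      using that assms
      by (auto intro!: derivative_eq_intros simp: power2_eq_square field_simps)
  qed (use assms in auto)
  also have "(\<lambda>u. ennreal ((1 + ln u) / u\<^sup>2) * indicator {b..} u) =
      (\<lambda>u. ennreal ((1 + ln u) / u\<^sup>2 * indicator {b..} u))"
    by (auto simp: indicator_def)
  finally show ?thesis
    using assms by (intro has_bochner_integral_nn_integral) (auto simp: indicator_def)
qed

lemma ln_lipschitz:
  fixes x y :: real
  assumes "0 < c" "c \<le> x" "c \<le> y"
  shows "\<bar>ln x - ln y\<bar> \<le> \<bar>x - y\<bar> / c"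
proof -
  have *: "ln x - ln y \<le> \<bar>x - y\<bar> / c" if "c \<le> x" "c \<le> y" for x y
  proof -
    have "ln x - ln y \<le> (x - y) / y"
      using ln_diff_le[of x y] that assms by auto
    also have "\<dots> \<le> \<bar>x - y\<bar> / y"
      using that assms by (intro divide_right_mono) auto
    also have "\<dots> \<le> \<bar>x - y\<bar> / c"
      using that assms by (intro divide_left_mono) auto
    finally show ?thesis .
  qed
  from *[of x y] *[of y x] assms show ?thesis by (simp add: abs_minus_commute)
qed

lemma harm_approx:
  assumes "n > 0"
  shows "\<bar>harm n - (euler_mascheroni + ln (real n))\<bar> \<le> 1 / real n"
proof -
  obtain k where k: "n = Suc k" using assms by (cases n) auto
  have "ln (real n + 1) - ln (real n) \<le> 1 / real n"
    using ln_lipschitz[of "real n" "real n + 1" "real n"] assms by auto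
  moreover have "ln (real n + 1) \<ge> ln (real n)" using assms by simp
  moreover have "harm n - ln (real n + 1) + 1 / (2 * (real n + 1)) \<le> euler_mascheroni"
    using euler_mascheroni_lower[of k] by (simp add: k algebra_simps)
  moreover have "euler_mascheroni \<le> harm n - ln (real n + 1) + 1 / (2 * real n)"
    using euler_mascheroni_upper[of k] by (simp add: k algebra_simps)
  moreover have "1 / (2 * (real n + 1)) \<ge> 0" "1 / (2 * real n) \<le> 1 / real n"
    using assms by (auto simp: field_simps)
  ultimately show ?thesis by linarith
qed

text \<open>The reciprocals of the even numbers up to \<open>2 * n\<close> add up to half of
  \<open>harm n\<close>; removing them from \<open>harm (2 * n)\<close> leaves the odd ones.\<close>

lemma sum_odd_inverse: "(\<Sum>i<n. 1 / real (2 * i + 1)) = harm (2 * n) - harm n / 2"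
proof (induction n)
  case (Suc n)
  have "harm (2 * Suc n) = harm (2 * n) + 1 / real (2 * n + 1) + 1 / (2 * (real n + 1))"
    by (simp add: harm_Suc inverse_eq_divide algebra_simps)
  moreover have "harm (Suc n) = harm n + 1 / (real n + 1)"
    by (simp add: harm_Suc inverse_eq_divide algebra_simps)
  moreover have "1 / (2 * (real n + 1)) = 1 / (real n + 1) / 2" by simp
  ultimately have "harm (2 * Suc n) - harm (Suc n) / 2 = harm (2 * n) - harm n / 2 + 1 / real (2 * n + 1)"
    by (simp only: add_divide_distrib)
  thus ?case using Suc by simp
qed (simp add: harm_def)

lemma sum_odd_inverse_approx:
  assumes "n > 0"
  shows "\<bar>(\<Sum>i<n. 1 / real (2 * i + 1)) - (ln (2 * real n) + ln 2 + euler_mascheroni) / 2\<bar> \<le> 1 / real n"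
proof -
  have "ln (2 * real n) = ln 2 + ln (real n)" using assms by (simp add: ln_mult)
  moreover have "\<bar>harm (2 * n) - (euler_mascheroni + ln (2 * real n))\<bar> \<le> 1 / (2 * real n)"
    using harm_approx[of "2 * n"] assms by simp
  moreover have "1 / (2 * real n) = (1 / real n) / 2" by simp
  moreover have "\<bar>h' - h / 2 - (a + c + e) / 2\<bar> \<le> x"
    if "a = c + d" "\<bar>h' - (e + a)\<bar> \<le> y" "y = x / 2" "\<bar>h - (e + d)\<bar> \<le> x" for a c d e h h' x y :: real
    using that unfolding add_divide_distrib by (intro abs_leI) linarith+
  ultimately show ?thesis
    using harm_approx[OF assms] unfolding sum_odd_inverse by blast
qed

lemma sum_odd_inverse_upto:
  fixes y :: real
  assumes y: "y \<ge> 2" and n: "real n \<ge> y"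
  shows "\<bar>(\<Sum>i<n. if real (2 * i + 1) \<le> y then 1 / real (2 * i + 1) else 0)
      - (ln y + ln 2 + euler_mascheroni) / 2\<bar> \<le> 5 / y"
proof -
  \<comment> \<open>The number of odd positive integers not exceeding \<open>y\<close>.\<close>
  define k where "k = nat \<lfloor>(y + 1) / 2\<rfloor>"
  have k: "real k \<le> (y + 1) / 2" "(y + 1) / 2 < real k + 1"
    using y floor_correct[of "(y + 1) / 2"] by (auto simp: k_def)
  have "real k \<le> real n" using k n y unfolding add_divide_distrib by linarith
  hence "k \<le> n" by simp
  have "k > 0" using k y unfolding add_divide_distrib by linarith
  have *: "real (2 * i + 1) \<le> y \<longleftrightarrow> i < k" for i
  proof
    assume "real (2 * i + 1) \<le> y"
    hence "real i + 1 \<le> (y + 1) / 2" by (simp add: field_simps)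
    thus "i < k" using k by linarith
  next
    assume "i < k"
    hence "real i + 1 \<le> real k" by linarith
    thus "real (2 * i + 1) \<le> y" using k by simp
  qed
  have "(\<Sum>i<n. if real (2 * i + 1) \<le> y then 1 / real (2 * i + 1) else 0) =
      (\<Sum>i<k. 1 / real (2 * i + 1))"
    using \<open>k \<le> n\<close> unfolding * by (intro sum.mono_neutral_cong_right) auto
  moreover have "\<bar>ln (2 * real k) - ln y\<bar> \<le> \<bar>2 * real k - y\<bar> / (y / 2)"
    using k y by (intro ln_lipschitz) auto
  moreover have "\<bar>2 * real k - y\<bar> / (y / 2) \<le> 1 / (y / 2)"
    using k y by (intro divide_right_mono) auto
  moreover have "1 / real k \<le> 1 / (y / 4)"
    using k y by (intro divide_left_mono) auto
  moreover have "1 / (y / 4) = 4 / y" "1 / (y / 2) = 2 / y" "5 / y = 4 / y + (2 / y) / 2"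
    by (auto simp: field_simps)
  moreover have "\<bar>S - (a + c + e) / 2\<bar> \<le> t"
    if "S = S'" "\<bar>b - a\<bar> \<le> p" "p \<le> q" "r \<le> u" "u = u'" "q = q'" "t = u' + q' / 2"
      "\<bar>S' - (b + c + e) / 2\<bar> \<le> r" for S S' a b c e p q q' r t u u' :: real
    using that unfolding add_divide_distrib by (intro abs_leI) linarith+
  ultimately show ?thesis
    using sum_odd_inverse_approx[OF \<open>k > 0\<close>] by blast
qed

section \<open>Sums over odd integers as Riemann sums for the weight
  \<open>1 / u\<^sup>2\<close>\<close>

definition tail_integral :: "(real \<Rightarrow> real) \<Rightarrow> real \<Rightarrow> real" where
  "tail_integral \<Phi> x = (\<integral>u. indicator {x<..} u * (\<Phi> u / u\<^sup>2) \<partial>lborel)"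

context
  fixes \<Phi> :: "real \<Rightarrow> real" and C :: real
  assumes \<Phi>_measurable [measurable]: "\<Phi> \<in> borel_measurable borel"
    and C_nonneg: "C \<ge> 0"
    and \<Phi>_small: "\<And>u. 0 < u \<Longrightarrow> u < 1 \<Longrightarrow> \<bar>\<Phi> u\<bar> \<le> C * u\<^sup>2"
    and \<Phi>_large: "\<And>u. u \<ge> 1 \<Longrightarrow> \<bar>\<Phi> u\<bar> \<le> C * (1 + ln u)"
begin

lemma integrable_near_0:
  assumes "0 \<le> a" "a < 1"
  shows "integrable lborel (\<lambda>u. indicator {0<..a} u * (\<Phi> u / u\<^sup>2))"
    and "\<bar>\<integral>u. indicator {0<..a} u * (\<Phi> u / u\<^sup>2) \<partial>lborel\<bar> \<le> C * a"
proof -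
  have C: "integrable lborel (\<lambda>u. C * indicator {0<..a} u)"
    using assms by (intro integrable_mult_right integrable_real_indicator) auto
  have le: "norm (indicator {0<..a} u * (\<Phi> u / u\<^sup>2)) \<le> C * indicator {0<..a} u" for u
    using \<Phi>_small[of u] assms by (auto simp: indicator_def abs_mult field_simps)
  show int: "integrable lborel (\<lambda>u. indicator {0<..a} u * (\<Phi> u / u\<^sup>2))"
    by (intro Bochner_Integration.integrable_bound[OF C] AE_I2 order_trans[OF le]) (simp_all only: real_norm_def abs_ge_self, measurable)
  have "norm (\<integral>u. indicator {0<..a} u * (\<Phi> u / u\<^sup>2) \<partial>lborel) \<le> (\<integral>u. C * indicator {0<..a} u \<partial>lborel)"
    by (rule Bochner_Integration.integral_norm_bound_integral[OF int C le])
  thus "\<bar>\<integral>u. indicator {0<..a} u * (\<Phi> u / u\<^sup>2) \<partial>lborel\<bar> \<le> C * a"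
    using assms by simp
qed

lemma integrable_near_infinity:
  assumes "b \<ge> 1"
  shows "integrable lborel (\<lambda>u. indicator {b..} u * (\<Phi> u / u\<^sup>2))"
    and "\<bar>\<integral>u. indicator {b..} u * (\<Phi> u / u\<^sup>2) \<partial>lborel\<bar> \<le> C * ((2 + ln b) / b)"
proof -
  note * = log_over_square_has_integral[OF assms]
  have C: "integrable lborel (\<lambda>u. C * ((1 + ln u) / u\<^sup>2 * indicator {b..} u))"
    using * by (intro integrable_mult_right) (auto simp: has_bochner_integral_iff)
  have le: "norm (indicator {b..} u * (\<Phi> u / u\<^sup>2)) \<le> C * ((1 + ln u) / u\<^sup>2 * indicator {b..} u)" for u
    using \<Phi>_large[of u] assms by (auto simp: indicator_def abs_mult field_simps)
  show int: "integrable lborel (\<lambda>u. indicator {b..} u * (\<Phi> u / u\<^sup>2))"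
    by (intro Bochner_Integration.integrable_bound[OF C] AE_I2 order_trans[OF le]) (simp_all only: real_norm_def abs_ge_self, measurable)
  have "norm (\<integral>u. indicator {b..} u * (\<Phi> u / u\<^sup>2) \<partial>lborel) \<le>
      (\<integral>u. C * ((1 + ln u) / u\<^sup>2 * indicator {b..} u) \<partial>lborel)"
    by (rule Bochner_Integration.integral_norm_bound_integral[OF int C le])
  thus "\<bar>\<integral>u. indicator {b..} u * (\<Phi> u / u\<^sup>2) \<partial>lborel\<bar> \<le> C * ((2 + ln b) / b)"
    using * by (subst (asm) integral_mult_right_zero) (simp add: has_bochner_integral_iff)
qed

lemma integrable_over_square:
  "integrable lborel (\<lambda>u. indicator {0<..} u * (\<Phi> u / u\<^sup>2))"
proof -
  \<comment> \<open>\<open>integrable_near_0\<close> stops short of 1, where the quadratic bound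
    ends and \<Phi> may jump; this constant bound bridges the gap from 1/2 to 1.\<close>
  have "\<bar>\<Phi> u\<bar> \<le> C" if "u \<in> {1/2<..1}" for u
  proof (cases "u < 1")
    case True
    have "\<bar>\<Phi> u\<bar> \<le> C * u\<^sup>2" using \<Phi>_small[of u] that True by auto
    also have "\<dots> \<le> C * 1" using that C_nonneg True
      by (intro mult_left_mono power_le_one) auto
    finally show ?thesis by simp
  qed (use that \<Phi>_large[of u] in auto)
  hence le: "norm (indicator {1/2<..1} u * (\<Phi> u / u\<^sup>2)) \<le> C * (indicator {1/2<..1} u / u\<^sup>2)" for u
    by (auto simp: indicator_def abs_mult field_simps)
  have "integrable lborel (\<lambda>u::real. C * (indicator {1/2<..1} u / u\<^sup>2))"
    using inverse_square_has_integral[of "1/2" 1]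
    by (intro integrable_mult_right) (auto simp: has_bochner_integral_iff)
  hence "integrable lborel (\<lambda>u. indicator {1/2<..1} u * (\<Phi> u / u\<^sup>2))"
    by (rule Bochner_Integration.integrable_bound)
      (measurable, intro AE_I2 order_trans[OF le], simp only: real_norm_def abs_ge_self)
  hence "integrable lborel (\<lambda>u. indicator {0<..1/2} u * (\<Phi> u / u\<^sup>2) +
      indicator {1/2<..1} u * (\<Phi> u / u\<^sup>2) + indicator {1..} u * (\<Phi> u / u\<^sup>2))"
    by (intro Bochner_Integration.integrable_add integrable_near_0 integrable_near_infinity) auto
  thus ?thesis
  proof (rule integrable_cong_AE_imp)
    show "AE u in lborel. indicator {0<..1/2} u * (\<Phi> u / u\<^sup>2) +
      indicator {1/2<..1} u * (\<Phi> u / u\<^sup>2) + indicator {1..} u * (\<Phi> u / u\<^sup>2) =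
      indicator {0<..} u * (\<Phi> u / u\<^sup>2)"
      using AE_lborel_singleton[of 1] by eventually_elim (auto simp: indicator_def)
  qed auto
qed

lemma integrable_tail:
  assumes "x \<ge> 0"
  shows "integrable lborel (\<lambda>u. indicator {x<..} u * (\<Phi> u / u\<^sup>2))"
  by (rule Bochner_Integration.integrable_bound[OF integrable_over_square])
    (use assms in \<open>auto simp: indicator_def\<close>)

lemma tail_integral_diff:
  assumes "0 \<le> a" "a \<le> b"
  shows "integrable lborel (\<lambda>u. indicator {a<..b} u * (\<Phi> u / u\<^sup>2))"
    and "tail_integral \<Phi> a - tail_integral \<Phi> b = (\<integral>u. indicator {a<..b} u * (\<Phi> u / u\<^sup>2) \<partial>lborel)"
proof -
  have *: "(\<lambda>u. indicator {a<..b} u * (\<Phi> u / u\<^sup>2)) =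
      (\<lambda>u. indicator {a<..} u * (\<Phi> u / u\<^sup>2) - indicator {b<..} u * (\<Phi> u / u\<^sup>2))"
    using assms by (auto simp: indicator_def fun_eq_iff)
  show "integrable lborel (\<lambda>u. indicator {a<..b} u * (\<Phi> u / u\<^sup>2))"
    unfolding * using assms by (intro Bochner_Integration.integrable_diff integrable_tail) auto
  show "tail_integral \<Phi> a - tail_integral \<Phi> b = (\<integral>u. indicator {a<..b} u * (\<Phi> u / u\<^sup>2) \<partial>lborel)"
    unfolding * tail_integral_def using assms
    by (intro Bochner_Integration.integral_diff[symmetric] integrable_tail) auto
qed

lemma tail_integral_le:
  assumes "b \<ge> 1"
  shows "\<bar>tail_integral \<Phi> b\<bar> \<le> C * ((2 + ln b) / b)"
proof -
  have "tail_integral \<Phi> b = (\<integral>u. indicator {b..} u * (\<Phi> u / u\<^sup>2) \<partial>lborel)"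
    unfolding tail_integral_def
  proof (rule integral_cong_AE)
    show "AE u in lborel. indicator {b<..} u * (\<Phi> u / u\<^sup>2) = indicator {b..} u * (\<Phi> u / u\<^sup>2)"
      using AE_lborel_singleton[of b] by eventually_elim (auto simp: indicator_def)
  qed auto
  thus ?thesis using integrable_near_infinity(2)[OF assms] by simp
qed

lemma tail_integral_near_0:
  assumes "0 \<le> a" "a < 1"
  shows "\<bar>tail_integral \<Phi> 0 - tail_integral \<Phi> a\<bar> \<le> C * a"
  using tail_integral_diff(2)[of 0 a] integrable_near_0(2)[of a] assms by simp

text \<open>The sum over odd \<open>h\<close> of \<open>\<Phi> (s / h)\<close> is compared with the integral of \<open>\<Phi> u / u\<^sup>2\<close> directly in
  the variable \<open>u\<close>: between consecutive points \<open>s / (h + 2)\<close> and \<open>s / h\<close> the weight \<open>1 / u\<^sup>2\<close> has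
  mass \<open>2 / s\<close>, so no change of variables is needed.\<close>

lemma riemann_step:
  assumes "0 < a" "a \<le> b" and W: "\<And>u. a < u \<Longrightarrow> u \<le> b \<Longrightarrow> \<bar>\<Phi> b - \<Phi> u\<bar> \<le> W"
  shows "\<bar>\<Phi> b * (1 / a - 1 / b) - (tail_integral \<Phi> a - tail_integral \<Phi> b)\<bar> \<le> W * (1 / a - 1 / b)"
proof -
  note inv = inverse_square_has_integral[OF assms(1,2)]
  have int: "integrable lborel (\<lambda>u. \<Phi> b * (indicator {a<..b} u / u\<^sup>2) - indicator {a<..b} u * (\<Phi> u / u\<^sup>2))"
    using inv assms by (intro Bochner_Integration.integrable_diff integrable_mult_right tail_integral_diff)
      (auto simp: has_bochner_integral_iff)
  have "\<Phi> b * (1 / a - 1 / b) - (tail_integral \<Phi> a - tail_integral \<Phi> b) =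
      (\<integral>u. \<Phi> b * (indicator {a<..b} u / u\<^sup>2) \<partial>lborel) -
      (\<integral>u. indicator {a<..b} u * (\<Phi> u / u\<^sup>2) \<partial>lborel)"
    using assms inv
    by (subst integral_mult_right_zero) (simp add: tail_integral_diff has_bochner_integral_iff)
  also have "\<dots> = (\<integral>u. \<Phi> b * (indicator {a<..b} u / u\<^sup>2) - indicator {a<..b} u * (\<Phi> u / u\<^sup>2) \<partial>lborel)"
    using inv assms
    by (intro Bochner_Integration.integral_diff[symmetric] integrable_mult_right tail_integral_diff)
      (auto simp: has_bochner_integral_iff)
  also have "norm \<dots> \<le> (\<integral>u. W * (indicator {a<..b} u / u\<^sup>2) \<partial>lborel)"
  proof (rule Bochner_Integration.integral_norm_bound_integral[OF int])
    show "integrable lborel (\<lambda>u. W * (indicator {a<..b} u / u\<^sup>2))"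
      using inv by (intro integrable_mult_right) (auto simp: has_bochner_integral_iff)
    show "norm (\<Phi> b * (indicator {a<..b} u / u\<^sup>2) - indicator {a<..b} u * (\<Phi> u / u\<^sup>2))
        \<le> W * (indicator {a<..b} u / u\<^sup>2)" for u
      using W[of u] assms by (auto simp: indicator_def diff_divide_distrib[symmetric] divide_right_mono)
  qed
  also have "\<dots> = W * (1 / a - 1 / b)"
    using inv by (subst integral_mult_right_zero) (simp add: has_bochner_integral_iff)
  finally show ?thesis by simp
qed

text \<open>\<open>W\<close> is a decreasing function whose drop over an interval dominates the
  oscillation of \<Phi> there. Integrals over the cells are differences of
  \<open>tail_integral\<close> and the errors are differences of \<open>W\<close>, so both
  telescope. The sample points decrease with \<open>i\<close>. No continuity of \<Phi> is asumed,
  which matters since \<open>sym_f\<close> may jump at 1.\<close>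

lemma riemann_sum_bounded_variation:
  fixes s :: real and W :: "real \<Rightarrow> real" and x :: "nat \<Rightarrow> real"
  assumes s: "s > 0" and x: "\<And>i. x i = s / real (2 * i + 1)"
    and W: "\<And>u v. 0 < u \<Longrightarrow> u \<le> v \<Longrightarrow> \<bar>\<Phi> v - \<Phi> u\<bar> \<le> W u - W v"
  shows "\<bar>(\<Sum>i<n. \<Phi> (x i)) - s / 2 * (tail_integral \<Phi> (x n) - tail_integral \<Phi> (x 0))\<bar> \<le> W (x n) - W (x 0)"
proof (induction n)
  case (Suc n)
  have le: "0 < x (Suc n)" "x (Suc n) \<le> x n"
    using s by (auto simp: x intro!: divide_left_mono)
  have d: "1 / x (Suc n) - 1 / x n = 2 / s"
    using s by (simp add: x field_simps)
  have W': "\<bar>\<Phi> (x n) - \<Phi> u\<bar> \<le> W (x (Suc n)) - W (x n)" if "x (Suc n) < u" "u \<le> x n" for u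
  proof -
    have "\<bar>\<Phi> (x n) - \<Phi> u\<bar> \<le> W u - W (x n)" using that le by (intro W) auto
    also have "W u \<le> W (x (Suc n))" using W[of "x (Suc n)" u] that le by auto
    finally show ?thesis by simp
  qed
  have "\<bar>\<Phi> (x n) * (2 / s) - (tail_integral \<Phi> (x (Suc n)) - tail_integral \<Phi> (x n))\<bar>
      \<le> (W (x (Suc n)) - W (x n)) * (2 / s)"
    using riemann_step[OF le W'] unfolding d .
  hence "s / 2 * \<bar>\<Phi> (x n) * (2 / s) - (tail_integral \<Phi> (x (Suc n)) - tail_integral \<Phi> (x n))\<bar>
      \<le> s / 2 * ((W (x (Suc n)) - W (x n)) * (2 / s))"
    using s by (intro mult_left_mono) auto
  also have "s / 2 * ((W (x (Suc n)) - W (x n)) * (2 / s)) = W (x (Suc n)) - W (x n)"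
    using s by simp
  also have "s / 2 * \<bar>\<Phi> (x n) * (2 / s) - (tail_integral \<Phi> (x (Suc n)) - tail_integral \<Phi> (x n))\<bar> =
      \<bar>s / 2 * (\<Phi> (x n) * (2 / s) - (tail_integral \<Phi> (x (Suc n)) - tail_integral \<Phi> (x n)))\<bar>"
    using s by (simp add: abs_mult)
  also have "s / 2 * (\<Phi> (x n) * (2 / s) - (tail_integral \<Phi> (x (Suc n)) - tail_integral \<Phi> (x n))) =
      \<Phi> (x n) - s / 2 * (tail_integral \<Phi> (x (Suc n)) - tail_integral \<Phi> (x n))"
    using s by (simp add: algebra_simps)
  finally show ?case using Suc by (simp add: algebra_simps)
qed auto

end

section \<open>The sum of the symmetrised cumulant over odd integers\<close>

context centered_bounded_variable
begin

definition sym_f :: "real \<Rightarrow> real" where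
  "sym_f u = f_rv M Z N u + f_rv M Z N (- u)"

lemma sym_f_measurable [measurable]: "sym_f \<in> borel_measurable borel"
  unfolding sym_f_def by measurable

lemma sym_f_bound:
  obtains C where "C \<ge> 0" "\<And>t. 0 < t \<Longrightarrow> t < 1 \<Longrightarrow> \<bar>sym_f t\<bar> \<le> C * t\<^sup>2"
    "\<And>t. t \<ge> 1 \<Longrightarrow> \<bar>sym_f t\<bar> \<le> C * (1 + ln t)"
proof -
  obtain C where C: "C \<ge> 0" "\<And>t. \<bar>t\<bar> < 1 \<Longrightarrow> \<bar>f_rv M Z N t\<bar> \<le> C * t\<^sup>2"
    "\<And>t. \<bar>t\<bar> \<ge> 1 \<Longrightarrow> \<bar>f_rv M Z N t\<bar> \<le> C * (1 + ln \<bar>t\<bar>)"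
    using f_rv_bound by blast
  show ?thesis
  proof (rule that[of "2 * C"])
    fix t :: real assume "0 < t" "t < 1"
    thus "\<bar>sym_f t\<bar> \<le> 2 * C * t\<^sup>2"
      using C(2)[of t] C(2)[of "- t"] unfolding sym_f_def by (simp add: abs_if split: if_splits)
  next
    fix t :: real assume "t \<ge> 1"
    thus "\<bar>sym_f t\<bar> \<le> 2 * C * (1 + ln t)"
      using C(3)[of t] C(3)[of "- t"] unfolding sym_f_def
      by (simp add: abs_if algebra_simps split: if_splits)
  qed (use C in auto)
qed

lemma integral_f_rv: "(\<integral>u. f_rv M Z N u / u\<^sup>2 \<partial>lborel) = tail_integral sym_f 0"
proof -
  define q where "q = (\<lambda>u. f_rv M Z N u / u\<^sup>2)"
  obtain C where C: "C \<ge> 0" "\<And>t. \<bar>t\<bar> < 1 \<Longrightarrow> \<bar>f_rv M Z N t\<bar> \<le> C * t\<^sup>2"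
    "\<And>t. \<bar>t\<bar> \<ge> 1 \<Longrightarrow> \<bar>f_rv M Z N t\<bar> \<le> C * (1 + ln \<bar>t\<bar>)"
    using f_rv_bound by blast
  have pos: "integrable lborel (\<lambda>u. indicator {0<..} u * q u)"
    unfolding q_def
  proof (rule integrable_over_square[of _ C])
    show "\<bar>f_rv M Z N u\<bar> \<le> C * (1 + ln u)" if "u \<ge> 1" for u
      using C(3)[of u] that by simp
  qed (use C in auto)
  have neg: "integrable lborel (\<lambda>u. indicator {0<..} u * q (- u))"
  proof -
    have "integrable lborel (\<lambda>u. indicator {0<..} u * (f_rv M Z N (- u) / u\<^sup>2))"
    proof (rule integrable_over_square[of _ C])
      show "\<bar>f_rv M Z N (- u)\<bar> \<le> C * (1 + ln u)" if "u \<ge> 1" for u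
        using C(3)[of "- u"] that by simp
      show "\<bar>f_rv M Z N (- u)\<bar> \<le> C * u\<^sup>2" if "0 < u" "u < 1" for u
        using C(2)[of "- u"] that by simp
    qed (use C in auto)
    thus ?thesis by (simp add: q_def)
  qed
  have neg': "integrable lborel (\<lambda>u. indicator {..<0} u * q u)"
  proof -
    have "integrable lborel (\<lambda>u. indicator {0<..} (0 + (-1) * u) * q (- (0 + (-1) * u)))"
      by (rule lborel_integrable_real_affine[OF neg]) auto
    also have "(\<lambda>u. indicator {0<..} (0 + (-1) * u) * q (- (0 + (-1) * u))) =
        (\<lambda>u. indicator {..<0} u * q u)"
      by (auto simp: indicator_def)
    finally show ?thesis .
  qed
  \<comment> \<open>At \<open>u = 0\<close> both integrands vanish, because division by zero yields
    0.\<close>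
  have "(\<integral>u. q u \<partial>lborel) = (\<integral>u. indicator {0<..} u * q u + indicator {..<0} u * q u \<partial>lborel)"
    by (intro Bochner_Integration.integral_cong) (auto simp: indicator_def q_def)
  also have "\<dots> = (\<integral>u. indicator {0<..} u * q u \<partial>lborel) + (\<integral>u. indicator {..<0} u * q u \<partial>lborel)"
    by (intro Bochner_Integration.integral_add pos neg')
  also have "(\<integral>u. indicator {..<0} u * q u \<partial>lborel) =
      (\<integral>u. indicator {..<0} (0 + (-1) * u) * q (0 + (-1) * u) \<partial>lborel)"
    by (subst lborel_integral_real_affine[of "-1" _ 0]) auto
  also have "(\<lambda>u. indicator {..<0} (0 + (-1) * u) * q (0 + (-1) * u)) = (\<lambda>u. indicator {0<..} u * q (- u))"
    by (auto simp: indicator_def)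
  also have "(\<integral>u. indicator {0<..} u * q u \<partial>lborel) + (\<integral>u. indicator {0<..} u * q (- u) \<partial>lborel) =
      (\<integral>u. indicator {0<..} u * q u + indicator {0<..} u * q (- u) \<partial>lborel)"
    by (intro Bochner_Integration.integral_add[symmetric] pos neg)
  also have "\<dots> = tail_integral sym_f 0"
    unfolding tail_integral_def
    by (intro Bochner_Integration.integral_cong) (auto simp: indicator_def q_def sym_f_def add_divide_distrib)
  finally show ?thesis by (simp add: q_def)
qed

text \<open>The constant D of the cumulant asymptotics: \<gamma> comes from the harmonic sum over
  odd integers, \<open>ln (2 / pi)\<close> from the \<open>ln 2\<close> of that sum and the cutoff
  \<open>s / pi\<close>, and the integral from the Riemann sum of \<open>sym_f\<close>.\<close>

definition saddle_const :: real where
  "saddle_const = euler_mascheroni + ln (2 / pi) + (\<integral>u. f_rv M Z N u / u\<^sup>2 \<partial>lborel) / (2 * N)"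

lemma sym_f_eq: "0 < u \<Longrightarrow> sym_f u = (if u < 1 then sym_log_mgf u else sym_log_mgf u - 2 * N * u)"
  unfolding sym_f_def by (rule f_rv_sym)

text \<open>Below 1 the Lipschitz constant \<open>2 * N\<close> supplies a linear \<open>W\<close>.
  From 1 on, subtracting \<open>2 * N * u\<close> makes \<open>sym_f\<close> nonincreasing, so it
  can serve as its own \<open>W\<close>. The shift by \<open>4 * N\<close> lets \<open>W\<close>
  drop far enough at 1 to dominate the jump of \<open>sym_f\<close>.\<close>

lemma sym_f_variation:
  assumes "0 < u" "u \<le> v"
  defines "W \<equiv> \<lambda>u. if u < 1 then - 2 * N * u else sym_f u - 4 * N"
  shows "\<bar>sym_f v - sym_f u\<bar> \<le> W u - W v"
proof -
  have lip: "\<bar>sym_log_mgf v - sym_log_mgf u\<bar> \<le> 2 * N * v - 2 * N * u"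
    using sym_log_mgf_lipschitz[of v u] assms by (simp add: algebra_simps)
  have v: "sym_log_mgf v \<le> 2 * N * v" and u: "sym_log_mgf u \<le> 2 * N * u" "sym_log_mgf u \<ge> 0"
    using sym_log_mgf_lipschitz[of v 0] sym_log_mgf_lipschitz[of u 0] sym_log_mgf_nonneg[of u] assms
    by (auto simp: sym_log_mgf_def)
  have "N * u \<le> N * 1" if "u < 1" using that N_pos by (intro mult_left_mono) auto
  thus ?thesis
    using assms lip v u by (auto simp: W_def sym_f_eq)
qed

text \<open>Put \<open>y = s / pi\<close>. The arguments \<open>y / h\<close> with
  \<open>h \<le> y\<close> are at least 1; splitting off the linear part
  \<open>2 * N * y / h\<close> there gives a harmonic sum over odd \<open>h \<le> y\<close>, the
  source of the term \<open>s * ln s\<close>, with a bounded error. What remains is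
  \<open>sym_f\<close>, whose sum is \<open>y / 2\<close> times its integral up to its variation,
  which is \<open>O(ln s)\<close>.\<close>

lemma sym_log_mgf_odd_sum:
  obtains C where "C \<ge> 0"
    "\<And>s n. s \<ge> 8 \<Longrightarrow> real n \<ge> s\<^sup>2 \<Longrightarrow>
      \<bar>(\<Sum>i<n. sym_log_mgf (s / (pi * real (2 * i + 1)))) - N / pi * s * (ln s + saddle_const)\<bar> \<le> C * ln s"
proof -
  obtain C where C: "C \<ge> 0" "\<And>t. 0 < t \<Longrightarrow> t < 1 \<Longrightarrow> \<bar>sym_f t\<bar> \<le> C * t\<^sup>2"
    "\<And>t. t \<ge> 1 \<Longrightarrow> \<bar>sym_f t\<bar> \<le> C * (1 + ln t)"
    using sym_f_bound by blast
  note rules = sym_f_measurable C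
  show ?thesis
  proof (rule that[of "6 * C + 14 * N"])
    fix s :: real and n :: nat assume s: "s \<ge> 8" and n: "real n \<ge> s\<^sup>2"
    define y where "y = s / pi"
    define x where "x = (\<lambda>i. y / real (2 * i + 1))"
    define W where "W = (\<lambda>u. if u < 1 then - 2 * N * u else sym_f u - 4 * N)"
    define Q where "Q = tail_integral sym_f"
    have y: "y \<ge> 2" "y \<le> s"
      using s pi_less_4 pi_gt3 by (auto simp: y_def field_simps)
    have lny: "ln y \<le> ln s" using y by simp
    have ln_s: "ln s \<ge> 1"
    proof -
      have "exp 1 \<le> s" using exp_le s by linarith
      thus ?thesis using s by (metis exp_gt_zero ln_exp ln_mono)
    qed
    have yn: "y * y \<le> real n"
      using y n mult_mono[of y s y s] by (simp add: power2_eq_square)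
    have yn': "y \<le> real n" using yn y mult_right_mono[of 1 y y] by linarith
    have xn: "0 < x n" "x n < 1" using y yn' by (auto simp: x_def field_simps)
    have x0: "x 0 = y" by (simp add: x_def)
    have 1: "\<bar>(\<Sum>i<n. sym_f (x i)) - y / 2 * (Q (x n) - Q y)\<bar> \<le> W (x n) - W y"
      using riemann_sum_bounded_variation[OF rules, of y x W n] y sym_f_variation
      by (simp add: x_def W_def Q_def)
    have 2: "W (x n) - W y \<le> C * (1 + ln s) + 4 * N"
    proof -
      have "W (x n) \<le> 0" using xn N_pos by (simp add: W_def)
      moreover have "- W y \<le> C * (1 + ln y) + 4 * N" using y C(3)[of y] by (simp add: W_def)
      moreover have "C * (1 + ln y) \<le> C * (1 + ln s)" using C lny by (intro mult_left_mono) auto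
      ultimately show ?thesis by linarith
    qed
    \<comment> \<open>The integral below the last sample point \<open>x n\<close>. Its size is about
      \<open>y * y / n\<close>, which is why \<open>n\<close> must reach the order of
      \<open>s\<^sup>2\<close>.\<close>
    have 3: "\<bar>y / 2 * (Q 0 - Q (x n))\<bar> \<le> C"
    proof -
      have "\<bar>y / 2 * (Q 0 - Q (x n))\<bar> = y / 2 * \<bar>Q 0 - Q (x n)\<bar>"
        using y by (simp add: abs_mult)
      also have "\<dots> \<le> y / 2 * (C * x n)"
        using y xn tail_integral_near_0[OF rules, of "x n"] by (intro mult_left_mono) (auto simp: Q_def)
      also have "\<dots> = C * ((y * y) / (2 * real (2 * n + 1)))" by (simp add: x_def)
      also have "\<dots> \<le> C * 1"
        using yn C by (intro mult_left_mono) (auto simp: field_simps)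
      finally show ?thesis by simp
    qed
    have 4: "\<bar>y / 2 * Q y\<bar> \<le> C * (2 + ln s)"
    proof -
      have "\<bar>y / 2 * Q y\<bar> = y / 2 * \<bar>Q y\<bar>" using y by (simp add: abs_mult)
      also have "\<dots> \<le> y / 2 * (C * ((2 + ln y) / y))"
        using y tail_integral_le[OF rules, of y] by (intro mult_left_mono) (auto simp: Q_def)
      also have "\<dots> = C * ((2 + ln y) / 2)" using y by simp
      also have "\<dots> \<le> C * (2 + ln s)" using C lny ln_s by (intro mult_left_mono) auto
      finally show ?thesis .
    qed
    define H where "H = (\<Sum>i<n. if real (2 * i + 1) \<le> y then 1 / real (2 * i + 1) else 0)"
    define l where "l = ln y + ln 2 + euler_mascheroni"
    have 5: "\<bar>2 * N * y * H - N * y * l\<bar> \<le> 10 * N"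
    proof -
      have "\<bar>2 * N * y * H - N * y * l\<bar> = 2 * N * y * \<bar>H - l / 2\<bar>"
      proof -
        have "2 * N * y * H - N * y * l = 2 * N * y * (H - l / 2)" by (simp add: algebra_simps)
        thus ?thesis using N_pos y by (simp add: abs_mult)
      qed
      also have "\<dots> \<le> 2 * N * y * (5 / y)"
        using sum_odd_inverse_upto[OF y(1) yn'] N_pos y
        unfolding H_def l_def by (intro mult_left_mono) auto
      finally show ?thesis using y by simp
    qed
    have "sym_log_mgf (x i) = sym_f (x i) + 2 * N * y * (if real (2 * i + 1) \<le> y then 1 / real (2 * i + 1) else 0)" for i
    proof -
      have "0 < x i" using y by (simp add: x_def)
      moreover have "x i < 1 \<longleftrightarrow> \<not> real (2 * i + 1) \<le> y" by (auto simp: x_def divide_less_eq_1)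
      ultimately show ?thesis by (auto simp: sym_f_eq) (auto simp: x_def)
    qed
    hence 6: "(\<Sum>i<n. sym_log_mgf (x i)) = (\<Sum>i<n. sym_f (x i)) + 2 * N * y * H"
      by (simp add: sum.distrib sum_distrib_left H_def)
    have 7: "N * y * l + y / 2 * Q 0 = N / pi * s * (ln s + saddle_const)"
    proof -
      have "ln y = ln s - ln pi" "ln (2 / pi) = ln 2 - ln pi" using s by (simp_all add: y_def ln_div)
      hence "ln s + saddle_const = l + Q 0 / (2 * N)"
        by (simp add: saddle_const_def integral_f_rv Q_def l_def)
      moreover have "N / pi * s * (l + Q 0 / (2 * N)) = N * y * l + y / 2 * Q 0"
        using N_pos by (simp add: y_def field_simps)
      ultimately show ?thesis by simp
    qed
    have triangle: "\<bar>S - T\<bar> \<le> c1 + c2 + c3 + c4"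
      if "\<bar>A - P\<bar> \<le> w" "w \<le> c1" "\<bar>a\<bar> \<le> c2" "\<bar>b\<bar> \<le> c3" "\<bar>h - e\<bar> \<le> c4"
        "P = q - a - b" "S = A + h" "e + q = T" for S T A P w a b h e q c1 c2 c3 c4 :: real
      using that by (intro abs_leI) linarith+
    have "y / 2 * (Q (x n) - Q y) = y / 2 * Q 0 - y / 2 * (Q 0 - Q (x n)) - y / 2 * Q y"
      by (simp add: algebra_simps)
    hence "\<bar>(\<Sum>i<n. sym_log_mgf (x i)) - N / pi * s * (ln s + saddle_const)\<bar>
        \<le> C * (1 + ln s) + 4 * N + C + C * (2 + ln s) + 10 * N"
      by (intro triangle[OF 1 2 3 4 5 _ 6 7])
    also have "\<dots> \<le> (6 * C + 14 * N) * ln s"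
    proof -
      have "C * 1 \<le> C * ln s" "N * 1 \<le> N * ln s"
        using C N_pos ln_s by (intro mult_left_mono; simp)+
      thus ?thesis by (simp add: algebra_simps)
    qed
    finally show "\<bar>(\<Sum>i<n. sym_log_mgf (s / (pi * real (2 * i + 1)))) - N / pi * s * (ln s + saddle_const)\<bar>
        \<le> (6 * C + 14 * N) * ln s"
      by (simp add: x_def y_def)
  qed (use C N_pos in auto)
qed

end

section \<open>Fourier coefficients of the half sum\<close>

text \<open>The imaginary part of the normalised Fourier sum of the indicator of the half interval.
  The factor \<open>1 / real m\<close> unites the two factors \<open>1 / sqrt (real m)\<close>, one
  from the inversion formula and one from \<open>half_sum\<close>.\<close>

definition half_coeff :: "nat \<Rightarrow> int \<Rightarrow> real" where
  "half_coeff m h = (\<Sum>n\<in>{0..\<lfloor>real m / 2\<rfloor>}. sin (2 * pi * (real_of_int (h * n) / real m))) / real m"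

text \<open>The residues modulo \<open>m\<close> represented symmetrically, without 0 and
  \<open>m / 2\<close>. At these two \<open>half_coeff\<close> vanishes, and the rest splits into
  pairs \<open>h\<close>, \<open>- h\<close>.\<close>

definition freqs :: "nat \<Rightarrow> int set" where
  "freqs m = {h. h \<noteq> 0 \<and> 2 * \<bar>h\<bar> < int m}"

lemma finite_freqs [simp]: "finite (freqs m)"
  by (rule finite_subset[of _ "{- int m..int m}"]) (auto simp: freqs_def)

lemma floor_half: "\<lfloor>real m / 2\<rfloor> = int (m div 2)"
  using floor_divide_of_nat_eq[of m 2, where 'a = real] by simp

lemma half_coeff_minus: "half_coeff m (- h) = - half_coeff m h"
  by (simp add: half_coeff_def sum_negf)

lemma sum_sin_telescope:
  "2 * sin (x / 2) * (\<Sum>n\<in>{0..int k}. sin (x * of_int n)) = cos (x / 2) - cos ((real k + 1 / 2) * x)"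
proof (induction k)
  case (Suc k)
  have "{0..int (Suc k)} = insert (int (Suc k)) {0..int k}" by auto
  hence "2 * sin (x / 2) * (\<Sum>n\<in>{0..int (Suc k)}. sin (x * of_int n)) =
      2 * sin (x / 2) * sin (x * (real k + 1)) + (cos (x / 2) - cos ((real k + 1 / 2) * x))"
    using Suc by (simp add: algebra_simps)
  also have "2 * sin (x / 2) * sin (x * (real k + 1)) =
      cos (x * (real k + 1) - x / 2) - cos (x * (real k + 1) + x / 2)"
    by (simp add: cos_add cos_diff)
  also have "x * (real k + 1) - x / 2 = (real k + 1 / 2) * x" by (simp add: field_simps)
  also have "x * (real k + 1) + x / 2 = (real (Suc k) + 1 / 2) * x" by (simp add: field_simps)
  finally show ?case by simp
qed auto

lemma half_coeff_closed_form:
  assumes "m > 0"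
  shows "2 * real m * sin (pi * of_int h / real m) * half_coeff m h =
    cos (pi * of_int h / real m) - cos (real (2 * (m div 2) + 1) * (pi * of_int h / real m))"
proof -
  define x where "x = 2 * pi * of_int h / real m"
  have x2: "x / 2 = pi * of_int h / real m" by (simp add: x_def)
  have "2 * real m * sin (x / 2) * half_coeff m h =
      2 * sin (x / 2) * (\<Sum>n\<in>{0..int (m div 2)}. sin (x * of_int n))"
    using assms by (simp add: half_coeff_def floor_half x_def mult_ac)
  also have "\<dots> = cos (x / 2) - cos ((real (m div 2) + 1 / 2) * x)"
    by (rule sum_sin_telescope)
  also have "(real (m div 2) + 1 / 2) * x = real (2 * (m div 2) + 1) * (x / 2)"
    by (simp add: algebra_simps)
  finally show ?thesis by (simp add: x2)
qed

lemma cot_bounds: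
  fixes z :: real
  assumes "0 < z" "z < pi / 2"
  shows "0 \<le> cos z / sin z" "cos z / sin z \<le> 1 / z" "1 / z - z \<le> cos z / sin z"
proof -
  have s: "sin z > 0" and c: "cos z > 0"
    using assms by (auto intro: sin_gt_zero2 cos_gt_zero)
  show "0 \<le> cos z / sin z" using s c by simp
  have "z \<le> tan z"
    using arctan_le_self[of "tan z"] arctan_tan[of z] tan_gt_zero[of z] assms by auto
  hence "z * cos z \<le> sin z" using c by (simp add: tan_def field_simps)
  thus "cos z / sin z \<le> 1 / z" using s assms by (simp add: field_simps)
  \<comment> \<open>The lower bound with denominators cleared. Up to 1 it follows from
    \<open>sin z \<le> z\<close> and \<open>1 - z * z \<le> cos z\<close>; beyond 1 the left side is
    not positive.\<close>
  have "(1 - z * z) * sin z \<le> z * cos z"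
  proof (cases "z \<le> 1")
    case True
    have "sin z \<le> z" using assms by (intro sin_x_le_x) auto
    hence "(1 - z * z) * sin z \<le> (1 - z * z) * z"
      using True assms by (intro mult_left_mono) (auto simp: mult_le_one)
    also have "\<dots> \<le> cos z * z"
    proof (intro mult_right_mono)
      have "(sin (z / 2))\<^sup>2 \<le> (z / 2)\<^sup>2"
        using abs_sin_x_le_abs_x[of "z / 2"] by (simp only: abs_le_square_iff)
      moreover have "cos z = 1 - 2 * (sin (z / 2))\<^sup>2" using cos_double_sin[of "z / 2"] by simp
      moreover have "2 * (z / 2)\<^sup>2 \<le> z * z" by (simp add: power2_eq_square)
      ultimately show "1 - z * z \<le> cos z" by linarith
    qed (use assms in auto)
    finally show ?thesis by (simp add: mult.commute)
  next
    case False
    hence "1 - z * z \<le> 0" using mult_mono[of 1 z 1 z] by auto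
    hence "(1 - z * z) * sin z \<le> 0" using s by (intro mult_nonpos_nonneg) auto
    also have "0 \<le> z * cos z" using assms c by simp
    finally show ?thesis .
  qed
  thus "1 / z - z \<le> cos z / sin z"
    using s assms by (simp add: field_simps)
qed

lemma cos_int_pi: "cos (pi * of_int h) = (if even h then 1 else -1)"
proof (cases "even h")
  case True
  then obtain k where "h = 2 * k" by blast
  thus ?thesis using cos_int_2pin[of k] by (simp add: mult_ac)
next
  case False
  then obtain k where k: "h = 2 * k + 1" by (elim oddE)
  have "cos (pi * of_int h) = cos (pi + 2 * pi * of_int k)"
    by (simp add: k algebra_simps)
  also have "\<dots> = -1" using cos_int_2pin[of k] by (simp add: cos_add)
  finally show ?thesis using False by simp
qed

lemma sin_int_pi: "sin (pi * of_int h) = 0"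
  by (metis mult.commute sin_npi_int)

text \<open>The number \<open>2 * (m div 2) + 1\<close> is \<open>m + 1\<close> or \<open>m\<close>,
  so the second cosine of the closed form is \<open>cos z\<close> or 1 up to the sign given by the
  parity of \<open>h\<close>. For odd \<open>m\<close> the half-angle formulas simplify the
  quotient.\<close>

lemma half_coeff_cases:
  assumes h: "1 \<le> h" "2 * h < int m"
  defines "z \<equiv> pi * of_int h / real m"
  shows "half_coeff m h =
    (if even m then if even h then 0 else cos z / sin z / real m
     else if even h then - (sin (z / 2) / cos (z / 2)) / (2 * real m)
     else cos (z / 2) / sin (z / 2) / (2 * real m))"
proof -
  have m: "m > 0" using h by auto
  have z: "0 < z" "z < pi / 2"
  proof -
    have "2 * of_int h < real m" using h by linarith
    thus "0 < z" "z < pi / 2" using h m by (auto simp: z_def field_simps)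
  qed
  have s: "sin z > 0" "sin (z / 2) > 0" "cos (z / 2) > 0"
    using z by (auto intro: sin_gt_zero2 cos_gt_zero)
  have eq: "half_coeff m h = (cos z - cos (real (2 * (m div 2) + 1) * z)) / (2 * real m * sin z)"
    using half_coeff_closed_form[OF m, of h] s m by (simp add: z_def field_simps)
  have w: "sin z = 2 * sin (z / 2) * cos (z / 2)" "cos z = 2 * (cos (z / 2))\<^sup>2 - 1"
    "cos z = 1 - 2 * (sin (z / 2))\<^sup>2"
    using sin_double[of "z / 2"] cos_double_cos[of "z / 2"] cos_double_sin[of "z / 2"] by auto
  show ?thesis
  proof (cases "even m")
    case True
    hence "real (2 * (m div 2) + 1) * z = pi * of_int h + z"
      using m by (auto simp: z_def field_simps elim!: evenE)
    hence "cos (real (2 * (m div 2) + 1) * z) = cos (pi * of_int h) * cos z"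
      by (simp add: cos_add sin_int_pi)
    thus ?thesis using True s m by (auto simp: eq cos_int_pi field_simps)
  next
    case False
    hence "real (2 * (m div 2) + 1) * z = pi * of_int h"
      using m by (auto simp: z_def field_simps elim!: oddE)
    hence "half_coeff m h = (cos z - (if even h then 1 else -1)) / (2 * real m * sin z)"
      by (simp add: eq cos_int_pi)
    also have "\<dots> = (if even h then - (sin (z / 2) / cos (z / 2)) / (2 * real m)
       else cos (z / 2) / sin (z / 2) / (2 * real m))"
    proof (cases "even h")
      case True
      have "cos z - 1 = - 2 * (sin (z / 2))\<^sup>2" using w(3) by simp
      hence "(cos z - (if even h then 1 else -1)) / (2 * real m * sin z) =
          (- 2 * (sin (z / 2))\<^sup>2) / (2 * real m * (2 * sin (z / 2) * cos (z / 2)))"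
        using True w(1) by simp
      thus ?thesis using True s m by (simp add: field_simps power2_eq_square)
    next
      case False
      have "cos z + 1 = 2 * (cos (z / 2))\<^sup>2" using w(2) by simp
      hence "(cos z - (if even h then 1 else -1)) / (2 * real m * sin z) =
          (2 * (cos (z / 2))\<^sup>2) / (2 * real m * (2 * sin (z / 2) * cos (z / 2)))"
        using False w(1) by simp
      thus ?thesis using False s m by (simp add: field_simps power2_eq_square)
    qed
    finally show ?thesis using False by simp
  qed
qed

text \<open>The first bound compares with the limiting coefficient and is used for \<open>h\<close>
  up to a power of \<open>ln m\<close>, where the errors are negligible in total. The crude second
  bound serves for the remaining \<open>h\<close> and for the sum of absolute values.\<close>

lemma half_coeff_bounds:
  assumes h: "1 \<le> h" "2 * h < int m"
  shows "\<bar>half_coeff m h - (if odd h then 1 / (pi * of_int h) else 0)\<bar> \<le> pi * of_int h / (real m)\<^sup>2"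
    and "\<bar>half_coeff m h\<bar> \<le> 1 / of_int h"
proof -
  define z where "z = pi * of_int h / real m"
  have m: "m > 0" using h by auto
  have hm: "2 * of_int h < real m" using h by linarith
  have z: "0 < z" "z < pi / 2"
    using h m hm by (auto simp: z_def field_simps)
  have hpos: "0 < real_of_int h" using h by auto
  \<comment> \<open>Even and odd \<open>m\<close> are treated together: the coefficient is
    \<open>cot y / c\<close> with \<open>(y, c)\<close> equal to \<open>(z, m)\<close> or
    \<open>(z / 2, 2 m)\<close>, and in both cases \<open>c * y = pi * h\<close>.\<close>
  have odd_case: "\<bar>cos y / sin y / c - 1 / (pi * of_int h)\<bar> \<le> pi * of_int h / (real m)\<^sup>2 \<and>
      \<bar>cos y / sin y / c\<bar> \<le> 1 / of_int h"
    if y: "0 < y" "y < pi / 2" and c: "c \<ge> real m" "c * y = pi * of_int h" for y c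
  proof -
    have c0: "c > 0" using c m by linarith
    have y_eq: "y = pi * of_int h / c" using c c0 by (simp add: field_simps)
    have 1: "cos y / sin y / c \<le> 1 / (pi * of_int h)"
    proof -
      have "cos y / sin y / c \<le> 1 / y / c"
        using cot_bounds(2)[OF y] c0 by (intro divide_right_mono) auto
      thus ?thesis using c by (simp add: mult.commute)
    qed
    have 2: "1 / (pi * of_int h) - pi * of_int h / (real m)\<^sup>2 \<le> cos y / sin y / c"
    proof -
      have "1 / (pi * of_int h) - y / c = (1 / y - y) / c"
        using c c0 by (simp add: diff_divide_distrib mult.commute)
      also have "\<dots> \<le> cos y / sin y / c"
        using cot_bounds(3)[OF y] c0 by (intro divide_right_mono) auto
      finally have "1 / (pi * of_int h) - y / c \<le> cos y / sin y / c" .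
      moreover have "y / c = pi * of_int h / (c * c)" by (simp add: y_eq)
      moreover have "pi * of_int h / (c * c) \<le> pi * of_int h / (real m)\<^sup>2"
        unfolding power2_eq_square using c m hpos by (intro divide_left_mono mult_mono) auto
      ultimately show ?thesis by linarith
    qed
    have 3: "0 \<le> cos y / sin y / c" using cot_bounds(1)[OF y] c0 by (rule divide_nonneg_pos)
    have "1 / (pi * of_int h) \<le> 1 / (1 * of_int h)"
      using hpos pi_gt3 by (intro divide_left_mono mult_right_mono) auto
    moreover have "0 \<le> pi * of_int h / (real m)\<^sup>2" using hpos by simp
    ultimately show ?thesis using 1 2 3 by (intro conjI abs_leI) linarith+
  qed
  have even_case: "\<bar>sin (z / 2) / cos (z / 2) / (2 * real m)\<bar> \<le> pi * of_int h / (2 * (real m)\<^sup>2)"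
  proof -
    have "cos (pi / 3) \<le> cos (z / 2)" using z by (intro cos_monotone_0_pi_le) auto
    hence c: "1 / 2 \<le> cos (z / 2)" by (simp add: cos_60)
    have s: "0 \<le> sin (z / 2)" using z by (intro sin_ge_zero) auto
    have "sin (z / 2) / cos (z / 2) \<le> (z / 2) / (1 / 2)"
      using c s z by (intro frac_le sin_x_le_x) auto
    hence "sin (z / 2) / cos (z / 2) / (2 * real m) \<le> z / (2 * real m)"
      using m by (intro divide_right_mono) auto
    also have "\<dots> = pi * of_int h / (2 * (real m)\<^sup>2)" by (simp add: z_def power2_eq_square)
    finally show ?thesis using c s by simp
  qed
  have even2: "pi * of_int h / (2 * (real m)\<^sup>2) \<le> pi * of_int h / (real m)\<^sup>2"
    using hpos m by (intro divide_left_mono) auto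
  have even3: "pi * of_int h / (2 * (real m)\<^sup>2) \<le> 1 / of_int h"
  proof -
    have "(2 * of_int h) * (2 * of_int h) \<le> real m * real m" using hm hpos by (intro mult_mono) auto
    hence "pi * (of_int h * of_int h) \<le> 4 * ((real m)\<^sup>2 / 4)"
      using pi_less_4 hpos by (intro mult_mono) (auto simp: power2_eq_square)
    also have "\<dots> \<le> 2 * (real m)\<^sup>2" by simp
    finally show ?thesis using hpos m by (simp add: field_simps)
  qed
  have z2: "0 < z / 2" "z / 2 < pi / 2" using z by auto
  have mz: "real m * z = pi * of_int h" "2 * real m * (z / 2) = pi * of_int h"
    using m by (auto simp: z_def)
  define q1 where "q1 = cos z / sin z / real m"
  define q2 where "q2 = cos (z / 2) / sin (z / 2) / (2 * real m)"
  define q3 where "q3 = sin (z / 2) / cos (z / 2) / (2 * real m)"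
  have eq: "half_coeff m h = (if even m then if even h then 0 else q1 else if even h then - q3 else q2)"
    using half_coeff_cases[OF h] by (simp add: q1_def q2_def q3_def z_def)
  have "real m \<le> 2 * real m" by simp
  note q = odd_case[OF z order_refl mz(1), folded q1_def] odd_case[OF z2 this mz(2), folded q2_def]
    order_trans[OF even_case even2, folded q3_def] order_trans[OF even_case even3, folded q3_def]
  have nn: "0 \<le> pi * of_int h / (real m)\<^sup>2" "0 \<le> 1 / real_of_int h" using hpos by auto
  show "\<bar>half_coeff m h - (if odd h then 1 / (pi * of_int h) else 0)\<bar> \<le> pi * of_int h / (real m)\<^sup>2"
    using q nn by (simp add: eq)
  show "\<bar>half_coeff m h\<bar> \<le> 1 / of_int h"
    using q nn by (simp add: eq)
qed

section \<open>Discrete Fourier inversion\<close>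

definition unit_exp :: "nat \<Rightarrow> int \<Rightarrow> complex" where
  "unit_exp m j = cis (2 * pi * (of_int j / real m))"

lemma fourier_eq_unit_exp:
  "fourier m \<phi> h = complex_of_real (1 / sqrt (real m)) * (\<Sum>n\<in>{0..<int m}. \<phi> n * unit_exp m (h * n))"
proof -
  have "exp (2 * complex_of_real pi * \<i> * (of_int j / of_nat m)) = unit_exp m j" for j
  proof -
    have "2 * complex_of_real pi * \<i> * (of_int j / of_nat m) =
        \<i> * complex_of_real (2 * pi * (of_int j / real m))" by simp
    thus ?thesis unfolding unit_exp_def cis_conv_exp by (simp only:)
  qed
  thus ?thesis by (simp only: fourier_def)
qed

lemma unit_exp_add: "unit_exp m (i + j) = unit_exp m i * unit_exp m j"
  by (simp add: unit_exp_def cis_mult distrib_left add_divide_distrib)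

lemma unit_exp_period: "m > 0 \<Longrightarrow> unit_exp m (int m * j) = 1"
  by (simp add: unit_exp_def)

lemma unit_exp_eq_1_iff:
  assumes "m > 0"
  shows "unit_exp m j = 1 \<longleftrightarrow> int m dvd j"
proof
  assume "unit_exp m j = 1"
  hence "cos (2 * pi * (of_int j / real m)) = 1" by (simp add: unit_exp_def complex_eq_iff)
  then obtain k :: int where "2 * pi * (of_int j / real m) = of_int k * 2 * pi"
    using cos_one_2pi_int by blast
  hence "real_of_int j = of_int (k * int m)" using assms by (simp add: field_simps)
  hence "j = k * int m" by linarith
  thus "int m dvd j" by simp
qed (use assms unit_exp_period in auto)

lemma unit_exp_power: "unit_exp m (int k * j) = unit_exp m j ^ k"
proof -
  have "2 * pi * (of_int (int k * j) / real m) = real k * (2 * pi * (of_int j / real m))" by simp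
  thus ?thesis by (simp only: unit_exp_def Complex.DeMoivre)
qed

lemma unit_exp_orthogonal:
  assumes "m > 0"
  shows "(\<Sum>h\<in>{0..<int m}. unit_exp m (h * j)) = (if int m dvd j then of_nat m else 0)"
proof -
  have "(\<Sum>h\<in>{0..<int m}. unit_exp m (h * j)) = (\<Sum>k<m. unit_exp m (int k * j))"
    by (rule sum.reindex_bij_witness[of _ int nat]) auto
  also have "\<dots> = (\<Sum>k<m. unit_exp m j ^ k)" by (simp add: unit_exp_power)
  also have "\<dots> = (if int m dvd j then of_nat m else 0)"
  proof (cases "int m dvd j")
    case True
    hence "unit_exp m j = 1" using unit_exp_eq_1_iff[OF assms] by simp
    thus ?thesis using True by simp
  next
    case False
    hence "unit_exp m j \<noteq> 1" using unit_exp_eq_1_iff[OF assms] by simp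
    moreover have "unit_exp m j ^ m = 1"
      using unit_exp_power[of m m j] unit_exp_period[OF assms, of j] by simp
    ultimately show ?thesis using False by (simp add: geometric_sum)
  qed
  finally show ?thesis .
qed

lemma fourier_inversion:
  assumes "m > 0" "n \<in> {0..<int m}"
  shows "complex_of_real (1 / sqrt (real m)) * (\<Sum>h\<in>{0..<int m}. fourier m \<phi> h * unit_exp m (- (h * n))) = \<phi> n"
proof -
  define c where "c = complex_of_real (1 / sqrt (real m))"
  have c: "c * c * of_nat m = 1"
  proof -
    have "1 / sqrt (real m) * (1 / sqrt (real m)) * real m = 1" using assms by simp
    hence "complex_of_real (1 / sqrt (real m) * (1 / sqrt (real m)) * real m) = 1" by (simp only: of_real_1)
    thus ?thesis by (simp only: c_def of_real_mult of_real_of_nat_eq)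
  qed
  have "(\<Sum>h\<in>{0..<int m}. fourier m \<phi> h * unit_exp m (- (h * n))) =
      (\<Sum>h\<in>{0..<int m}. \<Sum>k\<in>{0..<int m}. c * \<phi> k * unit_exp m (h * (k - n)))"
    by (simp add: fourier_eq_unit_exp c_def sum_distrib_left sum_distrib_right mult.assoc
        right_diff_distrib flip: unit_exp_add)
  also have "\<dots> = (\<Sum>k\<in>{0..<int m}. c * \<phi> k * (\<Sum>h\<in>{0..<int m}. unit_exp m (h * (k - n))))"
    by (subst sum.swap) (simp add: sum_distrib_left)
  also have "\<dots> = (\<Sum>k\<in>{0..<int m}. if k = n then c * \<phi> n * of_nat m else 0)"
  proof (intro sum.cong refl)
    fix k assume k: "k \<in> {0..<int m}"
    have "int m dvd k - n \<longleftrightarrow> k = n"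
      using k assms dvd_imp_le_int[of "k - n" "int m"] by (cases "k = n") auto
    thus "c * \<phi> k * (\<Sum>h\<in>{0..<int m}. unit_exp m (h * (k - n))) = (if k = n then c * \<phi> n * of_nat m else 0)"
      using assms by (auto simp: unit_exp_orthogonal)
  qed
  also have "\<dots> = c * \<phi> n * of_nat m" using assms by simp
  finally have "c * (\<Sum>h\<in>{0..<int m}. fourier m \<phi> h * unit_exp m (- (h * n))) = (c * c * of_nat m) * \<phi> n"
    by (simp add: mult_ac)
  thus ?thesis by (simp only: c c_def[symmetric] mult_1_left)
qed

lemma half_coeff_shift:
  assumes "m > 0"
  shows "half_coeff m (h - int m) = half_coeff m h"
proof -
  have "sin (2 * pi * (real_of_int ((h - int m) * n) / real m)) = sin (2 * pi * (real_of_int (h * n) / real m))" for n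
  proof -
    have "2 * pi * (real_of_int ((h - int m) * n) / real m) =
        2 * pi * (real_of_int (h * n) / real m) - 2 * pi * of_int n"
      using assms by (simp add: field_simps)
    thus ?thesis by (simp add: sin_diff)
  qed
  thus ?thesis by (simp add: half_coeff_def)
qed

lemma fourier_shift:
  assumes "m > 0"
  shows "fourier m \<phi> (h - int m) = fourier m \<phi> h"
proof -
  have "unit_exp m ((h - int m) * n) = unit_exp m (h * n)" for n
    using unit_exp_add[of m "h * n" "int m * (- n)"] unit_exp_period[OF assms, of "- n"]
    by (simp add: algebra_simps)
  thus ?thesis by (simp add: fourier_eq_unit_exp)
qed

lemma half_coeff_middle: "2 * h = int m \<Longrightarrow> half_coeff m h = 0"
proof -
  assume *: "2 * h = int m"
  have "sin (2 * pi * (real_of_int (h * n) / real m)) = 0" for n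
  proof (cases "m = 0")
    case False
    have "real m = 2 * of_int h" using * by linarith
    moreover have "h \<noteq> 0" using * False by auto
    ultimately have "2 * pi * (real_of_int (h * n) / real m) = pi * of_int n" by simp
    thus ?thesis by (simp only: sin_int_pi)
  qed auto
  thus ?thesis by (simp add: half_coeff_def)
qed

lemma sum_residues_eq_freqs:
  fixes t :: "int \<Rightarrow> real"
  assumes "\<And>h. t (h - int m) = t h" "t 0 = 0" "\<And>h. 2 * h = int m \<Longrightarrow> t h = 0"
  shows "(\<Sum>h\<in>{0..<int m}. t h) = (\<Sum>h\<in>freqs m. t h)"
proof -
  define r where "r = (\<lambda>h. if 2 * h < int m then h else h - int m)"
  have "(\<Sum>h\<in>{0..<int m}. t h) = (\<Sum>h\<in>{0..<int m} - {h. h = 0 \<or> 2 * h = int m}. t h)"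
    using assms by (intro sum.mono_neutral_right) auto
  also have "\<dots> = (\<Sum>h\<in>freqs m. t h)"
    by (rule sum.reindex_bij_witness[of _ "\<lambda>h. if h > 0 then h else h + int m" r])
      (auto simp: freqs_def r_def assms)
  finally show ?thesis .
qed

text \<open>In the imaginary part of the inversion formula real Fourier coefficients leave only the
  sines. The minus sign is that of the frequency in the inversion kernel.\<close>

lemma half_sum_eq:
  assumes m: "m > 0" and real: "\<And>h. Im (fourier m \<phi> h) = 0"
  shows "half_sum m \<phi> = - (\<Sum>h\<in>freqs m. half_coeff m h * Re (fourier m \<phi> h))"
proof -
  define I where "I = {0..\<lfloor>real m / 2\<rfloor>}"
  have I: "I \<subseteq> {0..<int m}" using m by (auto simp: I_def floor_half)
  have "Im (\<phi> n) = - (1 / sqrt (real m)) * (\<Sum>h\<in>{0..<int m}. Re (fourier m \<phi> h) * sin (2 * pi * (real_of_int (h * n) / real m)))"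
    if "n \<in> I" for n
  proof -
    have "n \<in> {0..<int m}" using that I by auto
    have Im_scale: "Im (complex_of_real c * w) = c * Im w" for c w by simp
    have "Im (\<phi> n) = Im (complex_of_real (1 / sqrt (real m)) *
        (\<Sum>h\<in>{0..<int m}. fourier m \<phi> h * unit_exp m (- (h * n))))"
      using fourier_inversion[OF m \<open>n \<in> {0..<int m}\<close>, of \<phi>] by simp
    also have "\<dots> = (1 / sqrt (real m)) * (\<Sum>h\<in>{0..<int m}. Im (fourier m \<phi> h * unit_exp m (- (h * n))))"
      by (simp only: Im_scale Im_sum)
    also have "(\<Sum>h\<in>{0..<int m}. Im (fourier m \<phi> h * unit_exp m (- (h * n)))) =
        - (\<Sum>h\<in>{0..<int m}. Re (fourier m \<phi> h) * sin (2 * pi * (real_of_int (h * n) / real m)))"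
      by (simp add: real unit_exp_def sum_negf)
    finally show ?thesis by simp
  qed
  hence "half_sum m \<phi> = (1 / sqrt (real m)) * (\<Sum>n\<in>I. - (1 / sqrt (real m)) *
      (\<Sum>h\<in>{0..<int m}. Re (fourier m \<phi> h) * sin (2 * pi * (real_of_int (h * n) / real m))))"
    by (simp add: half_sum_def I_def)
  also have "\<dots> = - (1 / sqrt (real m) * (1 / sqrt (real m))) *
      (\<Sum>h\<in>{0..<int m}. \<Sum>n\<in>I. Re (fourier m \<phi> h) * sin (2 * pi * (real_of_int (h * n) / real m)))"
    by (subst sum.swap) (simp only: sum_distrib_left[symmetric], simp add: mult_ac)
  also have "1 / sqrt (real m) * (1 / sqrt (real m)) = 1 / real m"
    using m by (simp add: real_sqrt_mult_self)
  also have "- (1 / real m) * (\<Sum>h\<in>{0..<int m}. \<Sum>n\<in>I. Re (fourier m \<phi> h) * sin (2 * pi * (real_of_int (h * n) / real m)))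
     = - (\<Sum>h\<in>{0..<int m}. half_coeff m h * Re (fourier m \<phi> h))"
    by (simp add: half_coeff_def I_def sum_distrib_left sum_distrib_right sum_divide_distrib sum_negf mult_ac)
  also have "(\<Sum>h\<in>{0..<int m}. half_coeff m h * Re (fourier m \<phi> h)) =
      (\<Sum>h\<in>freqs m. half_coeff m h * Re (fourier m \<phi> h))"
  proof (rule sum_residues_eq_freqs)
    show "half_coeff m 0 * Re (fourier m \<phi> 0) = 0" by (simp add: half_coeff_def)
  qed (use m in \<open>auto simp: half_coeff_shift fourier_shift half_coeff_middle\<close>)
  finally show ?thesis .
qed

section \<open>The random model\<close>

lemma sum_freqs:
  fixes t :: "int \<Rightarrow> real"
  shows "(\<Sum>h\<in>freqs m. t h) = (\<Sum>j=1..(m - 1) div 2. t (int j) + t (- int j))"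
proof -
  define r where "r = (m - 1) div 2"
  have "freqs m = int ` {1..r} \<union> (\<lambda>j. - int j) ` {1..r}"
  proof (intro equalityI subsetI)
    fix h assume h: "h \<in> freqs m"
    hence "nat \<bar>h\<bar> \<in> {1..r}" by (auto simp: freqs_def r_def)
    moreover have "h = int (nat \<bar>h\<bar>) \<or> h = - int (nat \<bar>h\<bar>)" by auto
    ultimately show "h \<in> int ` {1..r} \<union> (\<lambda>j. - int j) ` {1..r}" by blast
  qed (auto simp: freqs_def r_def)
  moreover have "int ` {1..r} \<inter> (\<lambda>j. - int j) ` {1..r} = {}" by auto
  ultimately show ?thesis
    by (simp add: sum.union_disjoint sum.reindex inj_on_def sum.distrib r_def)
qed

lemma sum_odd_even:
  fixes g :: "nat \<Rightarrow> real"
  shows "(\<Sum>j=1..2*n. g j) = (\<Sum>i<n. g (2 * i + 1) + g (2 * i + 2))"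
  by (induction n) auto

lemma sum_inverse_squares_tail:
  assumes "k > 0"
  shows "(\<Sum>j=k+1..r. 1 / (real j)\<^sup>2) \<le> 1 / real k"
proof -
  have "(\<Sum>j=k+1..k+d. 1 / (real j)\<^sup>2) \<le> 1 / real k - 1 / real (k + d)" for d
  proof (induction d)
    case (Suc d)
    have "1 / (real (k + Suc d))\<^sup>2 \<le> 1 / (real (k + d) * real (k + Suc d))"
      unfolding power2_eq_square using assms by (intro divide_left_mono mult_right_mono) auto
    also have "\<dots> = 1 / real (k + d) - 1 / real (k + Suc d)"
      using assms by (simp add: field_simps)
    finally show ?case using Suc by simp
  qed auto
  note * = this
  show ?thesis
  proof (cases "r \<ge> k")
    case True
    have "(\<Sum>j=k+1..r. 1 / (real j)\<^sup>2) \<le> 1 / real k - 1 / real r"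
      using *[of "r - k"] True by simp
    also have "\<dots> \<le> 1 / real k" by simp
    finally show ?thesis .
  qed auto
qed

context centered_bounded_variable
begin

lemma sym_log_mgf_0 [simp]: "sym_log_mgf 0 = 0"
  by (simp add: sym_log_mgf_def)

text \<open>Cut at \<open>2 * n\<close> with \<open>n\<close> about \<open>s\<^sup>2\<close>. Below
  the cut the Lipschitz bound replaces \<open>half_coeff\<close> by its limit, at a total cost of a
  power of \<open>ln m\<close> over \<open>m\<^sup>2\<close>, and \<open>sym_log_mgf_odd_sum\<close>
  applies. Above it the quadratic bound and the tail of the sum of \<open>1 / j\<^sup>2\<close>
  leave \<open>O(s\<^sup>2 / n)\<close>, which is bounded.\<close>

lemma sym_log_mgf_half_coeff_sum:
  obtains C where "C \<ge> 0"
    "\<forall>\<^sub>F m in sequentially. \<forall>s. 8 \<le> s \<longrightarrow> s \<le> ln (real m) \<longrightarrow>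
      \<bar>(\<Sum>j=1..(m - 1) div 2. sym_log_mgf (s * half_coeff m (int j)))
        - N / pi * s * (ln s + saddle_const)\<bar> \<le> C * ln s"
proof -
  obtain C where C: "C \<ge> 0"
    "\<And>s n. s \<ge> 8 \<Longrightarrow> real n \<ge> s\<^sup>2 \<Longrightarrow>
      \<bar>(\<Sum>i<n. sym_log_mgf (s / (pi * real (2 * i + 1)))) - N / pi * s * (ln s + saddle_const)\<bar> \<le> C * ln s"
    using sym_log_mgf_odd_sum by blast
  have "(\<lambda>m::nat. ln (real m) * ((ln (real m))\<^sup>2 + 1)\<^sup>2 / (real m)\<^sup>2) \<longlonglongrightarrow> 0"
    by real_asymp
  hence "(\<lambda>m::nat. 8 * N * pi * (ln (real m) * ((ln (real m))\<^sup>2 + 1)\<^sup>2 / (real m)\<^sup>2)) \<longlonglongrightarrow> 8 * N * pi * 0"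
    by (intro tendsto_mult_left)
  hence ev1: "\<forall>\<^sub>F m::nat in sequentially. 8 * N * pi * (ln (real m) * ((ln (real m))\<^sup>2 + 1)\<^sup>2 / (real m)\<^sup>2) < 1"
    by (rule order_tendstoD) simp
  have ev2: "\<forall>\<^sub>F m::nat in sequentially. 4 * ((ln (real m))\<^sup>2 + 2) < real m"
    by real_asymp
  show ?thesis
  proof (rule that[of "C + 1 + N\<^sup>2"])
    show "\<forall>\<^sub>F m in sequentially. \<forall>s. 8 \<le> s \<longrightarrow> s \<le> ln (real m) \<longrightarrow>
      \<bar>(\<Sum>j=1..(m - 1) div 2. sym_log_mgf (s * half_coeff m (int j)))
        - N / pi * s * (ln s + saddle_const)\<bar> \<le> (C + 1 + N\<^sup>2) * ln s"
      using ev1 ev2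
    proof (eventually_elim, intro allI impI)
      fix m :: nat and s :: real
      assume m1: "8 * N * pi * (ln (real m) * ((ln (real m))\<^sup>2 + 1)\<^sup>2 / (real m)\<^sup>2) < 1"
        and m2: "4 * ((ln (real m))\<^sup>2 + 2) < real m" and s: "8 \<le> s" "s \<le> ln (real m)"
      define n where "n = nat \<lceil>s\<^sup>2\<rceil>"
      define r where "r = (m - 1) div 2"
      define b where "b = (\<lambda>j. half_coeff m (int j))"
      have s2: "s\<^sup>2 \<le> (ln (real m))\<^sup>2" using s by (intro power_mono) auto
      have n: "s\<^sup>2 \<le> real n" "real n \<le> (ln (real m))\<^sup>2 + 1"
        using s2 ceiling_correct[of "s\<^sup>2"] unfolding n_def by auto
      have n0: "n > 0" using n s by (cases n) auto
      have "4 * real n < real m" "real m > 0" using n m2 s by auto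
      hence m: "m > 0" and nr: "2 * n \<le> r" by (auto simp: r_def)
      have ln_s: "ln s \<ge> 1"
      proof -
        have "exp 1 \<le> s" using exp_le s by linarith
        thus ?thesis using s by (metis exp_gt_zero ln_exp ln_mono)
      qed
      have jr: "1 \<le> int j" "2 * int j < int m" if "1 \<le> j" "j \<le> r" for j
        using that by (auto simp: r_def)
      define \<beta> where "\<beta> = (\<lambda>j. if odd j then 1 / (pi * real j) else 0)"
      have low: "\<bar>(\<Sum>j=1..2*n. sym_log_mgf (s * b j)) - (\<Sum>j=1..2*n. sym_log_mgf (s * \<beta> j))\<bar> \<le> 1"
      proof -
        have "\<bar>sym_log_mgf (s * b j) - sym_log_mgf (s * \<beta> j)\<bar> \<le> 2 * N * (s * (pi * real (2 * n) / (real m)\<^sup>2))"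
          if j: "j \<in> {1..2*n}" for j
        proof -
          have "\<bar>b j - \<beta> j\<bar> \<le> pi * real j / (real m)\<^sup>2"
            using half_coeff_bounds(1)[OF jr[of j]] j nr by (simp add: b_def \<beta>_def split: if_splits)
          also have "\<dots> \<le> pi * real (2 * n) / (real m)\<^sup>2"
            using j by (intro divide_right_mono mult_left_mono) auto
          finally have *: "\<bar>b j - \<beta> j\<bar> \<le> pi * real (2 * n) / (real m)\<^sup>2" .
          have "\<bar>sym_log_mgf (s * b j) - sym_log_mgf (s * \<beta> j)\<bar> \<le> 2 * N * \<bar>s * b j - s * \<beta> j\<bar>"
            by (rule sym_log_mgf_lipschitz)
          also have "\<bar>s * b j - s * \<beta> j\<bar> = s * \<bar>b j - \<beta> j\<bar>"
            using s by (simp add: abs_mult flip: right_diff_distrib)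
          also have "2 * N * (s * \<bar>b j - \<beta> j\<bar>) \<le> 2 * N * (s * (pi * real (2 * n) / (real m)\<^sup>2))"
            using * s N_pos by (intro mult_left_mono) auto
          finally show ?thesis .
        qed
        hence "\<bar>\<Sum>j=1..2*n. sym_log_mgf (s * b j) - sym_log_mgf (s * \<beta> j)\<bar>
            \<le> (\<Sum>j=1..2*n. 2 * N * (s * (pi * real (2 * n) / (real m)\<^sup>2)))"
          by (intro order_trans[OF sum_abs] sum_mono)
        also have "\<dots> = 8 * N * pi * (s * (real n)\<^sup>2 / (real m)\<^sup>2)"
          by (simp add: power2_eq_square)
        also have "\<dots> \<le> 8 * N * pi * (ln (real m) * ((ln (real m))\<^sup>2 + 1)\<^sup>2 / (real m)\<^sup>2)"
          using s n N_pos by (intro mult_left_mono divide_right_mono mult_mono power_mono) auto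
        also have "\<dots> \<le> 1" using m1 by simp
        finally show ?thesis by (simp add: sum_subtractf)
      qed
      \<comment> \<open>The even indices drop out since \<open>sym_log_mgf\<close> vanishes at
        0.\<close>
      have \<beta>: "(\<Sum>j=1..2*n. sym_log_mgf (s * \<beta> j)) = (\<Sum>i<n. sym_log_mgf (s / (pi * real (2 * i + 1))))"
        unfolding sum_odd_even by (simp add: \<beta>_def)
      have high: "(\<Sum>j=2*n+1..r. sym_log_mgf (s * b j)) \<le> N\<^sup>2"
      proof -
        have "(\<Sum>j=2*n+1..r. sym_log_mgf (s * b j)) \<le> (\<Sum>j=2*n+1..r. N\<^sup>2 * s\<^sup>2 * (1 / (real j)\<^sup>2))"
        proof (intro sum_mono)
          fix j assume j: "j \<in> {2*n+1..r}"
          have "\<bar>b j\<bar> \<le> 1 / real j" using half_coeff_bounds(2)[OF jr[of j]] j by (simp add: b_def)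
          hence "\<bar>b j\<bar>\<^sup>2 \<le> (1 / real j)\<^sup>2" by (intro power_mono) auto
          hence "N\<^sup>2 * s\<^sup>2 * (b j)\<^sup>2 \<le> N\<^sup>2 * s\<^sup>2 * (1 / (real j)\<^sup>2)"
            by (intro mult_left_mono) (auto simp: power_divide)
          moreover have "sym_log_mgf (s * b j) \<le> N\<^sup>2 * (s * b j)\<^sup>2" by (rule sym_log_mgf_le_square)
          ultimately show "sym_log_mgf (s * b j) \<le> N\<^sup>2 * s\<^sup>2 * (1 / (real j)\<^sup>2)"
            by (simp add: power_mult_distrib)
        qed
        also have "\<dots> = N\<^sup>2 * (s\<^sup>2 * (\<Sum>j=2*n+1..r. 1 / (real j)\<^sup>2))"
          by (simp add: sum_distrib_left mult.assoc)
        also have "\<dots> \<le> N\<^sup>2 * (real n * (1 / real (2 * n)))"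
          using n0 n by (intro mult_left_mono mult_mono sum_inverse_squares_tail sum_nonneg) auto
        also have "\<dots> \<le> N\<^sup>2" using n0 by simp
        finally show ?thesis .
      qed
      have high0: "0 \<le> (\<Sum>j=2*n+1..r. sym_log_mgf (s * b j))"
        by (intro sum_nonneg sym_log_mgf_nonneg)
      have "{1..r} = {1..2*n} \<union> {2*n+1..r}" using nr by auto
      hence split: "(\<Sum>j=1..r. sym_log_mgf (s * b j)) =
          (\<Sum>j=1..2*n. sym_log_mgf (s * b j)) + (\<Sum>j=2*n+1..r. sym_log_mgf (s * b j))"
        by (simp only:) (rule sum.union_disjoint, auto)
      have "\<bar>S - T\<bar> \<le> c + 1 + e" if "S = A + B" "\<bar>A - A'\<bar> \<le> 1" "\<bar>A' - T\<bar> \<le> c" "0 \<le> B" "B \<le> e"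
        for S T A A' B c e :: real
        using that by (intro abs_leI) linarith+
      from this[OF split low C(2)[OF s(1) n(1), folded \<beta>] high0 high]
      have "\<bar>(\<Sum>j=1..r. sym_log_mgf (s * b j)) - N / pi * s * (ln s + saddle_const)\<bar> \<le> C * ln s + 1 + N\<^sup>2" .
      also have "\<dots> \<le> (C + 1 + N\<^sup>2) * ln s"
        using ln_s mult_left_mono[of 1 "ln s" "N\<^sup>2"] by (simp add: algebra_simps)
      finally show "\<bar>(\<Sum>j=1..(m - 1) div 2. sym_log_mgf (s * half_coeff m (int j)))
        - N / pi * s * (ln s + saddle_const)\<bar> \<le> (C + 1 + N\<^sup>2) * ln s"
        by (simp only: r_def b_def)
    qed
  qed (use C in auto)
qed

end

section \<open>The linear form in independent variables\<close>

locale iid_model =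
  fixes M :: "'w measure" and X :: "int \<Rightarrow> 'w \<Rightarrow> real" and N :: real
  assumes N_pos: "N > 0" and iid: "iid_supported M X N"
    and tails: "condition3a M (X 1) N" and moments: "condition3b M (X 1)"
begin

sublocale prob_space M
  using iid by (simp add: iid_supported_def)

lemma X_measurable [measurable]: "h \<noteq> 0 \<Longrightarrow> X h \<in> borel_measurable M"
  using iid by (auto simp: iid_supported_def indep_vars_def)

lemma X_bounded: "h \<noteq> 0 \<Longrightarrow> AE w in M. X h w \<in> {-N..N}"
  using iid by (simp add: iid_supported_def)

sublocale centered_bounded_variable M "X 1" N
proof
  show "expectation (X 1) = 0"
    using moments unfolding condition3b_def by (auto dest!: spec[of _ 0])
qed (use N_pos tails X_bounded in auto)

lemma expectation_exp_X:
  assumes "h \<noteq> 0"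
  shows "expectation (\<lambda>w. exp (t * X h w)) = mgf t"
proof -
  have "distr M borel (X h) = distr M borel (X 1)"
    using iid assms unfolding iid_supported_def by (metis zero_neq_one)
  hence "integral\<^sup>L (distr M borel (X h)) (\<lambda>x. exp (t * x)) = integral\<^sup>L (distr M borel (X 1)) (\<lambda>x. exp (t * x))"
    by simp
  thus ?thesis using assms by (simp add: integral_distr mgf_def)
qed

definition model_sum :: "(int \<Rightarrow> real) \<Rightarrow> nat \<Rightarrow> 'w \<Rightarrow> real" where
  "model_sum c m w = (\<Sum>h\<in>freqs m. c h * X h w)"

lemma model_sum_measurable [measurable]: "model_sum c m \<in> borel_measurable M"
  unfolding model_sum_def[abs_def]
proof (intro borel_measurable_sum borel_measurable_times borel_measurable_const)
  show "X h \<in> borel_measurable M" if "h \<in> freqs m" for h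
    using that by (intro X_measurable) (simp add: freqs_def)
qed

lemma model_sum_bounded: "AE w in M. \<bar>model_sum c m w\<bar> \<le> (\<Sum>h\<in>freqs m. \<bar>c h\<bar> * N)"
proof -
  have "AE w in M. \<forall>h\<in>freqs m. X h w \<in> {-N..N}"
    by (intro AE_finite_allI finite_freqs X_bounded) (simp add: freqs_def)
  thus ?thesis
  proof eventually_elim
    case (elim w)
    have "\<bar>model_sum c m w\<bar> \<le> (\<Sum>h\<in>freqs m. \<bar>c h * X h w\<bar>)"
      unfolding model_sum_def by (rule sum_abs)
    also have "\<dots> \<le> (\<Sum>h\<in>freqs m. \<bar>c h\<bar> * N)"
      using elim by (intro sum_mono) (auto simp: abs_mult intro!: mult_left_mono)
    finally show ?case .
  qed
qed

lemma expectation_exp_model_sum: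
  "expectation (\<lambda>w. exp (s * model_sum c m w)) = (\<Prod>h\<in>freqs m. mgf (s * c h))"
proof -
  have "indep_vars (\<lambda>_. borel) X (freqs m)"
    using iid unfolding iid_supported_def
    by (auto intro!: indep_vars_subset[of _ X "UNIV - {0}"] simp: freqs_def)
  hence ind: "indep_vars (\<lambda>_. borel) (\<lambda>h w. exp (s * c h * X h w)) (freqs m)"
    by (rule indep_vars_compose2[where Y = "\<lambda>h x. exp (s * c h * x)"]) auto
  have int: "integrable M (\<lambda>w. exp (t * X h w))" if h: "h \<noteq> 0" for t h
  proof (rule integrable_const_bound[of _ "exp (\<bar>t\<bar> * N)"])
    show "AE w in M. norm (exp (t * X h w)) \<le> exp (\<bar>t\<bar> * N)"
      using X_bounded[OF h]
    proof eventually_elim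
      case (elim w)
      have "t * X h w \<le> \<bar>t\<bar> * \<bar>X h w\<bar>" by (metis abs_ge_self abs_mult)
      also have "\<dots> \<le> \<bar>t\<bar> * N" using elim by (intro mult_left_mono) auto
      finally show ?case by simp
    qed
  qed (use h in auto)
  have "expectation (\<lambda>w. exp (s * model_sum c m w)) = expectation (\<lambda>w. \<Prod>h\<in>freqs m. exp (s * c h * X h w))"
    by (simp add: model_sum_def exp_sum sum_distrib_left mult.assoc)
  also have "\<dots> = (\<Prod>h\<in>freqs m. expectation (\<lambda>w. exp (s * c h * X h w)))"
    by (rule indep_vars_lebesgue_integral[OF finite_freqs ind]) (auto simp: freqs_def int)
  also have "\<dots> = (\<Prod>h\<in>freqs m. mgf (s * c h))"
    by (intro prod.cong) (auto simp: expectation_exp_X freqs_def)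
  finally show ?thesis .
qed

lemma ln_expectation_exp_model_sum:
  assumes "\<And>h. c (- h) = - c h"
  shows "ln (expectation (\<lambda>w. exp (s * model_sum c m w))) =
    (\<Sum>j=1..(m - 1) div 2. sym_log_mgf (s * c (int j)))"
proof -
  have "ln (expectation (\<lambda>w. exp (s * model_sum c m w))) = (\<Sum>h\<in>freqs m. ln (mgf (s * c h)))"
    unfolding expectation_exp_model_sum by (rule ln_prod) (auto simp: less_imp_neq[OF mgf_pos, symmetric])
  also have "\<dots> = (\<Sum>j=1..(m - 1) div 2. sym_log_mgf (s * c (int j)))"
    unfolding sum_freqs by (simp add: assms sym_log_mgf_def)
  finally show ?thesis .
qed

end

section \<open>Taylor polynomials of exp and tail bounds\<close>

definition exp_taylor :: "nat \<Rightarrow> real \<Rightarrow> real" where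
  "exp_taylor n x = (\<Sum>k\<le>n. x ^ k / fact k)"

lemma exp_series_sums: "(\<lambda>k. x ^ k / fact k) sums exp (x :: real)"
  using exp_converges[of x] by (simp add: divide_inverse mult.commute)

lemma exp_taylor_le_exp:
  assumes "x \<ge> 0"
  shows "exp_taylor n x \<le> exp x"
proof -
  have "(\<Sum>k\<in>{..n}. x ^ k / fact k) \<le> (\<Sum>k. x ^ k / fact k)"
    using assms by (intro sum_le_suminf) (auto intro: sums_summable exp_series_sums)
  thus ?thesis using sums_unique[OF exp_series_sums[of x]] by (simp add: exp_taylor_def)
qed

lemma exp_taylor_mono: "0 \<le> x \<Longrightarrow> x \<le> y \<Longrightarrow> exp_taylor n x \<le> exp_taylor n y"
  unfolding exp_taylor_def by (intro sum_mono divide_right_mono power_mono) auto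

text \<open>For negative \<open>x\<close> the polynomial may exceed \<open>exp x\<close>. The
  Lagrange remainder after the terms of degree below the even number \<open>n\<close> is
  nonnegative, so the excess is at most the last term.\<close>

lemma exp_taylor_le_exp_plus:
  assumes "even n"
  shows "exp_taylor n x \<le> exp x + x ^ n / fact n"
proof -
  obtain t where t: "exp x = (\<Sum>k<n. x ^ k / fact k) + exp t / fact n * x ^ n"
    using Maclaurin_exp_le[of x n] by blast
  have "exp t / fact n * x ^ n \<ge> 0" using assms by (simp add: zero_le_even_power)
  hence "(\<Sum>k<n. x ^ k / fact k) \<le> exp x" using t by linarith
  thus ?thesis by (simp add: exp_taylor_def lessThan_Suc_atMost[symmetric])
qed

lemma exp_le_exp_taylor_nonpos:
  assumes "even n" "x \<le> 0"
  shows "exp x \<le> exp_taylor n x"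
proof -
  obtain t where t: "exp x = (\<Sum>k<Suc n. x ^ k / fact k) + exp t / fact (Suc n) * x ^ Suc n"
    using Maclaurin_exp_le[of x "Suc n"] by blast
  have "x ^ Suc n \<le> 0" using assms by (subst power_le_zero_eq) auto
  hence "exp t / fact (Suc n) * x ^ Suc n \<le> 0" by (intro mult_nonneg_nonpos) auto
  thus ?thesis using t by (simp add: exp_taylor_def lessThan_Suc_atMost)
qed

text \<open>Rankin's trick for positive \<open>x\<close>: on the omitted terms the factor
  \<open>exp (k - n)\<close> is at least 1, and inserting it turns the tail into a part of
  \<open>exp (- n)\<close> times the series of \<open>exp (e x)\<close>. For negative
  \<open>x\<close> the remainder of odd order already has the right sign.\<close>

lemma exp_le_exp_taylor_plus:
  assumes "even n"
  shows "exp x \<le> exp_taylor n x + exp (- real n) * exp (exp 1 * x)"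
proof (cases "x \<ge> 0")
  case True
  have "(\<lambda>k. if k \<in> {..n} then x ^ k / fact k else 0) sums exp_taylor n x"
    unfolding exp_taylor_def by (rule sums_If_finite_set) auto
  hence series: "(\<lambda>k. (if k \<in> {..n} then x ^ k / fact k else 0) + exp (- real n) * ((exp 1 * x) ^ k / fact k)) sums
      (exp_taylor n x + exp (- real n) * exp (exp 1 * x))"
    by (intro sums_add sums_mult exp_series_sums)
  have "x ^ k / fact k \<le> (if k \<in> {..n} then x ^ k / fact k else 0) + exp (- real n) * ((exp 1 * x) ^ k / fact k)" for k
  proof (cases "k \<le> n")
    case False
    have "1 * (x ^ k / fact k) \<le> exp (real k - real n) * (x ^ k / fact k)"
      using False True by (intro mult_right_mono) auto
    also have "exp (real k - real n) = exp (- real n) * exp 1 ^ k"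
      by (simp add: exp_diff exp_minus divide_inverse mult.commute flip: exp_of_nat_mult)
    finally show ?thesis using False by (simp add: power_mult_distrib mult_ac)
  qed (use True in auto)
  thus ?thesis by (rule sums_le[OF _ exp_series_sums series])
next
  case False
  hence "exp x \<le> exp_taylor n x" using assms by (intro exp_le_exp_taylor_nonpos) auto
  also have "\<dots> \<le> exp_taylor n x + exp (- real n) * exp (exp 1 * x)" by simp
  finally show ?thesis .
qed

lemma exp_taylor_pos:
  assumes "even n"
  shows "exp_taylor n x > 0"
proof (cases "x \<ge> 0")
  case True
  have "(\<Sum>k\<in>{0}. x ^ k / fact k) \<le> exp_taylor n x"
    unfolding exp_taylor_def using True by (intro sum_mono2) auto
  thus ?thesis by simp
next
  case False
  hence "exp x \<le> exp_taylor n x" using assms by (intro exp_le_exp_taylor_nonpos) auto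
  thus ?thesis using exp_gt_zero[of x] by linarith
qed

text \<open>Here \<open>x ^ n / fact n\<close> is \<open>exp (- n)\<close> times a single term of
  the series of \<open>exp (e \<bar>x\<bar>)\<close>. Both signs are kept on the right so that its
  expectation consists of values of the moment generating function.\<close>

lemma even_power_le_exp:
  assumes "even n"
  shows "x ^ n / fact n \<le> exp (- real n) * (exp (exp 1 * x) + exp (- (exp 1 * x)))"
proof -
  have "(exp 1 * \<bar>x\<bar>) ^ n / fact n = (\<Sum>k\<in>{n}. (exp 1 * \<bar>x\<bar>) ^ k / fact k)" by simp
  also have "\<dots> \<le> exp_taylor n (exp 1 * \<bar>x\<bar>)"
    unfolding exp_taylor_def by (intro sum_mono2) auto
  also have "\<dots> \<le> exp (exp 1 * \<bar>x\<bar>)" by (intro exp_taylor_le_exp) auto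
  also have "\<dots> \<le> exp (exp 1 * x) + exp (- (exp 1 * x))" by (cases "x \<ge> 0") auto
  finally have "exp (- real n) * ((exp 1 * \<bar>x\<bar>) ^ n / fact n) \<le>
      exp (- real n) * (exp (exp 1 * x) + exp (- (exp 1 * x)))" by (intro mult_left_mono) auto
  moreover have "exp (- real n) * ((exp 1 * \<bar>x\<bar>) ^ n / fact n) = x ^ n / fact n"
    using assms by (simp add: power_mult_distrib power_even_abs exp_minus flip: exp_of_nat_mult)
  ultimately show ?thesis by simp
qed

text \<open>The quotient of the two polynomials in \<open>x\<close> is monotone because the ratios of their coefficients
  are; symmetrising the double sum makes every term nonnegative.\<close>

lemma exp_taylor_ratio:
  assumes "0 \<le> s" "s \<le> s'" "0 \<le> x" "x \<le> x'"
  shows "exp_taylor n (s * x') * exp_taylor n (s' * x) \<le> exp_taylor n (s * x) * exp_taylor n (s' * x')"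
proof -
  define A where "A = (\<lambda>j k. s ^ j * s' ^ k / (fact j * fact k))"
  define D where "D = (\<lambda>j k. x ^ j * x' ^ k - x' ^ j * x ^ k)"
  have "exp_taylor n (s * x) * exp_taylor n (s' * x') - exp_taylor n (s * x') * exp_taylor n (s' * x) =
      (\<Sum>j\<le>n. \<Sum>k\<le>n. A j k * D j k)"
    unfolding exp_taylor_def sum_product sum_subtractf[symmetric] A_def D_def
    by (intro sum.cong refl) (simp add: power_mult_distrib algebra_simps diff_divide_distrib)
  also have "2 * (\<Sum>j\<le>n. \<Sum>k\<le>n. A j k * D j k) =
      (\<Sum>j\<le>n. \<Sum>k\<le>n. A j k * D j k) + (\<Sum>k\<le>n. \<Sum>j\<le>n. A j k * D j k)"
    by (subst (3) sum.swap) simp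
  hence "2 * (\<Sum>j\<le>n. \<Sum>k\<le>n. A j k * D j k) = (\<Sum>j\<le>n. \<Sum>k\<le>n. A j k * D j k + A k j * D k j)"
    by (simp add: sum.distrib)
  moreover have "A j k * D j k + A k j * D k j \<ge> 0" for j k
  proof -
    have "0 \<le> (s ^ i * s' ^ (i + d) - s ^ (i + d) * s' ^ i) * (x ^ i * x' ^ (i + d) - x' ^ i * x ^ (i + d))" for i d
    proof (rule mult_nonneg_nonneg)
      have "s ^ d \<le> s' ^ d" "x ^ d \<le> x' ^ d" using assms by (auto intro: power_mono)
      hence "(s ^ i * s' ^ i) * s ^ d \<le> (s ^ i * s' ^ i) * s' ^ d"
        "(x ^ i * x' ^ i) * x ^ d \<le> (x ^ i * x' ^ i) * x' ^ d"
        using assms by (auto intro!: mult_left_mono)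
      thus "0 \<le> s ^ i * s' ^ (i + d) - s ^ (i + d) * s' ^ i"
        "0 \<le> x ^ i * x' ^ (i + d) - x' ^ i * x ^ (i + d)" by (auto simp: power_add mult_ac)
    qed
    note * = this
    have "0 \<le> (s ^ j * s' ^ k - s ^ k * s' ^ j) * (x ^ j * x' ^ k - x' ^ j * x ^ k)"
    proof (cases "j \<le> k")
      case True
      thus ?thesis using *[of j "k - j"] by simp
    next
      case False
      thus ?thesis using *[of k "j - k"] by (simp add: algebra_simps)
    qed
    hence "0 \<le> (s ^ j * s' ^ k - s ^ k * s' ^ j) * (x ^ j * x' ^ k - x' ^ j * x ^ k) / (fact j * fact k)"
      by simp
    also have "\<dots> = A j k * D j k + A k j * D k j"
      by (simp add: A_def D_def diff_divide_distrib add_divide_distrib algebra_simps)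
    finally show ?thesis .
  qed
  ultimately have "0 \<le> (\<Sum>j\<le>n. \<Sum>k\<le>n. A j k * D j k)"
    by (smt (verit) sum_nonneg)
  thus ?thesis
    using \<open>exp_taylor n (s * x) * exp_taylor n (s' * x') - exp_taylor n (s * x') * exp_taylor n (s' * x) = _\<close>
    by linarith
qed

section \<open>Averages over the parameter set and bounds for tail proportions\<close>

definition avg :: "'a set \<Rightarrow> ('a \<Rightarrow> real) \<Rightarrow> real" where
  "avg \<Omega> f = (\<Sum>a\<in>\<Omega>. f a) / real (card \<Omega>)"

definition prop_gt :: "'a set \<Rightarrow> ('a \<Rightarrow> real) \<Rightarrow> real \<Rightarrow> real" where
  "prop_gt \<Omega> x V = real (card {a\<in>\<Omega>. x a > V}) / real (card \<Omega>)"

lemma avg_mono: "(\<And>a. a \<in> \<Omega> \<Longrightarrow> f a \<le> g a) \<Longrightarrow> avg \<Omega> f \<le> avg \<Omega> g"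
  unfolding avg_def by (intro divide_right_mono sum_mono) auto

lemma avg_add: "avg \<Omega> (\<lambda>a. f a + g a) = avg \<Omega> f + avg \<Omega> g"
  by (simp add: avg_def sum.distrib add_divide_distrib)

lemma avg_cmult: "avg \<Omega> (\<lambda>a. c * f a) = c * avg \<Omega> f"
  by (simp add: avg_def sum_distrib_left)

lemma avg_sum: "avg \<Omega> (\<lambda>a. \<Sum>k\<in>S. f k a) = (\<Sum>k\<in>S. avg \<Omega> (f k))"
  unfolding avg_def by (subst sum.swap) (simp add: sum_divide_distrib)

lemma avg_const: "finite \<Omega> \<Longrightarrow> \<Omega> \<noteq> {} \<Longrightarrow> avg \<Omega> (\<lambda>_. c) = c"
  by (simp add: avg_def)

lemma prop_gt_eq_avg: "finite \<Omega> \<Longrightarrow> prop_gt \<Omega> x V = avg \<Omega> (\<lambda>a. if x a > V then 1 else 0)"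
  by (simp add: prop_gt_def avg_def sum.If_cases Int_def)

text \<open>Markov's inequality for the polynomial: it is increasing to the right of
  \<open>s * V\<close>, and positive everywhere, so the other parameters can only increase the
  average.\<close>

lemma prop_gt_upper:
  assumes "finite \<Omega>" "even n" "0 \<le> s" "0 \<le> V"
  shows "exp_taylor n (s * V) * prop_gt \<Omega> x V \<le> avg \<Omega> (\<lambda>a. exp_taylor n (s * x a))"
proof -
  have "exp_taylor n (s * V) * (if x a > V then 1 else 0) \<le> exp_taylor n (s * x a)" for a
    using assms exp_taylor_pos[of n "s * x a"] by (auto intro!: exp_taylor_mono mult_left_mono)
  thus ?thesis
    unfolding prop_gt_eq_avg[OF assms(1)] avg_cmult[symmetric] by (intro avg_mono)
qed

text \<open>Each value of \<open>x\<close> falls into one of four ranges. Negative values contribute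
  at most 1 plus the top term, values up to \<open>V\<close> are charged to the smaller tilt
  \<open>s1\<close>, values above \<open>V'\<close> to the larger tilt \<open>s2\<close>, and only
  the window between \<open>V\<close> and \<open>V'\<close> is left for the proportion that is to be
  bounded from below.\<close>

lemma prop_gt_lower:
  assumes \<Omega>: "finite \<Omega>" "\<Omega> \<noteq> {}" and n: "even n" and s: "0 \<le> s1" "s1 \<le> s" "s \<le> s2"
    and V: "0 \<le> V" "V \<le> V'" and trunc: "\<And>y. 0 \<le> y \<Longrightarrow> y \<le> s2 * V' \<Longrightarrow> exp y \<le> 2 * exp_taylor n y"
  shows "avg \<Omega> (\<lambda>a. exp_taylor n (s * x a)) \<le> 1 + avg \<Omega> (\<lambda>a. (s * x a) ^ n / fact n)
    + 2 * exp ((s - s1) * V) * avg \<Omega> (\<lambda>a. exp_taylor n (s1 * x a))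
    + 2 * exp (- (s2 - s) * V') * avg \<Omega> (\<lambda>a. exp_taylor n (s2 * x a))
    + exp (s * V') * prop_gt \<Omega> x V"
proof -
  define t1 where "t1 = (\<lambda>y. (s * y) ^ n / fact n)"
  define t2 where "t2 = (\<lambda>y. 2 * exp ((s - s1) * V) * exp_taylor n (s1 * y))"
  define t3 where "t3 = (\<lambda>y. 2 * exp (- (s2 - s) * V') * exp_taylor n (s2 * y))"
  define t4 where "t4 = (\<lambda>y. exp (s * V') * (if y > V then 1 else 0))"
  have pw: "exp_taylor n (s * y) \<le> 1 + t1 y + t2 y + t3 y + t4 y" for y
  proof -
    have nonneg: "t1 y \<ge> 0" "t2 y \<ge> 0" "t3 y \<ge> 0" "t4 y \<ge> 0"
      using n exp_taylor_pos[OF n, of "s1 * y"] exp_taylor_pos[OF n, of "s2 * y"]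
      by (auto simp: t1_def t2_def t3_def t4_def zero_le_even_power)
    consider "y < 0" | "0 \<le> y" "y \<le> V" | "V < y" "y \<le> V'" | "V' < y" by linarith
    thus ?thesis
    proof cases
      case 1
      hence "exp (s * y) \<le> 1" using s by (simp add: mult_nonneg_nonpos)
      thus ?thesis using nonneg exp_taylor_le_exp_plus[OF n, of "s * y"] unfolding t1_def by linarith
    next
      case 2
      have "exp_taylor n (s * y) \<le> exp (s * y)" using 2 s by (intro exp_taylor_le_exp) auto
      also have "\<dots> = exp ((s - s1) * y) * exp (s1 * y)" by (simp add: algebra_simps flip: exp_add)
      also have "\<dots> \<le> exp ((s - s1) * V) * (2 * exp_taylor n (s1 * y))"
        using 2 s V by (intro mult_mono trunc) (auto intro!: mult_left_mono mult_mono)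
      also have "\<dots> = t2 y" by (simp add: t2_def)
      finally show ?thesis using nonneg by linarith
    next
      case 3
      have "exp_taylor n (s * y) \<le> exp (s * y)" using 3 s V by (intro exp_taylor_le_exp) auto
      also have "\<dots> \<le> exp (s * V')" using 3 s by (auto intro!: mult_left_mono)
      also have "\<dots> = t4 y" using 3 by (simp add: t4_def)
      finally show ?thesis using nonneg by linarith
    next
      case 4
      have pos: "exp_taylor n (s2 * y) > 0" "exp_taylor n (s2 * V') > 0" by (auto intro: exp_taylor_pos[OF n])
      \<comment> \<open>Here \<open>s2 * y\<close> can be far beyond the range in which the
        polynomial resembles \<open>exp\<close>. The monotone quotient moves the comparison back to
        \<open>V'\<close>, where \<open>trunc\<close> is available.\<close>
      have "exp_taylor n (s * y) * exp_taylor n (s2 * V') \<le> exp_taylor n (s * V') * exp_taylor n (s2 * y)"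
        using 4 s V by (intro exp_taylor_ratio) auto
      also have "\<dots> \<le> exp (s * V') * exp_taylor n (s2 * y)"
        using pos s V by (intro mult_right_mono exp_taylor_le_exp) auto
      finally have "exp_taylor n (s * y) \<le> exp (s * V') * exp_taylor n (s2 * y) / exp_taylor n (s2 * V')"
        using pos by (simp add: field_simps)
      also have "\<dots> \<le> exp (s * V') * exp_taylor n (s2 * y) / (exp (s2 * V') / 2)"
        using pos trunc[of "s2 * V'"] s V by (intro divide_left_mono) auto
      also have "\<dots> = t3 y"
        by (simp add: t3_def algebra_simps exp_diff)
      finally show ?thesis using nonneg by linarith
    qed
  qed
  have "avg \<Omega> (\<lambda>a. exp_taylor n (s * x a)) \<le> avg \<Omega> (\<lambda>a. 1 + t1 (x a) + t2 (x a) + t3 (x a) + t4 (x a))"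
    by (intro avg_mono pw)
  also have "\<dots> = 1 + avg \<Omega> (\<lambda>a. t1 (x a)) + avg \<Omega> (\<lambda>a. t2 (x a)) + avg \<Omega> (\<lambda>a. t3 (x a)) + avg \<Omega> (\<lambda>a. t4 (x a))"
    by (simp add: avg_add avg_const[OF \<Omega>])
  finally show ?thesis
    by (simp add: t1_def t2_def t3_def t4_def avg_cmult prop_gt_eq_avg[OF \<Omega>(1)])
qed

section \<open>Transfer to the family\<close>

context iid_model
begin

definition family_sum :: "(int \<Rightarrow> real) \<Rightarrow> nat \<Rightarrow> (int \<Rightarrow> complex) \<Rightarrow> real" where
  "family_sum c m \<psi> = (\<Sum>h\<in>freqs m. c h * Re (fourier m \<psi> h))"

lemma power_sum_PiE:
  fixes u :: "int \<Rightarrow> real"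
  shows "(\<Sum>h\<in>freqs m. u h) ^ k = (\<Sum>g\<in>PiE {1..k} (\<lambda>_. freqs m). \<Prod>i=1..k. u (g i))"
  using prod_sum_PiE[of "{1..k}" "\<lambda>_. freqs m" "\<lambda>_. u"] by simp

lemma integrable_prod_X:
  fixes k :: nat
  assumes "g \<in> PiE {1..k} (\<lambda>_. freqs m)"
  shows "integrable M (\<lambda>w. \<Prod>i=1..k. X (g i) w)"
proof (rule integrable_const_bound[of _ "N ^ k"])
  have nz: "g i \<noteq> 0" if "i \<in> {1..k}" for i
    using assms that by (auto simp: PiE_def Pi_def freqs_def)
  have "AE w in M. \<forall>i\<in>{1..k}. X (g i) w \<in> {-N..N}"
    by (intro AE_finite_allI X_bounded nz) auto
  thus "AE w in M. norm (\<Prod>i=1..k. X (g i) w) \<le> N ^ k"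
  proof eventually_elim
    case (elim w)
    have "norm (\<Prod>i=1..k. X (g i) w) = (\<Prod>i=1..k. \<bar>X (g i) w\<bar>)" by (simp add: abs_prod)
    also have "\<dots> \<le> (\<Prod>i=1..k. N)" using elim by (intro prod_mono) (auto simp: abs_le_iff Ball_def)
    finally show ?case by simp
  qed
  show "(\<lambda>w. \<Prod>i=1..k. X (g i) w) \<in> borel_measurable M"
    by (intro borel_measurable_prod X_measurable nz)
qed

text \<open>The linear form is almost surely bounded, so a continuous function of it is bounded by
  its maximum on a compact interval.\<close>

lemma integrable_bounded_model:
  assumes "continuous_on UNIV f"
  shows "integrable M (\<lambda>w. f (model_sum c m w) :: real)"
proof -
  define B where "B = (\<Sum>h\<in>freqs m. \<bar>c h\<bar> * N)"
  have "compact (f ` {-B..B})"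
    by (intro compact_continuous_image continuous_on_subset[OF assms]) auto
  then obtain b where b: "\<And>y. y \<in> {-B..B} \<Longrightarrow> norm (f y) \<le> b"
    by (metis bounded_iff compact_imp_bounded imageI)
  show ?thesis
  proof (rule integrable_const_bound[of _ b])
    show "AE w in M. norm (f (model_sum c m w)) \<le> b"
      using model_sum_bounded[of c m] by eventually_elim (intro b, auto simp: B_def)
    have [measurable]: "f \<in> borel_measurable borel" by (rule borel_measurable_continuous_onI[OF assms])
    show "(\<lambda>w. f (model_sum c m w)) \<in> borel_measurable M" by measurable
  qed
qed

text \<open>Expand the power over all \<open>k\<close>-tuples of frequencies and apply the moment
  condition to each tuple. The coefficients then multiply the error by the \<open>k\<close>-th power
  of their absolute sum.\<close>

lemma moments_close:
  assumes pf: "periodic_family m \<Omega> \<phi>" and a2: "assumption2 N m \<Omega> \<phi>"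
    and mc: "moment_condition M X \<eta> C\<^sub>1 K m \<Omega> \<phi>" and "C\<^sub>1 \<ge> 0"
    and k: "real k \<le> ln (real m) / ln (ln (real m))"
  shows "\<bar>avg \<Omega> (\<lambda>a. family_sum c m (\<phi> a) ^ k) - expectation (\<lambda>w. model_sum c m w ^ k)\<bar>
    \<le> \<bar>K\<bar> * (C\<^sub>1 * (\<Sum>h\<in>freqs m. \<bar>c h\<bar>)) ^ k / real m powr \<eta>"
\<comment> \<open>The moment condition starts at \<open>k = 1\<close>; for \<open>k = 0\<close> both
  means are 1.\<close>
proof (cases "k = 0")
  case True
  thus ?thesis using pf by (simp add: periodic_family_def avg_const prob_space)
next
  case False
  define G where "G = PiE {1..k} (\<lambda>_. freqs m)"
  define r where "r = (\<lambda>a h. Re (fourier m (\<phi> a) h))"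
  define E where "E = (\<lambda>g. expectation (\<lambda>w. \<Prod>i=1..k. X (g i) w))"
  define A where "A = (\<lambda>g. avg \<Omega> (\<lambda>a. \<Prod>i=1..k. r a (g i)))"
  have fin: "finite G" unfolding G_def by (intro finite_PiE) auto
  have real: "fourier m (\<phi> a) h = complex_of_real (r a h)" if "a \<in> \<Omega>" for a h
  proof -
    have "fourier m (\<phi> a) h \<in> complex_of_real ` {-N..N}"
      using a2 that unfolding assumption2_def by blast
    thus ?thesis by (auto simp: r_def)
  qed
  have close: "\<bar>A g - E g\<bar> \<le> \<bar>K\<bar> * (C\<^sub>1 ^ k / real m powr \<eta>)" if "g \<in> G" for g
  proof -
    have g: "g i \<in> freqs m" if "i \<in> {1..k}" for i
      using \<open>g \<in> G\<close> that by (auto simp: G_def PiE_def Pi_def)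
    have rng: "- real m / 2 < real_of_int (g i) \<and> real_of_int (g i) \<le> real m / 2 \<and> g i \<noteq> 0"
      if "i \<in> {1..k}" for i
    proof -
      have "2 * \<bar>g i\<bar> < int m" "g i \<noteq> 0" using g[OF that] by (auto simp: freqs_def)
      hence "2 * \<bar>real_of_int (g i)\<bar> < real m" by linarith
      thus ?thesis using \<open>g i \<noteq> 0\<close> by (auto simp: abs_if split: if_splits)
    qed
    have "norm ((\<Sum>a\<in>\<Omega>. \<Prod>i=1..k. fourier m (\<phi> a) (g i)) / of_nat (card \<Omega>) - complex_of_real (E g))
        \<le> K * (C\<^sub>1 ^ k / real m powr \<eta>)"
      using mc k False rng unfolding moment_condition_def E_def by auto
    also have "(\<Sum>a\<in>\<Omega>. \<Prod>i=1..k. fourier m (\<phi> a) (g i)) / of_nat (card \<Omega>) = complex_of_real (A g)"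
      by (simp add: real A_def avg_def)
    also have "norm (complex_of_real (A g) - complex_of_real (E g)) = \<bar>A g - E g\<bar>"
      by (simp flip: of_real_diff)
    also have "K * (C\<^sub>1 ^ k / real m powr \<eta>) \<le> \<bar>K\<bar> * (C\<^sub>1 ^ k / real m powr \<eta>)"
      using \<open>C\<^sub>1 \<ge> 0\<close> by (intro mult_right_mono) auto
    finally show ?thesis .
  qed
  have "avg \<Omega> (\<lambda>a. family_sum c m (\<phi> a) ^ k) = (\<Sum>g\<in>G. (\<Prod>i=1..k. c (g i)) * A g)"
    unfolding family_sum_def power_sum_PiE G_def[symmetric] A_def r_def
    by (simp add: prod.distrib avg_sum avg_cmult)
  moreover have "expectation (\<lambda>w. model_sum c m w ^ k) = (\<Sum>g\<in>G. (\<Prod>i=1..k. c (g i)) * E g)"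
  proof -
    have int: "integrable M (\<lambda>w. (\<Prod>i=1..k. c (g i)) * (\<Prod>i=1..k. X (g i) w))" if "g \<in> G" for g
      using integrable_prod_X that unfolding G_def by (intro integrable_mult_right)
    show ?thesis
      unfolding model_sum_def power_sum_PiE G_def[symmetric] E_def prod.distrib
      by (subst Bochner_Integration.integral_sum[OF int]) (simp_all only: integral_mult_right_zero)
  qed
  ultimately have "\<bar>avg \<Omega> (\<lambda>a. family_sum c m (\<phi> a) ^ k) - expectation (\<lambda>w. model_sum c m w ^ k)\<bar> =
      \<bar>\<Sum>g\<in>G. (\<Prod>i=1..k. c (g i)) * (A g - E g)\<bar>"
    by (simp add: sum_subtractf right_diff_distrib)
  also have "\<dots> \<le> (\<Sum>g\<in>G. (\<Prod>i=1..k. \<bar>c (g i)\<bar>) * (\<bar>K\<bar> * (C\<^sub>1 ^ k / real m powr \<eta>)))"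
    unfolding abs_prod[symmetric] using close
    by (intro order_trans[OF sum_abs] sum_mono) (simp only: abs_mult mult_left_mono abs_ge_zero)
  also have "\<dots> = (\<Sum>h\<in>freqs m. \<bar>c h\<bar>) ^ k * (\<bar>K\<bar> * (C\<^sub>1 ^ k / real m powr \<eta>))"
    unfolding power_sum_PiE G_def by (simp only: sum_distrib_right)
  also have "\<dots> = \<bar>K\<bar> * (C\<^sub>1 * (\<Sum>h\<in>freqs m. \<bar>c h\<bar>)) ^ k / real m powr \<eta>"
    by (simp add: power_mult_distrib)
  finally show ?thesis .
qed

definition model_mgf :: "(int \<Rightarrow> real) \<Rightarrow> nat \<Rightarrow> real \<Rightarrow> real" where
  "model_mgf c m t = expectation (\<lambda>w. exp (t * model_sum c m w))"

text \<open>As \<open>Q \<ge> 1\<close>, all powers up to degree \<open>n\<close> are at most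
  \<open>Q ^ n\<close>, and the weights \<open>1 / fact k\<close> add up to at most e. The second
  estimate treats the top term separately, because it bounds the contribution of negative values in
  \<open>prop_gt_lower\<close>.\<close>

lemma family_taylor_close:
  assumes pf: "periodic_family m \<Omega> \<phi>" and a2: "assumption2 N m \<Omega> \<phi>"
    and mc: "moment_condition M X \<eta> C\<^sub>1 K m \<Omega> \<phi>" and C1: "C\<^sub>1 \<ge> 0"
    and n: "real n \<le> ln (real m) / ln (ln (real m))"
    and Q: "Q \<ge> 1" "s * (C\<^sub>1 * (\<Sum>h\<in>freqs m. \<bar>c h\<bar>)) \<le> Q" and s: "s \<ge> 0"
  shows "\<bar>avg \<Omega> (\<lambda>a. exp_taylor n (s * family_sum c m (\<phi> a))) - expectation (\<lambda>w. exp_taylor n (s * model_sum c m w))\<bar>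
      \<le> \<bar>K\<bar> * (exp 1 * Q ^ n) / real m powr \<eta>"
    and "\<bar>avg \<Omega> (\<lambda>a. (s * family_sum c m (\<phi> a)) ^ n / fact n) - expectation (\<lambda>w. (s * model_sum c m w) ^ n / fact n)\<bar>
      \<le> \<bar>K\<bar> * (exp 1 * Q ^ n) / real m powr \<eta>"
proof -
  define x where "x = (\<lambda>a. family_sum c m (\<phi> a))"
  define Y where "Y = model_sum c m"
  define d where "d = (\<lambda>k. avg \<Omega> (\<lambda>a. x a ^ k) - expectation (\<lambda>w. Y w ^ k))"
  have S: "C\<^sub>1 * (\<Sum>h\<in>freqs m. \<bar>c h\<bar>) \<ge> 0" using C1 by (intro mult_nonneg_nonneg sum_nonneg) auto
  have termwise: "\<bar>s ^ k / fact k * d k\<bar> \<le> \<bar>K\<bar> * Q ^ n / real m powr \<eta> * (1 / fact k)" if "k \<le> n" for k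
  proof -
    have "\<bar>d k\<bar> \<le> \<bar>K\<bar> * (C\<^sub>1 * (\<Sum>h\<in>freqs m. \<bar>c h\<bar>)) ^ k / real m powr \<eta>"
      unfolding d_def x_def Y_def using that n by (intro moments_close[OF pf a2 mc C1]) linarith
    hence "s ^ k / fact k * \<bar>d k\<bar> \<le> s ^ k / fact k * (\<bar>K\<bar> * (C\<^sub>1 * (\<Sum>h\<in>freqs m. \<bar>c h\<bar>)) ^ k / real m powr \<eta>)"
      using s by (intro mult_left_mono) auto
    also have "\<dots> = \<bar>K\<bar> * (s * (C\<^sub>1 * (\<Sum>h\<in>freqs m. \<bar>c h\<bar>))) ^ k / real m powr \<eta> * (1 / fact k)"
      by (simp add: power_mult_distrib mult.commute mult.left_commute)
    also have "\<dots> \<le> \<bar>K\<bar> * Q ^ n / real m powr \<eta> * (1 / fact k)"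
    proof (intro mult_right_mono divide_right_mono mult_left_mono)
      have "(s * (C\<^sub>1 * (\<Sum>h\<in>freqs m. \<bar>c h\<bar>))) ^ k \<le> Q ^ k" using Q S s by (intro power_mono) auto
      also have "\<dots> \<le> Q ^ n" using Q that by (intro power_increasing) auto
      finally show "(s * (C\<^sub>1 * (\<Sum>h\<in>freqs m. \<bar>c h\<bar>))) ^ k \<le> Q ^ n" .
    qed auto
    finally show ?thesis using s by (simp add: abs_mult)
  qed
  have int: "integrable M (\<lambda>w. Y w ^ k)" for k
    unfolding Y_def by (rule integrable_bounded_model) (intro continuous_intros)
  have "avg \<Omega> (\<lambda>a. exp_taylor n (s * x a)) = (\<Sum>k\<le>n. s ^ k / fact k * avg \<Omega> (\<lambda>a. x a ^ k))"
    unfolding exp_taylor_def avg_sum avg_cmult[symmetric] by (simp add: power_mult_distrib)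
  moreover have "expectation (\<lambda>w. exp_taylor n (s * Y w)) = (\<Sum>k\<le>n. s ^ k / fact k * expectation (\<lambda>w. Y w ^ k))"
  proof -
    have "expectation (\<lambda>w. exp_taylor n (s * Y w)) = expectation (\<lambda>w. \<Sum>k\<le>n. s ^ k / fact k * Y w ^ k)"
      by (simp add: exp_taylor_def power_mult_distrib)
    also have "\<dots> = (\<Sum>k\<le>n. expectation (\<lambda>w. s ^ k / fact k * Y w ^ k))"
      by (intro Bochner_Integration.integral_sum integrable_mult_right int)
    finally show ?thesis by (simp only: integral_mult_right_zero)
  qed
  ultimately have "avg \<Omega> (\<lambda>a. exp_taylor n (s * x a)) - expectation (\<lambda>w. exp_taylor n (s * Y w)) =
      (\<Sum>k\<le>n. s ^ k / fact k * d k)"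
    by (simp add: d_def right_diff_distrib sum_subtractf)
  also have "\<bar>\<dots>\<bar> \<le> (\<Sum>k\<le>n. \<bar>K\<bar> * Q ^ n / real m powr \<eta> * (1 / fact k))"
    using termwise by (intro order_trans[OF sum_abs] sum_mono) auto
  also have "\<dots> = \<bar>K\<bar> * Q ^ n / real m powr \<eta> * exp_taylor n 1"
    by (simp add: exp_taylor_def sum_distrib_left)
  also have "\<dots> \<le> \<bar>K\<bar> * Q ^ n / real m powr \<eta> * exp 1"
    using Q by (intro mult_left_mono exp_taylor_le_exp) auto
  finally show "\<bar>avg \<Omega> (\<lambda>a. exp_taylor n (s * family_sum c m (\<phi> a))) - expectation (\<lambda>w. exp_taylor n (s * model_sum c m w))\<bar>
      \<le> \<bar>K\<bar> * (exp 1 * Q ^ n) / real m powr \<eta>"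
    by (simp add: x_def Y_def mult_ac)
  have "avg \<Omega> (\<lambda>a. (s * x a) ^ n / fact n) = s ^ n / fact n * avg \<Omega> (\<lambda>a. x a ^ n)"
    unfolding avg_cmult[symmetric] by (simp add: power_mult_distrib)
  moreover have "expectation (\<lambda>w. (s * Y w) ^ n / fact n) = s ^ n / fact n * expectation (\<lambda>w. Y w ^ n)"
    unfolding integral_mult_right_zero[symmetric] by (simp add: power_mult_distrib)
  ultimately have "avg \<Omega> (\<lambda>a. (s * x a) ^ n / fact n) - expectation (\<lambda>w. (s * Y w) ^ n / fact n) = s ^ n / fact n * d n"
    by (simp add: d_def right_diff_distrib)
  also have "\<bar>\<dots>\<bar> \<le> \<bar>K\<bar> * Q ^ n / real m powr \<eta> * (1 / fact n)" by (rule termwise) simp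
  also have "\<dots> \<le> \<bar>K\<bar> * Q ^ n / real m powr \<eta> * exp 1"
  proof (intro mult_left_mono)
    have "1 / fact n \<le> (1::real)" by (simp add: fact_ge_1)
    also have "\<dots> \<le> exp 1" by simp
    finally show "1 / fact n \<le> exp (1::real)" .
  qed (use Q in auto)
  finally show "\<bar>avg \<Omega> (\<lambda>a. (s * family_sum c m (\<phi> a)) ^ n / fact n) - expectation (\<lambda>w. (s * model_sum c m w) ^ n / fact n)\<bar>
      \<le> \<bar>K\<bar> * (exp 1 * Q ^ n) / real m powr \<eta>"
    by (simp add: x_def Y_def mult_ac)
qed

lemma integrable_exp_model [simp]: "integrable M (\<lambda>w. exp (t * model_sum c m w))"
  by (rule integrable_bounded_model) (intro continuous_intros)

lemma integrable_taylor_model [simp]: "integrable M (\<lambda>w. exp_taylor n (t * model_sum c m w))"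
  unfolding exp_taylor_def by (rule integrable_bounded_model) (intro continuous_intros, auto)

lemma integrable_power_model [simp]: "integrable M (\<lambda>w. (t * model_sum c m w) ^ n / fact n)"
  by (rule integrable_bounded_model) (intro continuous_intros, auto)

lemma model_taylor_bounds:
  fixes c :: "int \<Rightarrow> real" and m :: nat and s :: real
  assumes n: "even n"
  defines "\<epsilon> \<equiv> exp (- real n) * (model_mgf c m (exp 1 * s) + model_mgf c m (- (exp 1 * s)))"
  shows "expectation (\<lambda>w. exp_taylor n (s * model_sum c m w)) \<le> model_mgf c m s + \<epsilon>"
    and "model_mgf c m s - \<epsilon> \<le> expectation (\<lambda>w. exp_taylor n (s * model_sum c m w))"
    and "expectation (\<lambda>w. (s * model_sum c m w) ^ n / fact n) \<le> \<epsilon>"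
proof -
  define Y where "Y = model_sum c m"
  note [simp] = integrable_exp_model[of _ c m, folded Y_def] integrable_taylor_model[of n _ c m, folded Y_def]
    integrable_power_model[of _ c m n, folded Y_def]
  have F: "model_mgf c m t = expectation (\<lambda>w. exp (t * Y w))" for t
    by (simp add: model_mgf_def Y_def)
  have exp_int: "integrable M (\<lambda>w. exp (t * Y w))" for t
    unfolding Y_def by (rule integrable_exp_model)
  have int: "integrable M (\<lambda>w. exp (- real n) * (exp (exp 1 * s * Y w) + exp (- (exp 1 * s) * Y w)))"
    by (intro integrable_mult_right Bochner_Integration.integrable_add exp_int)
  have "expectation (\<lambda>w. (s * Y w) ^ n / fact n) \<le>
      expectation (\<lambda>w. exp (- real n) * (exp (exp 1 * s * Y w) + exp (- (exp 1 * s) * Y w)))"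
    using even_power_le_exp[OF n] by (intro integral_mono int) (simp_all add: mult.assoc)
  also have "\<dots> = \<epsilon>" unfolding \<epsilon>_def F
    by (simp only: integral_mult_right_zero Bochner_Integration.integral_add[OF exp_int exp_int])
  finally show pow: "expectation (\<lambda>w. (s * model_sum c m w) ^ n / fact n) \<le> \<epsilon>" by (simp add: Y_def)
  have "expectation (\<lambda>w. exp_taylor n (s * Y w)) \<le> expectation (\<lambda>w. exp (s * Y w) + (s * Y w) ^ n / fact n)"
    using exp_taylor_le_exp_plus[OF n] by (intro integral_mono Bochner_Integration.integrable_add) auto
  also have "\<dots> = model_mgf c m s + expectation (\<lambda>w. (s * Y w) ^ n / fact n)"
    unfolding F by (intro Bochner_Integration.integral_add) auto
  finally show "expectation (\<lambda>w. exp_taylor n (s * model_sum c m w)) \<le> model_mgf c m s + \<epsilon>"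
    using pow by (simp add: Y_def)
  have "model_mgf c m s \<le> expectation (\<lambda>w. exp_taylor n (s * Y w) + exp (- real n) * exp (exp 1 * s * Y w))"
    unfolding F
  proof (intro integral_mono Bochner_Integration.integrable_add integrable_mult_right exp_int)
    show "exp (s * Y w) \<le> exp_taylor n (s * Y w) + exp (- real n) * exp (exp 1 * s * Y w)" for w
      using exp_le_exp_taylor_plus[OF n, of "s * Y w"] by (simp add: mult.assoc)
  qed auto
  also have "\<dots> = expectation (\<lambda>w. exp_taylor n (s * Y w)) + exp (- real n) * model_mgf c m (exp 1 * s)"
    unfolding F by (subst Bochner_Integration.integral_add) auto
  also have "exp (- real n) * model_mgf c m (exp 1 * s) \<le> \<epsilon>"
    unfolding \<epsilon>_def by (intro mult_left_mono) (auto simp: model_mgf_def)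
  finally show "model_mgf c m s - \<epsilon> \<le> expectation (\<lambda>w. exp_taylor n (s * model_sum c m w))"
    by (simp add: Y_def)
qed

lemma family_taylor_bounds:
  assumes "periodic_family m \<Omega> \<phi>" "assumption2 N m \<Omega> \<phi>" "moment_condition M X \<eta> C\<^sub>1 K m \<Omega> \<phi>" "C\<^sub>1 \<ge> 0"
    "real n \<le> ln (real m) / ln (ln (real m))" "Q \<ge> 1" "s * (C\<^sub>1 * (\<Sum>h\<in>freqs m. \<bar>c h\<bar>)) \<le> Q" "s \<ge> 0"
    and n: "even n" and small: "\<bar>K\<bar> * (exp 1 * Q ^ n) / real m powr \<eta> \<le> 1"
      "exp (- real n) * (model_mgf c m (exp 1 * s) + model_mgf c m (- (exp 1 * s))) \<le> 1"
  shows "avg \<Omega> (\<lambda>a. exp_taylor n (s * family_sum c m (\<phi> a))) \<le> model_mgf c m s + 2"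
    and "model_mgf c m s - 2 \<le> avg \<Omega> (\<lambda>a. exp_taylor n (s * family_sum c m (\<phi> a)))"
    and "avg \<Omega> (\<lambda>a. (s * family_sum c m (\<phi> a)) ^ n / fact n) \<le> 2"
  using family_taylor_close[OF assms(1-8)] model_taylor_bounds[OF n, where c = c and m = m and s = s] small
  by (auto simp: abs_le_iff)

end

section \<open>The saddle point estimate\<close>

definition saddle :: "real \<Rightarrow> real \<Rightarrow> real \<Rightarrow> real" where
  "saddle \<kappa> D V = exp (V / \<kappa> - D - 1)"

text \<open>Chosen so that \<open>(width \<kappa> V)\<^sup>2\<close> times the saddle point is a
  constant multiple of \<open>V\<^sup>2\<close>, enough to beat cumulant errors of order V, while
  \<open>width \<kappa> V\<close> times the saddle point is a constant multiple of the permitted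
  error \<open>V * exp (V / (2 * \<kappa>))\<close>.\<close>

definition width :: "real \<Rightarrow> real \<Rightarrow> real" where
  "width \<kappa> V = V * exp (- V / (2 * \<kappa>))"

lemma saddle_pos [simp]: "saddle \<kappa> D V > 0"
  by (simp add: saddle_def)

lemma ln_saddle: "ln (saddle \<kappa> D V) = V / \<kappa> - D - 1"
  by (simp add: saddle_def)

lemma cumulant_at_saddle:
  fixes \<kappa> D V :: real
  assumes "\<kappa> > 0"
  defines "s \<equiv> saddle \<kappa> D V"
  shows "\<kappa> * s * (ln s + D) = s * V - \<kappa> * s"
  using assms by (simp add: s_def ln_saddle field_simps)

text \<open>Stationarity makes V the coefficient of the linear term, and
  \<open>ln (1 + \<mu>) \<le> \<mu>\<close> bounds everything of higher order by a quadratic term,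
  for both signs of \<mu>.\<close>

lemma cumulant_near_saddle:
  fixes \<kappa> D V \<mu> :: real
  assumes \<kappa>: "\<kappa> > 0" and \<mu>: "\<mu> > -1"
  defines "s \<equiv> saddle \<kappa> D V"
  shows "\<kappa> * (s * (1 + \<mu>)) * (ln (s * (1 + \<mu>)) + D) \<le> s * V - \<kappa> * s + \<mu> * s * V + \<kappa> * s * \<mu>\<^sup>2"
proof -
  have s: "s > 0" by (simp add: s_def)
  have "ln (1 + \<mu>) \<le> \<mu>" using \<mu> by (simp add: ln_add_one_self_le_self2)
  hence "\<kappa> * (s * (1 + \<mu>)) * ln (1 + \<mu>) \<le> \<kappa> * (s * (1 + \<mu>)) * \<mu>"
    using \<kappa> s \<mu> by (intro mult_left_mono) auto
  moreover have "\<kappa> * (s * (1 + \<mu>)) * (ln (s * (1 + \<mu>)) + D) =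
      (1 + \<mu>) * (\<kappa> * s * (ln s + D)) + \<kappa> * (s * (1 + \<mu>)) * ln (1 + \<mu>)"
  proof -
    have "ln (s * (1 + \<mu>)) = ln s + ln (1 + \<mu>)" using s \<mu> by (subst ln_mult) auto
    thus ?thesis by (simp add: algebra_simps)
  qed
  moreover have "\<kappa> * s * (ln s + D) = s * V - \<kappa> * s"
    unfolding s_def by (rule cumulant_at_saddle[OF \<kappa>])
  ultimately have "\<kappa> * (s * (1 + \<mu>)) * (ln (s * (1 + \<mu>)) + D) \<le>
      (1 + \<mu>) * (s * V - \<kappa> * s) + \<kappa> * (s * (1 + \<mu>)) * \<mu>" by simp
  also have "\<dots> = s * V - \<kappa> * s + \<mu> * s * V + \<kappa> * s * \<mu>\<^sup>2"
    by (simp add: algebra_simps power2_eq_square)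
  finally show ?thesis .
qed

text \<open>Chernoff's bound at the saddle point: the term \<open>s * V\<close> of the cumulant
  cancels and \<open>- \<kappa> * s\<close> remains. The loss \<open>O(ln s) = O(V)\<close> is well
  below the permitted error.\<close>

lemma saddle_upper:
  assumes \<kappa>: "\<kappa> > 0" and C0: "C\<^sub>0 \<ge> 0" and F: "F \<ge> (1::real)" and V: "V \<ge> 1"
    and asym: "ln F \<le> \<kappa> * saddle \<kappa> D V * (ln (saddle \<kappa> D V) + D) + C\<^sub>0 * ln (saddle \<kappa> D V)"
    and P: "P > 0" "P \<le> 2 * (F + 2) * exp (- saddle \<kappa> D V * V)"
  shows "ln P + \<kappa> * saddle \<kappa> D V \<le> (3 + C\<^sub>0 * (1 / \<kappa> + \<bar>D\<bar>)) * (V * exp (V / (2 * \<kappa>)))"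
proof -
  define s where "s = saddle \<kappa> D V"
  have "2 * (F + 2) * exp (- s * V) \<le> 6 * F * exp (- s * V)"
    using F by (intro mult_right_mono) auto
  hence "P \<le> 6 * F * exp (- s * V)" using P(2) unfolding s_def by (rule order_trans[rotated])
  hence "ln P \<le> ln (6 * F * exp (- s * V))" using P by (intro ln_mono) auto
  also have "\<dots> = ln 6 + ln F - s * V" using F by (simp add: ln_mult)
  also have "\<dots> \<le> ln 6 + (s * V - \<kappa> * s) + C\<^sub>0 * ln s - s * V"
    using asym cumulant_at_saddle[OF \<kappa>, of D V] by (simp add: s_def)
  finally have "ln P + \<kappa> * s \<le> ln 6 + C\<^sub>0 * ln s" by simp
  also have "ln 6 \<le> (3::real)"
  proof -
    have "2 ^ 3 \<le> exp (1::real) ^ 3" using exp_ge_add_one_self_aux[of 1] by (intro power_mono) auto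
    also have "\<dots> = exp 3" by (simp flip: exp_of_nat_mult)
    finally have "ln 6 \<le> ln (exp (3::real))" by (subst ln_le_cancel_iff) auto
    thus ?thesis by simp
  qed
  also have "C\<^sub>0 * ln s \<le> C\<^sub>0 * ((1 / \<kappa> + \<bar>D\<bar>) * V)"
  proof (intro mult_left_mono C0)
    have "\<bar>D\<bar> * 1 \<le> \<bar>D\<bar> * V" using V by (intro mult_left_mono) auto
    thus "ln s \<le> (1 / \<kappa> + \<bar>D\<bar>) * V" by (simp add: s_def ln_saddle algebra_simps)
  qed
  also have "3 + C\<^sub>0 * ((1 / \<kappa> + \<bar>D\<bar>) * V) \<le> (3 + C\<^sub>0 * (1 / \<kappa> + \<bar>D\<bar>)) * V"
    using V by (simp add: algebra_simps)
  also have "\<dots> \<le> (3 + C\<^sub>0 * (1 / \<kappa> + \<bar>D\<bar>)) * (V * exp (V / (2 * \<kappa>)))"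
    using V C0 \<kappa> by (intro mult_left_mono) auto
  finally show ?thesis by (simp add: s_def)
qed

text \<open>The largeness conditions on V for \<open>saddle_lower\<close>. The 7 makes each
  discarded part at most an eighth of the main term, since \<open>6 * exp (- 7) \<le> 1 / 8\<close>;
  the 5 makes the main term at least 20; the 16 keeps the smaller tilt at least 8, where the
  cumulant asymptotics start.\<close>

lemma width_properties:
  fixes \<kappa> D C\<^sub>0 :: real
  assumes "\<kappa> > 0" "C\<^sub>0 > 0"
  shows "\<forall>\<^sub>F V in at_top. V \<ge> 1 \<and> V \<ge> \<kappa> + 1 \<and> width \<kappa> V \<le> 1 \<and> width \<kappa> V \<le> \<kappa> \<and> saddle \<kappa> D V \<ge> 16
    \<and> 7 + C\<^sub>0 * (2 * ((V + 1) / \<kappa> + \<bar>D\<bar>) + 1) \<le> V\<^sup>2 * exp (- D - 1) / (4 * \<kappa>)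
    \<and> 5 + C\<^sub>0 * ((V + 1) / \<kappa> + \<bar>D\<bar>) \<le> saddle \<kappa> D V"
proof -
  have E: "exp (V / \<kappa>) * exp (- D - 1) = saddle \<kappa> D V" for V
    by (simp add: saddle_def flip: exp_add)
  have "(width \<kappa> \<longlongrightarrow> 0) at_top" unfolding width_def using assms by real_asymp
  hence 1: "\<forall>\<^sub>F V in at_top. width \<kappa> V < 1" "\<forall>\<^sub>F V in at_top. width \<kappa> V < \<kappa>"
    using assms by (auto intro: order_tendstoD)
  have "filterlim (\<lambda>V. V\<^sup>2 * E / (4 * \<kappa>) - C\<^sub>0 * (2 * ((V + 1) / \<kappa> + d) + 1)) at_top at_top"
    if "E > 0" for E d :: real using that assms by real_asymp
  hence 2: "\<forall>\<^sub>F V in at_top. 7 \<le> V\<^sup>2 * exp (- D - 1) / (4 * \<kappa>) - C\<^sub>0 * (2 * ((V + 1) / \<kappa> + \<bar>D\<bar>) + 1)"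
    unfolding filterlim_at_top by simp
  have "filterlim (\<lambda>V. exp (V / \<kappa>) * E - C\<^sub>0 * ((V + 1) / \<kappa> + d)) at_top at_top"
    if "E > 0" for E d :: real using that assms by real_asymp
  hence 3: "\<forall>\<^sub>F V in at_top. 5 \<le> exp (V / \<kappa>) * exp (- D - 1) - C\<^sub>0 * ((V + 1) / \<kappa> + \<bar>D\<bar>)"
    unfolding filterlim_at_top by simp
  have "filterlim (\<lambda>V. exp (V / \<kappa>) * E) at_top at_top"
    if "E > 0" for E :: real using that assms by real_asymp
  hence 4: "\<forall>\<^sub>F V in at_top. 16 \<le> exp (V / \<kappa>) * exp (- D - 1)"
    unfolding filterlim_at_top by simp
  show ?thesis
    using 1 2 3[unfolded E] 4[unfolded E] eventually_ge_at_top[of 1] eventually_ge_at_top[of "\<kappa> + 1"]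
    by eventually_elim (intro conjI; linarith)
qed

text \<open>\<open>saddle \<kappa> D V\<close> is the stationary point of \<open>\<kappa> s (ln s + D) - s V\<close>. Tilting at the saddle point of
  \<open>V + \<delta>\<close> puts most of the mass between \<open>V\<close> and \<open>V + 2\<delta>\<close>: moving the tilt by the factors
  \<open>1 \<plusminus> \<delta> / (2\<kappa>)\<close> gains \<open>exp (\<delta>\<^sup>2 s / (4\<kappa>))\<close> outside this window.\<close>

lemma saddle_lower:
  fixes \<kappa> D C\<^sub>0 V P :: real and F :: "real \<Rightarrow> real"
  defines "\<delta> \<equiv> width \<kappa> V"
  defines "w \<equiv> V + \<delta>"
  defines "s \<equiv> saddle \<kappa> D w"
  defines "\<mu> \<equiv> \<delta> / (2 * \<kappa>)"
  defines "s1 \<equiv> s * (1 - \<mu>)" and "s2 \<equiv> s * (1 + \<mu>)"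
  assumes \<kappa>: "\<kappa> > 0" and C0: "C\<^sub>0 > 0" and F: "\<And>t. F t \<ge> 1" and V: "V \<ge> 1" "V \<ge> \<kappa> + 1"
    and \<delta>: "\<delta> \<le> 1" "\<delta> \<le> \<kappa>" and s16: "saddle \<kappa> D V \<ge> 16"
    and big1: "7 + C\<^sub>0 * (2 * ((V + 1) / \<kappa> + \<bar>D\<bar>) + 1) \<le> V\<^sup>2 * exp (- D - 1) / (4 * \<kappa>)"
    and big2: "5 + C\<^sub>0 * ((V + 1) / \<kappa> + \<bar>D\<bar>) \<le> saddle \<kappa> D V"
    and asym: "\<And>t. t \<in> {s, s1, s2} \<Longrightarrow> \<bar>ln (F t) - \<kappa> * t * (ln t + D)\<bar> \<le> C\<^sub>0 * ln t"
    and lower: "F s - 2 \<le> 3 + 2 * exp ((s - s1) * V) * (F s1 + 2)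
       + 2 * exp (- (s2 - s) * (V + 2 * \<delta>)) * (F s2 + 2) + exp (s * (V + 2 * \<delta>)) * P"
  shows "P > 0" and "ln P + \<kappa> * saddle \<kappa> D V \<ge>
    - (1 + 5 * exp (- D - 1) + C\<^sub>0 * (2 / \<kappa> + \<bar>D\<bar>)) * (V * exp (V / (2 * \<kappa>)))"
proof -
  define L where "L = s * w - \<kappa> * s"
  have \<delta>0: "\<delta> > 0" using V by (simp add: \<delta>_def width_def)
  have \<mu>: "0 < \<mu>" "\<mu> \<le> 1 / 2" using \<delta>0 \<delta> \<kappa> by (auto simp: \<mu>_def field_simps)
  have s_ge: "s \<ge> saddle \<kappa> D V" using \<delta>0 \<kappa> by (simp add: s_def saddle_def w_def divide_right_mono)
  have s: "s \<ge> 16" using s_ge s16 by linarith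
  have ln_s: "ln s \<le> (V + 1) / \<kappa> + \<bar>D\<bar>"
  proof -
    have "w / \<kappa> \<le> (V + 1) / \<kappa>" using \<delta> \<kappa> by (intro divide_right_mono) (auto simp: w_def)
    thus ?thesis by (simp add: s_def ln_saddle)
  qed
  have L: "\<kappa> * s * (ln s + D) = L"
    unfolding L_def s_def by (rule cumulant_at_saddle[OF \<kappa>])
  have Fs: "F s \<ge> exp (L - C\<^sub>0 * ln s)"
  proof -
    have "L - C\<^sub>0 * ln s \<le> ln (F s)" using asym[of s] L by (auto simp: abs_le_iff)
    thus ?thesis using F[of s] by (simp add: ln_ge_iff)
  qed
  \<comment> \<open>The tilting gain has order \<open>V\<^sup>2\<close>, against cumulant errors of
    order V.\<close>
  have gain: "7 + C\<^sub>0 * (2 * ln s + 1) \<le> \<delta>\<^sup>2 * s / (4 * \<kappa>)"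
  proof -
    have "7 + C\<^sub>0 * (2 * ln s + 1) \<le> 7 + C\<^sub>0 * (2 * ((V + 1) / \<kappa> + \<bar>D\<bar>) + 1)"
      using C0 ln_s by (intro add_left_mono mult_left_mono add_right_mono) auto
    also have "\<dots> \<le> V\<^sup>2 * exp (- D - 1) / (4 * \<kappa>)" by (rule big1)
    also have "V\<^sup>2 * exp (- D - 1) = \<delta>\<^sup>2 * saddle \<kappa> D V"
    proof -
      have "(exp (- V / (2 * \<kappa>)))\<^sup>2 = exp (- V / \<kappa>)"
        by (simp add: power2_eq_square flip: exp_add)
      moreover have "exp (- V / \<kappa>) * saddle \<kappa> D V = exp (- D - 1)"
        by (simp add: saddle_def flip: exp_add)
      ultimately show ?thesis by (simp add: \<delta>_def width_def power_mult_distrib mult.assoc)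
    qed
    also have "\<delta>\<^sup>2 * saddle \<kappa> D V / (4 * \<kappa>) \<le> \<delta>\<^sup>2 * s / (4 * \<kappa>)"
      using s_ge \<kappa> by (intro divide_right_mono mult_left_mono) auto
    finally show ?thesis .
  qed
  \<comment> \<open>Both outer parts at once, with \<nu> = - \<mu> for \<open>s1\<close> and \<nu> =
    \<mu> for \<open>s2\<close>. The exponent changes by
    \<open>\<kappa> * s * \<mu>\<^sup>2 - \<mu> * s * \<delta>\<close>, which \<mu> = \<delta> / (2
    \<kappa>) minimises.\<close>
  have tail: "2 * exp e * (F t + 2) \<le> F s / 8"
    if t: "t = s * (1 + \<nu>)" "t \<in> {s1, s2}" and \<nu>: "\<bar>\<nu>\<bar> = \<mu>" and e: "e = - \<nu> * s * w - \<mu> * s * \<delta>" for e t \<nu>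
  proof -
    have t0: "t > 0" using s t \<nu> \<mu> by (auto intro!: mult_pos_pos)
    have "ln t \<le> ln s + 1"
    proof -
      have "ln t = ln s + ln (1 + \<nu>)" using s \<nu> \<mu> unfolding t(1) by (subst ln_mult) auto
      also have "ln (1 + \<nu>) \<le> \<nu>" using \<nu> \<mu> by (intro ln_add_one_self_le_self2) auto
      finally show ?thesis using \<nu> \<mu> by linarith
    qed
    hence "ln (F t) \<le> \<kappa> * t * (ln t + D) + C\<^sub>0 * (ln s + 1)"
      using asym[of t] t C0 by (auto simp: abs_le_iff intro: order_trans[OF _ mult_left_mono])
        (smt (verit) mult_left_mono)+
    also have "\<kappa> * t * (ln t + D) \<le> L + \<nu> * s * w + \<kappa> * s * \<nu>\<^sup>2"
      using cumulant_near_saddle[OF \<kappa>, of \<nu> D w] \<nu> \<mu> by (simp add: t(1) L_def s_def)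
    finally have "ln (F t) \<le> L + \<nu> * s * w + \<kappa> * s * \<nu>\<^sup>2 + C\<^sub>0 * (ln s + 1)" by simp
    moreover have "\<kappa> * s * \<nu>\<^sup>2 - \<mu> * s * \<delta> = - (\<delta>\<^sup>2 * s / (4 * \<kappa>))"
    proof -
      have "\<nu>\<^sup>2 = \<mu>\<^sup>2" using \<nu> by (metis power2_abs)
      thus ?thesis using \<kappa> by (simp add: \<mu>_def power2_eq_square field_simps)
    qed
    ultimately have "e + ln (F t) \<le> L - \<delta>\<^sup>2 * s / (4 * \<kappa>) + C\<^sub>0 * (ln s + 1)" using e by linarith
    also have "\<dots> \<le> (L - C\<^sub>0 * ln s) - 7" using gain by (simp add: algebra_simps)
    finally have "exp (e + ln (F t)) \<le> exp ((L - C\<^sub>0 * ln s) + - 7)" by simp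
    moreover have "exp (e + ln (F t)) = exp e * F t" using F[of t] by (simp add: exp_add)
    ultimately have 1: "exp e * F t \<le> exp (L - C\<^sub>0 * ln s) * exp (- 7)"
      by (simp only: exp_add)
    have "2 * exp e * (F t + 2) \<le> 6 * (exp e * F t)"
      using F[of t] by (simp add: algebra_simps)
    also have "\<dots> \<le> 6 * (F s * exp (-7))"
      using 1 Fs by (smt (verit) exp_gt_zero mult_right_mono)
    also have "\<dots> \<le> F s / 8"
    proof -
      have "2 ^ 7 \<le> exp (1::real) ^ 7" using exp_ge_add_one_self_aux[of 1] by (intro power_mono) auto
      also have "\<dots> = exp 7" by (simp flip: exp_of_nat_mult)
      finally have "exp (-7::real) \<le> 1 / 48" by (simp add: exp_minus field_simps)
      thus ?thesis using F[of s] mult_left_mono[of "exp (-7)" "1/48" "F s"] by simp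
    qed
    finally show ?thesis .
  qed
  have U1: "2 * exp ((s - s1) * V) * (F s1 + 2) \<le> F s / 8"
    by (rule tail[of _ "- \<mu>"]) (use \<mu> in \<open>auto simp: s1_def w_def algebra_simps\<close>)
  have U2: "2 * exp (- (s2 - s) * (V + 2 * \<delta>)) * (F s2 + 2) \<le> F s / 8"
    by (rule tail[of _ \<mu>]) (use \<mu> in \<open>auto simp: s2_def w_def algebra_simps\<close>)
  \<comment> \<open>After removing two eighths and the constants 2 and 3, at least half of
    \<open>F s\<close> must survive, which requires \<open>F s \<ge> 20\<close>.\<close>
  have F20: "F s \<ge> 20"
  proof -
    have "s * 1 \<le> s * (w - \<kappa>)" using s V \<delta>0 by (intro mult_left_mono) (auto simp: w_def)
    hence "s \<le> L" by (simp add: L_def algebra_simps)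
    moreover have "C\<^sub>0 * ln s \<le> C\<^sub>0 * ((V + 1) / \<kappa> + \<bar>D\<bar>)" using C0 ln_s by (intro mult_left_mono) auto
    ultimately have "5 \<le> L - C\<^sub>0 * ln s" using big2 s_ge by linarith
    hence "exp 5 \<le> F s" using Fs by (meson exp_le_cancel_iff order_trans)
    moreover have "2 ^ 5 \<le> exp (1::real) ^ 5" using exp_ge_add_one_self_aux[of 1] by (intro power_mono) auto
    moreover have "exp (1::real) ^ 5 = exp 5" by (simp flip: exp_of_nat_mult)
    ultimately show ?thesis by simp
  qed
  have "F s / 2 \<le> exp (s * (V + 2 * \<delta>)) * P" using lower U1 U2 F20 by linarith
  hence "F s / 2 * exp (- (s * (V + 2 * \<delta>))) \<le> exp (s * (V + 2 * \<delta>)) * P * exp (- (s * (V + 2 * \<delta>)))"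
    by (rule mult_right_mono) simp
  also have "\<dots> = P" by (simp add: exp_minus)
  finally have P: "P \<ge> F s / 2 * exp (- (s * (V + 2 * \<delta>)))" .
  moreover have "F s / 2 * exp (- (s * (V + 2 * \<delta>))) > 0" using F20 by simp
  ultimately show P0: "P > 0" by linarith
  have "exp (L - C\<^sub>0 * ln s) / 2 * exp (- (s * (V + 2 * \<delta>))) \<le> P"
    using P Fs by (smt (verit) divide_right_mono exp_gt_zero mult_right_mono)
  hence "ln (exp (L - C\<^sub>0 * ln s) / 2 * exp (- (s * (V + 2 * \<delta>)))) \<le> ln P"
    by (intro ln_mono) auto
  also have "ln (exp (L - C\<^sub>0 * ln s) / 2 * exp (- (s * (V + 2 * \<delta>)))) =
      L - C\<^sub>0 * ln s - ln 2 - s * (V + 2 * \<delta>)"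
    by (simp add: ln_mult ln_div)
  also have "\<dots> = - \<kappa> * s - C\<^sub>0 * ln s - ln 2 - s * \<delta>"
    by (simp add: L_def w_def algebra_simps)
  finally have lnP: "- \<kappa> * s - C\<^sub>0 * ln s - ln 2 - s * \<delta> \<le> ln P" .
  define sV where "sV = saddle \<kappa> D V"
  have s_le: "s \<le> sV * (1 + 2 * (\<delta> / \<kappa>))"
  proof -
    have x: "0 \<le> \<delta> / \<kappa>" "\<delta> / \<kappa> \<le> 1" using \<delta> \<delta>0 \<kappa> by auto
    have "exp (\<delta> / \<kappa>) \<le> 1 + \<delta> / \<kappa> + (\<delta> / \<kappa>)\<^sup>2" using x by (rule exp_bound)
    also have "(\<delta> / \<kappa>)\<^sup>2 \<le> \<delta> / \<kappa> * 1" unfolding power2_eq_square using x by (intro mult_left_mono)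
    finally have "exp (\<delta> / \<kappa>) \<le> 1 + 2 * (\<delta> / \<kappa>)" by simp
    moreover have "s = sV * exp (\<delta> / \<kappa>)"
      by (simp add: s_def sV_def saddle_def w_def add_divide_distrib algebra_simps flip: exp_add)
    ultimately show ?thesis by (simp add: sV_def)
  qed
  have 1: "\<kappa> * s \<le> \<kappa> * sV + 2 * (sV * \<delta>)"
    using mult_left_mono[OF s_le, of \<kappa>] \<kappa> by (simp add: algebra_simps)
  have 2: "s * \<delta> \<le> 3 * (sV * \<delta>)"
  proof -
    have "\<delta> / \<kappa> \<le> 1" using \<delta> \<kappa> by simp
    hence "sV * (1 + 2 * (\<delta> / \<kappa>)) \<le> sV * 3"
      by (intro mult_left_mono) (auto simp: sV_def intro: less_imp_le)
    hence "s \<le> 3 * sV" using s_le by linarith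
    thus ?thesis using \<delta>0 by simp
  qed
  define R where "R = V * exp (V / (2 * \<kappa>))"
  have 3: "sV * \<delta> = exp (- D - 1) * R"
  proof -
    have "exp (V / \<kappa> - D - 1) * exp (- V / (2 * \<kappa>)) = exp (- D - 1) * exp (V / (2 * \<kappa>))"
      using \<kappa> by (simp add: field_simps flip: exp_add)
    thus ?thesis by (simp add: sV_def saddle_def \<delta>_def width_def R_def)
  qed
  have R: "R \<ge> V" using V \<kappa> by (simp add: R_def)
  have 4: "C\<^sub>0 * ln s \<le> C\<^sub>0 * (2 / \<kappa> + \<bar>D\<bar>) * R"
  proof -
    have "\<bar>D\<bar> * 1 \<le> \<bar>D\<bar> * V" using V by (intro mult_left_mono) auto
    moreover have "(V + 1) / \<kappa> \<le> 2 * V / \<kappa>" using V \<kappa> by (intro divide_right_mono) auto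
    ultimately have "ln s \<le> (2 / \<kappa> + \<bar>D\<bar>) * V" using ln_s by (simp add: algebra_simps)
    also have "\<dots> \<le> (2 / \<kappa> + \<bar>D\<bar>) * R" using R \<kappa> by (intro mult_left_mono) auto
    finally show ?thesis using C0 by (simp add: mult.assoc)
  qed
  have "ln 2 \<le> (1::real)" using ln_2_less_1 by simp
  hence "ln P + \<kappa> * sV \<ge> - (R + 5 * (exp (- D - 1) * R) + C\<^sub>0 * (2 / \<kappa> + \<bar>D\<bar>) * R)"
    using lnP 1 2 3 4 R V by linarith
  also have "R + 5 * (exp (- D - 1) * R) + C\<^sub>0 * (2 / \<kappa> + \<bar>D\<bar>) * R =
      (1 + 5 * exp (- D - 1) + C\<^sub>0 * (2 / \<kappa> + \<bar>D\<bar>)) * R"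
    by (simp add: algebra_simps)
  finally show "ln P + \<kappa> * saddle \<kappa> D V \<ge>
    - (1 + 5 * exp (- D - 1) + C\<^sub>0 * (2 / \<kappa> + \<bar>D\<bar>)) * (V * exp (V / (2 * \<kappa>)))"
    by (simp only: R_def sV_def mult_minus_left)
qed

section \<open>Assembling the estimate\<close>

text \<open>With \<open>l = ln m\<close>, the third condition makes the moment error at most 1
  (leading constants 3/8 against 1/2), the fourth and fifth control the truncation (3/64 and 6/64
  against 1/8), the sixth keeps three times the largest tilt below \<open>l\<close>, the seventh
  bounds the end of the window, and the last puts \<open>V\<^sub>0\<close> into the range of the
  theorem.\<close>

lemma log_scale_conditions:
  fixes \<kappa> C\<^sub>0 C\<^sub>1 K D B V\<^sub>0 :: real
  assumes "\<kappa> > 0" "C\<^sub>0 > 0"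
  shows "\<forall>\<^sub>F l in at_top. ln l \<ge> 1 \<and> 2 * C\<^sub>1 \<le> l
    \<and> ln (\<bar>K\<bar> * exp 1 + 1) + 3 * l * ln (l + 2) / (8 * ln l) \<le> l / 2
    \<and> 3 / 64 * (l / (ln l)\<^sup>2) * (ln l + 1 + \<bar>D\<bar>) + C\<^sub>0 * (ln l + 1) + 1 \<le> l / (8 * ln l) - 2
    \<and> 6 / 64 * (l / ln l) + 1 \<le> l / (8 * ln l) - 2
    \<and> 3 / (64 * \<kappa>) \<le> (ln l)\<^sup>2
    \<and> \<kappa> * (ln l + \<bar>B\<bar>) + 2 \<le> 3 * \<kappa> * ln l
    \<and> V\<^sub>0 \<le> \<kappa> * (ln l - 2 * ln (ln l) - B)"
proof -
  have 1: "\<forall>\<^sub>F l in at_top. ln l \<ge> (1::real)" by real_asymp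
  have "filterlim (\<lambda>l::real. l / 2 - 3 * l * ln (l + 2) / (8 * ln l)) at_top at_top" by real_asymp
  hence 2: "\<forall>\<^sub>F l in at_top. ln (\<bar>K\<bar> * exp 1 + 1) \<le> l / 2 - 3 * l * ln (l + 2) / (8 * ln l)"
    unfolding filterlim_at_top by blast
  have "filterlim (\<lambda>l. l / (8 * ln l) - 3 / 64 * (l / (ln l)\<^sup>2) * (ln l + 1 + d) - C\<^sub>0 * (ln l + 1)) at_top at_top"
    for d using assms by real_asymp
  hence 3: "\<forall>\<^sub>F l in at_top. 3 \<le> l / (8 * ln l) - 3 / 64 * (l / (ln l)\<^sup>2) * (ln l + 1 + \<bar>D\<bar>) - C\<^sub>0 * (ln l + 1)"
    unfolding filterlim_at_top by blast
  have 4: "\<forall>\<^sub>F l::real in at_top. 6 / 64 * (l / ln l) + 1 \<le> l / (8 * ln l) - 2" by real_asymp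
  have "filterlim (\<lambda>l::real. (ln l)\<^sup>2) at_top at_top" by real_asymp
  hence 5: "\<forall>\<^sub>F l in at_top. 3 / (64 * \<kappa>) \<le> (ln l)\<^sup>2" unfolding filterlim_at_top by blast
  have "filterlim (\<lambda>l. 2 * \<kappa> * ln l) at_top at_top" using assms by real_asymp
  hence 6: "\<forall>\<^sub>F l in at_top. \<kappa> * \<bar>B\<bar> + 2 \<le> 2 * \<kappa> * ln l" unfolding filterlim_at_top by blast
  have "filterlim (\<lambda>l. \<kappa> * (ln l - 2 * ln (ln l))) at_top at_top" using assms by real_asymp
  hence 7: "\<forall>\<^sub>F l in at_top. V\<^sub>0 + \<kappa> * B \<le> \<kappa> * (ln l - 2 * ln (ln l))" unfolding filterlim_at_top by blast
  show ?thesis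
    using 1 2 3 4 5 6 7 eventually_ge_at_top[of "2 * C\<^sub>1"]
  proof eventually_elim
    case (elim l)
    have "\<kappa> * (ln l + \<bar>B\<bar>) + 2 \<le> 3 * \<kappa> * ln l" using elim(6) by (simp add: algebra_simps)
    moreover have "V\<^sub>0 \<le> \<kappa> * (ln l - 2 * ln (ln l) - B)" using elim(7) by (simp add: algebra_simps)
    ultimately show ?case using elim by (intro conjI) linarith+
  qed
qed

lemma prop_gt_antimono:
  assumes "finite \<Omega>" "V \<le> V'"
  shows "prop_gt \<Omega> x V' \<le> prop_gt \<Omega> x V"
  unfolding prop_gt_def using assms
  by (intro divide_right_mono of_nat_mono card_mono) auto

lemma prop_gt_le_1: "finite \<Omega> \<Longrightarrow> prop_gt \<Omega> x V \<le> 1"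
  unfolding prop_gt_def by (auto simp: divide_le_eq_1 card_gt_0_iff intro!: card_mono)

text \<open>Solve for \<theta>; dividing the additive error by the main term
  \<open>A * exp (V / \<kappa>)\<close> reverses the sign in the exponent of the error.\<close>

lemma exp_relative_error:
  fixes A \<kappa> P V C :: real
  assumes A: "A > 0" and \<kappa>: "\<kappa> > 0" and P: "P > 0"
    and bound: "\<bar>ln P + A * exp (V / \<kappa>)\<bar> \<le> C * (V * exp (V / (2 * \<kappa>)))"
  shows "\<exists>\<theta>. \<bar>\<theta>\<bar> \<le> C / A * (V * exp (- (V / (2 * \<kappa>)))) \<and> P = exp (- A * exp (V / \<kappa>) * (1 + \<theta>))"
proof (intro exI conjI)
  define E where "E = A * exp (V / \<kappa>)"
  define \<theta> where "\<theta> = - ln P / E - 1"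
  have E: "E > 0" unfolding E_def using A by (intro mult_pos_pos) auto
  have "- A * exp (V / \<kappa>) * (1 + \<theta>) = ln P"
    using E by (simp add: \<theta>_def flip: E_def)
  thus "P = exp (- A * exp (V / \<kappa>) * (1 + \<theta>))" using P by simp
  have "\<theta> = - (ln P + E) / E" using E by (simp add: \<theta>_def field_simps)
  hence "\<bar>\<theta>\<bar> = \<bar>ln P + E\<bar> / E" using E by (simp add: abs_minus_commute)
  also have "\<dots> \<le> C * (V * exp (V / (2 * \<kappa>))) / E"
    using bound E by (intro divide_right_mono) (auto simp: E_def)
  also have "\<dots> = C / A * (V * (exp (V / (2 * \<kappa>)) / exp (V / \<kappa>)))"
    by (simp add: E_def)
  also have "exp (V / (2 * \<kappa>)) / exp (V / \<kappa>) = exp (- (V / (2 * \<kappa>)))"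
    using \<kappa> by (simp add: field_simps flip: exp_diff)
  finally show "\<bar>\<theta>\<bar> \<le> C / A * (V * exp (- (V / (2 * \<kappa>))))" .
qed

section \<open>The constant of the theorem and the two signs of the half sum\<close>

context iid_model
begin

lemma A_zero_eq: "A_zero M (X 1) N = N / pi * exp (- saddle_const - 1)"
proof -
  have "- saddle_const - 1 = ln (pi / 2) +
      (- euler_mascheroni - 1 - 1 / (2 * N) * (\<integral>u. f_rv M (X 1) N u / u\<^sup>2 \<partial>lborel))"
    by (simp add: saddle_const_def ln_div)
  hence *: "exp (- saddle_const - 1) = pi / 2 *
      exp (- euler_mascheroni - 1 - 1 / (2 * N) * (\<integral>u. f_rv M (X 1) N u / u\<^sup>2 \<partial>lborel))"
    by (simp only: exp_add) simp
  show ?thesis unfolding * by (simp add: A_zero_def)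
qed

lemma A_zero_pos: "A_zero M (X 1) N > 0"
  using N_pos by (simp add: A_zero_eq)

lemma A_zero_exp: "A_zero M (X 1) N * exp (V / (N / pi)) = N / pi * saddle (N / pi) saddle_const V"
proof -
  have "exp (- saddle_const - 1) * exp (V / (N / pi)) = saddle (N / pi) saddle_const V"
    unfolding saddle_def exp_add[symmetric] by (rule arg_cong[of _ _ exp]) simp
  thus ?thesis by (simp only: A_zero_eq mult.assoc)
qed

text \<open>By the minus sign in \<open>half_sum_eq\<close>, \<sigma> = -1 gives the half sum and
  \<sigma> = 1 its negative, so both tails are upper tails of one kind of linear form.\<close>

definition signed_coeff :: "real \<Rightarrow> nat \<Rightarrow> int \<Rightarrow> real" where
  "signed_coeff \<sigma> m h = \<sigma> * half_coeff m h"

lemma model_mgf_ge_1: "model_mgf c m t \<ge> 1"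
  unfolding model_mgf_def expectation_exp_model_sum by (intro prod_ge_1 mgf_ge_1)

lemma ln_model_mgf_signed:
  assumes "\<sigma> \<in> {1, -1}"
  shows "ln (model_mgf (signed_coeff \<sigma> m) m t) = (\<Sum>j=1..(m - 1) div 2. sym_log_mgf (t * half_coeff m (int j)))"
proof -
  have "sym_log_mgf (t * signed_coeff \<sigma> m (int j)) = sym_log_mgf (t * half_coeff m (int j))" for j
    using assms by (auto simp: signed_coeff_def)
  moreover have "signed_coeff \<sigma> m (- h) = - signed_coeff \<sigma> m h" for h
    by (simp add: signed_coeff_def half_coeff_minus)
  ultimately show ?thesis
    unfolding model_mgf_def by (subst ln_expectation_exp_model_sum) auto
qed

lemma model_mgf_signed_minus:
  assumes "\<sigma> \<in> {1, -1}"
  shows "model_mgf (signed_coeff \<sigma> m) m (- t) = model_mgf (signed_coeff \<sigma> m) m t"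
proof -
  have "ln (model_mgf (signed_coeff \<sigma> m) m (- t)) = ln (model_mgf (signed_coeff \<sigma> m) m t)"
    unfolding ln_model_mgf_signed[OF assms] by simp
  moreover have "model_mgf (signed_coeff \<sigma> m) m u > 0" for u
    using model_mgf_ge_1[of "signed_coeff \<sigma> m" m u] by linarith
  ultimately show ?thesis by (simp add: ln_inj_iff)
qed

lemma sum_abs_signed_coeff:
  assumes "\<sigma> \<in> {1, -1}" "m \<ge> 3"
  shows "(\<Sum>h\<in>freqs m. \<bar>signed_coeff \<sigma> m h\<bar>) \<le> 2 * (ln (real m) + 2)"
proof -
  define r where "r = (m - 1) div 2"
  have r: "r > 0" "r \<le> m" using assms by (auto simp: r_def)
  have "(\<Sum>h\<in>freqs m. \<bar>signed_coeff \<sigma> m h\<bar>) = (\<Sum>h\<in>freqs m. \<bar>half_coeff m h\<bar>)"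
    using assms by (intro sum.cong) (auto simp: signed_coeff_def)
  also have "\<dots> = (\<Sum>j=1..r. 2 * \<bar>half_coeff m (int j)\<bar>)"
    unfolding sum_freqs by (simp add: half_coeff_minus r_def)
  also have "\<dots> \<le> (\<Sum>j=1..r. 2 * (1 / real j))"
  proof (intro sum_mono mult_left_mono)
    fix j assume "j \<in> {1..r}"
    hence "1 \<le> int j" "2 * int j < int m" by (auto simp: r_def)
    from half_coeff_bounds(2)[OF this] show "\<bar>half_coeff m (int j)\<bar> \<le> 1 / real j" by simp
  qed auto
  also have "\<dots> = 2 * harm r" by (simp add: harm_def sum_distrib_left divide_inverse)
  also have "harm r \<le> ln (real r) + 2"
    using euler_mascheroni_sequence_decreasing[of 1 r] r by (simp add: harm_expand)
  also have "ln (real r) \<le> ln (real m)" using r by simp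
  finally show ?thesis by simp
qed

lemma half_sum_eq_family_sum:
  assumes "periodic_family m \<Omega> \<phi>" "assumption2 N m \<Omega> \<phi>" "a \<in> \<Omega>"
  shows "half_sum m (\<phi> a) = family_sum (signed_coeff (-1) m) m (\<phi> a)"
    and "half_sum m (\<phi> a) = - family_sum (signed_coeff 1 m) m (\<phi> a)"
proof -
  have "Im (fourier m (\<phi> a) h) = 0" for h
  proof -
    have "fourier m (\<phi> a) h \<in> complex_of_real ` {-N..N}"
      using assms unfolding assumption2_def by blast
    thus ?thesis by auto
  qed
  moreover have "m > 0" using assms by (simp add: periodic_family_def)
  ultimately have "half_sum m (\<phi> a) = - (\<Sum>h\<in>freqs m. half_coeff m h * Re (fourier m (\<phi> a) h))"
    by (intro half_sum_eq) auto
  thus "half_sum m (\<phi> a) = family_sum (signed_coeff (-1) m) m (\<phi> a)"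
    "half_sum m (\<phi> a) = - family_sum (signed_coeff 1 m) m (\<phi> a)"
    by (simp_all add: family_sum_def signed_coeff_def sum_negf)
qed

lemma Psi_eq_prop_gt:
  assumes "periodic_family m \<Omega> \<phi>" "assumption2 N m \<Omega> \<phi>"
  shows "Psi_plus m \<Omega> \<phi> V = prop_gt \<Omega> (\<lambda>a. family_sum (signed_coeff (-1) m) m (\<phi> a)) V"
    and "Psi_minus m \<Omega> \<phi> V = prop_gt \<Omega> (\<lambda>a. family_sum (signed_coeff 1 m) m (\<phi> a)) V"
proof -
  have "{a\<in>\<Omega>. half_sum m (\<phi> a) > V} = {a\<in>\<Omega>. family_sum (signed_coeff (-1) m) m (\<phi> a) > V}"
    using half_sum_eq_family_sum(1)[OF assms] by auto
  thus "Psi_plus m \<Omega> \<phi> V = prop_gt \<Omega> (\<lambda>a. family_sum (signed_coeff (-1) m) m (\<phi> a)) V"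
    by (simp add: Psi_plus_def prop_gt_def)
  have "{a\<in>\<Omega>. half_sum m (\<phi> a) < - V} = {a\<in>\<Omega>. family_sum (signed_coeff 1 m) m (\<phi> a) > V}"
    using half_sum_eq_family_sum(2)[OF assms] by auto
  thus "Psi_minus m \<Omega> \<phi> V = prop_gt \<Omega> (\<lambda>a. family_sum (signed_coeff 1 m) m (\<phi> a)) V"
    by (simp add: Psi_minus_def prop_gt_def)
qed

end

section \<open>The tail estimate for large V\<close>

context iid_model
begin

text \<open>The fixed threshold \<open>V\<^sub>0\<close> is where the conditions of
  \<open>width_properties\<close> set in. That it lies in the admissible range for all
  \<open>m \<ge> m\<^sub>0\<close> allows smaller V to be compared with it by monotonicity
  later.\<close>

lemma family_tail_estimate:
  assumes C1: "C\<^sub>1 > 1" and \<eta>: "\<eta> \<ge> 1 / 2"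
  defines "\<kappa> \<equiv> N / pi"
  obtains V\<^sub>0 C m\<^sub>0 where "V\<^sub>0 \<ge> 1" "C \<ge> 0"
    "\<And>m. m \<ge> m\<^sub>0 \<Longrightarrow> V\<^sub>0 \<le> \<kappa> * (ln (ln (real m)) - 2 * ln (ln (ln (real m))) - B_const M (X 1) N)"
    "\<And>m (\<Omega> :: 'a set) \<phi> \<sigma> V. m \<ge> m\<^sub>0 \<Longrightarrow> periodic_family m \<Omega> \<phi> \<Longrightarrow> assumption2 N m \<Omega> \<phi> \<Longrightarrow>
      moment_condition M X \<eta> C\<^sub>1 K m \<Omega> \<phi> \<Longrightarrow> \<sigma> \<in> {1, -1} \<Longrightarrow> V\<^sub>0 \<le> V \<Longrightarrow>
      V \<le> \<kappa> * (ln (ln (real m)) - 2 * ln (ln (ln (real m))) - B_const M (X 1) N) \<Longrightarrow>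
      prop_gt \<Omega> (\<lambda>a. family_sum (signed_coeff \<sigma> m) m (\<phi> a)) V > 0 \<and>
      \<bar>ln (prop_gt \<Omega> (\<lambda>a. family_sum (signed_coeff \<sigma> m) m (\<phi> a)) V) + A_zero M (X 1) N * exp (V / \<kappa>)\<bar>
        \<le> C * (V * exp (V / (2 * \<kappa>)))"
proof -
  define D where "D = saddle_const"
  define B where "B = B_const M (X 1) N"
  have \<kappa>: "\<kappa> > 0" using N_pos by (simp add: \<kappa>_def)
  obtain C' where C': "C' \<ge> 0" and asym_ev: "\<forall>\<^sub>F m in sequentially. \<forall>s. 8 \<le> s \<longrightarrow> s \<le> ln (real m) \<longrightarrow>
      \<bar>(\<Sum>j=1..(m - 1) div 2. sym_log_mgf (s * half_coeff m (int j))) - N / pi * s * (ln s + saddle_const)\<bar> \<le> C' * ln s"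
    using sym_log_mgf_half_coeff_sum by blast
  define C\<^sub>0 where "C\<^sub>0 = C' + 1"
  have C0: "C\<^sub>0 > 0" "C\<^sub>0 \<ge> 0" using C' by (auto simp: C\<^sub>0_def)
  obtain V\<^sub>0 where V0: "\<And>V. V \<ge> V\<^sub>0 \<Longrightarrow> V \<ge> 1 \<and> V \<ge> \<kappa> + 1 \<and> width \<kappa> V \<le> 1 \<and> width \<kappa> V \<le> \<kappa> \<and> saddle \<kappa> D V \<ge> 16
    \<and> 7 + C\<^sub>0 * (2 * ((V + 1) / \<kappa> + \<bar>D\<bar>) + 1) \<le> V\<^sup>2 * exp (- D - 1) / (4 * \<kappa>)
    \<and> 5 + C\<^sub>0 * ((V + 1) / \<kappa> + \<bar>D\<bar>) \<le> saddle \<kappa> D V"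
    using width_properties[OF \<kappa> C0(1), of D] unfolding eventually_at_top_linorder by blast
  have "filterlim (\<lambda>m::nat. ln (real m)) at_top sequentially" by real_asymp
  note scale_ev = eventually_compose_filterlim[OF log_scale_conditions[OF \<kappa> C0(1), of C\<^sub>1 K D B V\<^sub>0] this]
  have "\<forall>\<^sub>F m in sequentially. m \<ge> (3::nat)" by (rule eventually_ge_at_top)
  with asym_ev scale_ev have "\<forall>\<^sub>F m in sequentially. m \<ge> 3 \<and>
      (\<forall>s. 8 \<le> s \<longrightarrow> s \<le> ln (real m) \<longrightarrow>
      \<bar>(\<Sum>j=1..(m - 1) div 2. sym_log_mgf (s * half_coeff m (int j))) - N / pi * s * (ln s + saddle_const)\<bar> \<le> C' * ln s) \<and>
      (let l = ln (real m) in ln l \<ge> 1 \<and> 2 * C\<^sub>1 \<le> l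
    \<and> ln (\<bar>K\<bar> * exp 1 + 1) + 3 * l * ln (l + 2) / (8 * ln l) \<le> l / 2
    \<and> 3 / 64 * (l / (ln l)\<^sup>2) * (ln l + 1 + \<bar>D\<bar>) + C\<^sub>0 * (ln l + 1) + 1 \<le> l / (8 * ln l) - 2
    \<and> 6 / 64 * (l / ln l) + 1 \<le> l / (8 * ln l) - 2
    \<and> 3 / (64 * \<kappa>) \<le> (ln l)\<^sup>2
    \<and> \<kappa> * (ln l + \<bar>B\<bar>) + 2 \<le> 3 * \<kappa> * ln l
    \<and> V\<^sub>0 \<le> \<kappa> * (ln l - 2 * ln (ln l) - B))"
    unfolding Let_def by eventually_elim blast
  then obtain m\<^sub>0 where m0: "\<And>m. m \<ge> m\<^sub>0 \<Longrightarrow> m \<ge> 3 \<and>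
      (\<forall>s. 8 \<le> s \<longrightarrow> s \<le> ln (real m) \<longrightarrow>
      \<bar>(\<Sum>j=1..(m - 1) div 2. sym_log_mgf (s * half_coeff m (int j))) - N / pi * s * (ln s + saddle_const)\<bar> \<le> C' * ln s) \<and>
      (let l = ln (real m) in ln l \<ge> 1 \<and> 2 * C\<^sub>1 \<le> l
    \<and> ln (\<bar>K\<bar> * exp 1 + 1) + 3 * l * ln (l + 2) / (8 * ln l) \<le> l / 2
    \<and> 3 / 64 * (l / (ln l)\<^sup>2) * (ln l + 1 + \<bar>D\<bar>) + C\<^sub>0 * (ln l + 1) + 1 \<le> l / (8 * ln l) - 2
    \<and> 6 / 64 * (l / ln l) + 1 \<le> l / (8 * ln l) - 2
    \<and> 3 / (64 * \<kappa>) \<le> (ln l)\<^sup>2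
    \<and> \<kappa> * (ln l + \<bar>B\<bar>) + 2 \<le> 3 * \<kappa> * ln l
    \<and> V\<^sub>0 \<le> \<kappa> * (ln l - 2 * ln (ln l) - B))"
    unfolding eventually_at_top_linorder by blast
  define Cu where "Cu = 3 + C\<^sub>0 * (1 / \<kappa> + \<bar>D\<bar>)"
  define Cl where "Cl = 1 + 5 * exp (- D - 1) + C\<^sub>0 * (2 / \<kappa> + \<bar>D\<bar>)"
  have Cu: "Cu \<ge> 0" using C0 \<kappa> by (simp add: Cu_def)
  have Cl: "Cl \<ge> 0" using C0 \<kappa> by (simp add: Cl_def add_nonneg_nonneg)
  show ?thesis
  proof (rule that[of V\<^sub>0 "max Cu Cl" m\<^sub>0])
    show "V\<^sub>0 \<ge> 1" using V0[of V\<^sub>0] by simp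
    show "max Cu Cl \<ge> 0" using Cu by simp
    show "V\<^sub>0 \<le> \<kappa> * (ln (ln (real m)) - 2 * ln (ln (ln (real m))) - B_const M (X 1) N)" if "m \<ge> m\<^sub>0" for m
      using m0[OF that] by (simp add: Let_def B_def)
  next
    fix m :: nat and \<Omega> :: "'a set" and \<phi> :: "'a \<Rightarrow> int \<Rightarrow> complex" and \<sigma> V :: real
    assume m: "m \<ge> m\<^sub>0" and pf: "periodic_family m \<Omega> \<phi>" and a2: "assumption2 N m \<Omega> \<phi>"
      and mc: "moment_condition M X \<eta> C\<^sub>1 K m \<Omega> \<phi>" and \<sigma>: "\<sigma> \<in> {1, -1}" and V: "V\<^sub>0 \<le> V"
      and V_le: "V \<le> \<kappa> * (ln (ln (real m)) - 2 * ln (ln (ln (real m))) - B_const M (X 1) N)"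
    define c where "c = signed_coeff \<sigma> m"
    define F where "F = model_mgf c m"
    define x where "x = (\<lambda>a. family_sum c m (\<phi> a))"
    define P where "P = prop_gt \<Omega> x V"
    define l where "l = ln (real m)"
    define l2 where "l2 = ln l"
    \<comment> \<open>The largest tilt used. At \<open>e * smax\<close> the cumulant is about
      \<open>3 / 64 * (l / l2)\<close> at most, below the degree \<open>n\<close>, which is close to
      \<open>l / (8 * l2)\<close>.\<close>
    define smax where "smax = l / (64 * \<kappa> * l2\<^sup>2)"
    \<comment> \<open>Doubling after rounding keeps the degree even. The 16 makes
      \<open>(l + 2) ^ (3 * n)\<close> about \<open>m powr (3 / 8)\<close> at most, below
      \<open>m powr \<eta>\<close>.\<close>
    define n where "n = 2 * nat \<lfloor>l / (16 * l2)\<rfloor>"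
    have \<Omega>: "finite \<Omega>" "\<Omega> \<noteq> {}" using pf by (auto simp: periodic_family_def)
    have m3: "m \<ge> 3" using m0[OF m] by simp
    have scale: "l2 \<ge> 1" "2 * C\<^sub>1 \<le> l"
      "ln (\<bar>K\<bar> * exp 1 + 1) + 3 * l * ln (l + 2) / (8 * l2) \<le> l / 2"
      "3 / 64 * (l / l2\<^sup>2) * (l2 + 1 + \<bar>D\<bar>) + C\<^sub>0 * (l2 + 1) + 1 \<le> l / (8 * l2) - 2"
      "6 / 64 * (l / l2) + 1 \<le> l / (8 * l2) - 2" "3 / (64 * \<kappa>) \<le> l2\<^sup>2"
      "\<kappa> * (l2 + \<bar>B\<bar>) + 2 \<le> 3 * \<kappa> * l2"
      using m0[OF m] by (simp_all only: Let_def l_def l2_def)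
    have l: "l > 2" using scale C1 by linarith
    have F1: "F t \<ge> 1" for t unfolding F_def by (rule model_mgf_ge_1)
    have asym: "\<bar>ln (F t) - \<kappa> * t * (ln t + D)\<bar> \<le> C\<^sub>0 * ln t" if "8 \<le> t" "t \<le> l" for t
    proof -
      have "\<bar>ln (F t) - \<kappa> * t * (ln t + D)\<bar> \<le> C' * ln t"
        using m0[OF m] that by (simp add: F_def c_def ln_model_mgf_signed[OF \<sigma>] \<kappa>_def D_def l_def)
      also have "\<dots> \<le> C\<^sub>0 * ln t" using that by (intro mult_right_mono) (auto simp: C\<^sub>0_def)
      finally show ?thesis .
    qed
    have n_even: "even n" by (simp add: n_def)
    have n_le: "real n \<le> l / (8 * l2)" and n_ge: "l / (8 * l2) - 2 \<le> real n"
    proof -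
      have y: "l / (16 * l2) \<ge> 0" using l scale by simp
      have "real n = 2 * of_int \<lfloor>l / (16 * l2)\<rfloor>" using y by (simp add: n_def)
      moreover have "l / (8 * l2) = 2 * (l / (16 * l2))" by simp
      ultimately show "real n \<le> l / (8 * l2)" "l / (8 * l2) - 2 \<le> real n"
        using floor_correct[of "l / (16 * l2)"] by linarith+
    qed
    have n_le': "real n \<le> ln (real m) / ln (ln (real m))"
    proof -
      have "l / (8 * l2) \<le> l / l2" using l scale by (intro divide_left_mono) auto
      thus ?thesis using n_le by (simp add: l_def l2_def)
    qed
    have smax_pos: "smax > 0" using l scale \<kappa> by (simp add: smax_def)
    have smax_le: "3 * smax \<le> l"
    proof -
      have "3 * smax = l * (3 / (64 * \<kappa>) / l2\<^sup>2)" by (simp add: smax_def)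
      also have "\<dots> \<le> l * 1"
      proof (rule mult_left_mono)
        have "l2\<^sup>2 > 0" using scale(1) by simp
        thus "3 / (64 * \<kappa>) / l2\<^sup>2 \<le> 1" using scale(6) by (simp only: divide_le_eq_1_pos)
      qed (use l in simp)
      finally show ?thesis by simp
    qed
    have K_small: "\<bar>K\<bar> * (exp 1 * ((l + 2) ^ 3) ^ n) / real m powr \<eta> \<le> 1"
    proof -
      have "((l + 2) ^ 3) ^ n = exp (real n * (3 * ln (l + 2)))"
        using l by (simp add: exp_of_nat_mult exp_of_nat_mult[of 3, simplified])
      also have "\<dots> \<le> exp (l / (8 * l2) * (3 * ln (l + 2)))"
        unfolding exp_le_cancel_iff using n_le l by (intro mult_right_mono) auto
      also have "l / (8 * l2) * (3 * ln (l + 2)) = 3 * l * ln (l + 2) / (8 * l2)" by simp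
      finally have Q: "((l + 2) ^ 3) ^ n \<le> exp (3 * l * ln (l + 2) / (8 * l2))" .
      have pos: "\<bar>K\<bar> * exp 1 + 1 > 0" by (simp add: add_nonneg_pos)
      have "\<bar>K\<bar> * (exp 1 * ((l + 2) ^ 3) ^ n) = \<bar>K\<bar> * exp 1 * ((l + 2) ^ 3) ^ n" by simp
      also have "\<dots> \<le> (\<bar>K\<bar> * exp 1 + 1) * exp (3 * l * ln (l + 2) / (8 * l2))"
        using Q l by (intro mult_mono) auto
      also have "\<dots> = exp (ln (\<bar>K\<bar> * exp 1 + 1) + 3 * l * ln (l + 2) / (8 * l2))"
        using pos by (simp add: exp_add)
      also have "\<dots> \<le> exp (\<eta> * l)"
      proof -
        have "1 / 2 * l \<le> \<eta> * l" using \<eta> l by (intro mult_right_mono) auto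
        thus ?thesis using scale(3) by simp
      qed
      also have "\<dots> = real m powr \<eta>" using m3 by (simp add: powr_def l_def)
      finally show ?thesis using m3 by simp
    qed
    have S: "(\<Sum>h\<in>freqs m. \<bar>c h\<bar>) \<le> 2 * (l + 2)"
      unfolding c_def l_def by (rule sum_abs_signed_coeff[OF \<sigma> m3])
    have tiny: "exp (- real n) * (F (exp 1 * t) + F (- (exp 1 * t))) \<le> 1" if t: "8 \<le> t" "t \<le> smax" for t
    proof -
      have e: "exp 1 * t \<le> 3 * smax" using t exp_le by (intro mult_mono) auto
      have et: "8 \<le> exp 1 * t" using t mult_mono[of 1 "exp 1" 8 t] by simp
      have "F (- (exp 1 * t)) = F (exp 1 * t)"
        unfolding F_def c_def by (rule model_mgf_signed_minus[OF \<sigma>])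
      moreover have "ln (F (exp 1 * t)) \<le> \<kappa> * (exp 1 * t) * (ln (exp 1 * t) + D) + C\<^sub>0 * ln (exp 1 * t)"
        using asym[of "exp 1 * t"] et e smax_le by (simp add: abs_le_iff)
      moreover have ln_et: "ln (exp 1 * t) \<le> l2 + 1"
      proof -
        have "ln (exp 1 * t) \<le> ln l" using et e smax_le by (intro ln_mono) auto
        thus ?thesis by (simp add: l2_def)
      qed
      moreover have "\<kappa> * (exp 1 * t) * (ln (exp 1 * t) + D) \<le> \<kappa> * (3 * smax) * (l2 + 1 + \<bar>D\<bar>)"
      proof -
        have "\<kappa> * (exp 1 * t) * (ln (exp 1 * t) + D) \<le> \<kappa> * (exp 1 * t) * (l2 + 1 + \<bar>D\<bar>)"
          using ln_et \<kappa> et by (intro mult_left_mono) auto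
        also have "\<dots> \<le> \<kappa> * (3 * smax) * (l2 + 1 + \<bar>D\<bar>)"
          using e \<kappa> scale by (intro mult_right_mono mult_left_mono) auto
        finally show ?thesis .
      qed
      moreover have "\<kappa> * (3 * smax) = 3 / 64 * (l / l2\<^sup>2)" using \<kappa> by (simp add: smax_def)
      moreover have "C\<^sub>0 * ln (exp 1 * t) \<le> C\<^sub>0 * (l2 + 1)" using C0 ln_et by (intro mult_left_mono) auto
      ultimately have "ln (F (exp 1 * t)) + 1 \<le> real n" and eq: "F (- (exp 1 * t)) = F (exp 1 * t)"
        using scale(4) n_ge by (simp_all only:)
      hence "exp (ln (F (exp 1 * t)) + 1) \<le> exp (real n)" by simp
      hence "F (exp 1 * t) * exp 1 \<le> exp (real n)" using F1[of "exp 1 * t"] by (simp add: exp_add)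
      moreover have "F (exp 1 * t) * 2 \<le> F (exp 1 * t) * exp 1"
        using F1[of "exp 1 * t"] exp_ge_add_one_self_aux[of 1] by (intro mult_left_mono) auto
      ultimately have "F (exp 1 * t) + F (- (exp 1 * t)) \<le> exp (real n)" unfolding eq by linarith
      hence "exp (- real n) * (F (exp 1 * t) + F (- (exp 1 * t))) \<le> exp (- real n) * exp (real n)"
        by (rule mult_left_mono) simp
      also have "\<dots> = 1" by (simp flip: exp_add)
      finally show ?thesis .
    qed
    \<comment> \<open>In this range \<open>2 * y + 1 \<le> n\<close>, so the truncation error
      \<open>exp (e * y - n)\<close> is at most \<open>exp (y - 1)\<close>, less than half of
      \<open>exp y\<close>.\<close>
    have trunc: "exp y \<le> 2 * exp_taylor n y" if y: "0 \<le> y" "y \<le> smax * (3 * \<kappa> * l2)" for y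
    proof -
      have "smax * (3 * \<kappa> * l2) = 3 / 64 * (l / l2)"
        using \<kappa> scale by (simp add: smax_def power2_eq_square)
      hence "2 * y + 1 \<le> real n" using y scale(5) n_ge by simp
      moreover have "exp 1 * y \<le> 3 * y" using exp_le y by (intro mult_right_mono) auto
      ultimately have "exp (- real n + exp 1 * y) \<le> exp (y + -1)" by simp
      also have "\<dots> = exp y * exp (-1)" by (rule exp_add)
      also have "\<dots> \<le> exp y * (1 / 2)"
        using exp_ge_add_one_self_aux[of 1] by (intro mult_left_mono) (auto simp: exp_minus field_simps)
      finally have "exp (- real n) * exp (exp 1 * y) \<le> exp y * (1 / 2)" by (simp only: exp_add)
      thus ?thesis using exp_le_exp_taylor_plus[OF n_even, of y] by linarith
    qed
    have fam: "avg \<Omega> (\<lambda>a. exp_taylor n (t * x a)) \<le> F t + 2"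
        "F t - 2 \<le> avg \<Omega> (\<lambda>a. exp_taylor n (t * x a))"
        "avg \<Omega> (\<lambda>a. (t * x a) ^ n / fact n) \<le> 2" if t: "8 \<le> t" "t \<le> smax" for t
    proof -
      \<comment> \<open>The cube in Q has one factor for the tilt, one for the constant
        \<open>2 * C\<^sub>1\<close> and one for the absolute sum of the coefficients.\<close>
      have "t * (C\<^sub>1 * (\<Sum>h\<in>freqs m. \<bar>c h\<bar>)) \<le> l * (C\<^sub>1 * (2 * (l + 2)))"
        using t smax_le smax_pos S C1 by (intro mult_mono mult_left_mono mult_nonneg_nonneg sum_nonneg) auto
      also have "\<dots> = (2 * C\<^sub>1) * (l * (l + 2))" by simp
      also have "\<dots> \<le> (l + 2) * ((l + 2) * (l + 2))" using scale l C1 by (intro mult_mono) auto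
      finally have Q: "t * (C\<^sub>1 * (\<Sum>h\<in>freqs m. \<bar>c h\<bar>)) \<le> (l + 2) ^ 3" by (simp add: power3_eq_cube)
      have Q1: "(l + 2) ^ 3 \<ge> 1" using l by (intro one_le_power) auto
      have C1': "C\<^sub>1 \<ge> 0" "t \<ge> 0" using C1 t by auto
      note * = family_taylor_bounds[OF pf a2 mc C1'(1) n_le' Q1 Q C1'(2) n_even K_small tiny[OF t, unfolded F_def]]
      show "avg \<Omega> (\<lambda>a. exp_taylor n (t * x a)) \<le> F t + 2"
        "F t - 2 \<le> avg \<Omega> (\<lambda>a. exp_taylor n (t * x a))"
        "avg \<Omega> (\<lambda>a. (t * x a) ^ n / fact n) \<le> 2"
        using * by (simp_all add: x_def F_def)
    qed
    note V0' = V0[OF V]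
    define sV where "sV = saddle \<kappa> D V"
    \<comment> \<open>This is where the upper limit for V and the 9 in \<open>B_const\<close> enter:
      \<open>exp 9 \<ge> 512 = 8 * 64\<close>. The factor 8 leaves room for \<open>s2\<close>, which
      is at most 9/2 times \<open>sV\<close>.\<close>
    have sV_le: "8 * sV \<le> smax"
    proof -
      have "V / \<kappa> \<le> l2 - 2 * ln l2 - B"
        using V_le \<kappa> by (simp add: field_simps l2_def l_def B_def)
      hence "A_zero M (X 1) N * exp (V / \<kappa>) \<le> A_zero M (X 1) N * exp (l2 - 2 * ln l2 - B)"
        using A_zero_pos by (intro mult_left_mono) auto
      also have "exp (l2 - 2 * ln l2 - B) = l / l2\<^sup>2 * exp (- B)"
      proof -
        have "exp (2 * ln l2) = l2\<^sup>2" using scale by (simp add: exp_double)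
        moreover have "exp l2 = l" using l by (simp add: l2_def)
        ultimately have "exp (l2 - 2 * ln l2 - B) = l / l2\<^sup>2 / exp B" by (simp only: exp_diff)
        thus ?thesis by (simp add: exp_minus divide_inverse)
      qed
      also have "exp (- B) = exp (- 9) / A_zero M (X 1) N"
      proof -
        have "- B = - 9 - ln (A_zero M (X 1) N)" by (simp add: B_def B_const_def)
        thus ?thesis using A_zero_pos by (simp only: exp_diff exp_ln)
      qed
      also have "A_zero M (X 1) N * (l / l2\<^sup>2 * (exp (- 9) / A_zero M (X 1) N)) = l / l2\<^sup>2 * exp (- 9)"
        using A_zero_pos by simp
      also have "\<dots> \<le> l / l2\<^sup>2 * (1 / 512)"
      proof (intro mult_left_mono)
        have "2 ^ 9 \<le> exp (1::real) ^ 9" using exp_ge_add_one_self_aux[of 1] by (intro power_mono) auto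
        also have "\<dots> = exp 9" by (simp flip: exp_of_nat_mult)
        finally show "exp (-9::real) \<le> 1 / 512" by (simp add: exp_minus field_simps)
      qed (use l in auto)
      finally have "\<kappa> * sV \<le> l / l2\<^sup>2 * (1 / 512)"
        using A_zero_exp[of V] by (simp add: sV_def \<kappa>_def D_def)
      thus ?thesis using \<kappa> scale by (simp add: smax_def field_simps)
    qed
    define \<delta> where "\<delta> = width \<kappa> V"
    define s where "s = saddle \<kappa> D (V + \<delta>)"
    define \<mu> where "\<mu> = \<delta> / (2 * \<kappa>)"
    define s1 where "s1 = s * (1 - \<mu>)"
    define s2 where "s2 = s * (1 + \<mu>)"
    have V1: "V \<ge> 1" and \<delta>: "\<delta> \<ge> 0" "\<delta> \<le> 1" "\<delta> \<le> \<kappa>" and sV16: "sV \<ge> 16"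
      using V0' by (auto simp: \<delta>_def sV_def width_def)
    have \<mu>: "0 \<le> \<mu>" "\<mu> \<le> 1 / 2" using \<delta> \<kappa> by (auto simp: \<mu>_def field_simps)
    have s_bounds: "sV \<le> s" "s \<le> 3 * sV"
    proof -
      have eq: "s = sV * exp (\<delta> / \<kappa>)"
        by (simp add: s_def sV_def saddle_def add_divide_distrib algebra_simps flip: exp_add)
      have "1 \<le> exp (\<delta> / \<kappa>)" using \<delta> \<kappa> by simp
      moreover have "exp (\<delta> / \<kappa>) \<le> exp 1" using \<delta> \<kappa> by simp
      ultimately have "sV * 1 \<le> s" "s \<le> sV * 3"
        unfolding eq using sV16 exp_le by (intro mult_left_mono; linarith)+
      thus "sV \<le> s" "s \<le> 3 * sV" by auto
    qed
    have "s * (1 - \<mu>) \<ge> s * (1 / 2)" "s * (1 + \<mu>) \<le> s * (3 / 2)"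
      using s_bounds sV16 \<mu> by (intro mult_left_mono; linarith)+
    hence s1: "8 \<le> s1" and s2: "s2 \<le> smax" using s_bounds sV16 sV_le unfolding s1_def s2_def by linarith+
    have s12: "s1 \<le> s" "s \<le> s2"
      using \<mu> s_bounds sV16 mult_left_mono[of "1 - \<mu>" 1 s] mult_left_mono[of 1 "1 + \<mu>" s]
      by (auto simp: s1_def s2_def)
    have V': "V + 2 * \<delta> \<le> 3 * \<kappa> * l2"
    proof -
      have "V \<le> \<kappa> * (l2 - 2 * ln l2 - B)" using V_le by (simp add: l2_def l_def B_def)
      also have "\<dots> \<le> \<kappa> * (l2 + \<bar>B\<bar>)"
      proof (intro mult_left_mono)
        have "ln l2 \<ge> 0" using scale(1) by simp
        thus "l2 - 2 * ln l2 - B \<le> l2 + \<bar>B\<bar>" by linarith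
      qed (use \<kappa> in simp)
      finally show ?thesis using \<delta> scale(7) by linarith
    qed
    have range: "s2 * (V + 2 * \<delta>) \<le> smax * (3 * \<kappa> * l2)" "sV * V \<le> smax * (3 * \<kappa> * l2)"
      using s2 V' smax_pos V1 \<delta> sV_le sV16 by (intro mult_mono; linarith)+
    have l_le: "smax \<le> l" using smax_le smax_pos by linarith
    have lower: "F s - 2 \<le> 3 + 2 * exp ((s - s1) * V) * (F s1 + 2)
       + 2 * exp (- (s2 - s) * (V + 2 * \<delta>)) * (F s2 + 2) + exp (s * (V + 2 * \<delta>)) * P"
    proof -
      have "avg \<Omega> (\<lambda>a. exp_taylor n (s * x a)) \<le> 1 + avg \<Omega> (\<lambda>a. (s * x a) ^ n / fact n)
        + 2 * exp ((s - s1) * V) * avg \<Omega> (\<lambda>a. exp_taylor n (s1 * x a))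
        + 2 * exp (- (s2 - s) * (V + 2 * \<delta>)) * avg \<Omega> (\<lambda>a. exp_taylor n (s2 * x a))
        + exp (s * (V + 2 * \<delta>)) * P"
        unfolding P_def
        using s1 s12 V1 \<delta> range trunc by (intro prop_gt_lower[OF \<Omega> n_even]) auto
      moreover have "2 * exp ((s - s1) * V) * avg \<Omega> (\<lambda>a. exp_taylor n (s1 * x a)) \<le> 2 * exp ((s - s1) * V) * (F s1 + 2)"
        using s1 s2 s12 by (intro mult_left_mono fam) auto
      moreover have "2 * exp (- (s2 - s) * (V + 2 * \<delta>)) * avg \<Omega> (\<lambda>a. exp_taylor n (s2 * x a))
          \<le> 2 * exp (- (s2 - s) * (V + 2 * \<delta>)) * (F s2 + 2)"
        using s1 s2 s12 by (intro mult_left_mono fam) auto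
      moreover have "F s - 2 \<le> avg \<Omega> (\<lambda>a. exp_taylor n (s * x a))" "avg \<Omega> (\<lambda>a. (s * x a) ^ n / fact n) \<le> 2"
        using s1 s2 s12 by (intro fam; linarith)+
      ultimately show ?thesis by linarith
    qed
    have asym': "\<bar>ln (F t) - \<kappa> * t * (ln t + D)\<bar> \<le> C\<^sub>0 * ln t" if "t \<in> {s, s1, s2}" for t
      using that s1 s2 s12 l_le by (intro asym) auto
    have V0'': "V \<ge> \<kappa> + 1" "7 + C\<^sub>0 * (2 * ((V + 1) / \<kappa> + \<bar>D\<bar>) + 1) \<le> V\<^sup>2 * exp (- D - 1) / (4 * \<kappa>)"
      "5 + C\<^sub>0 * ((V + 1) / \<kappa> + \<bar>D\<bar>) \<le> saddle \<kappa> D V" "saddle \<kappa> D V \<ge> 16"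
      using V0' by blast+
    note low = saddle_lower[OF \<kappa> C0(1) F1 V1 V0''(1) \<delta>(2,3)[unfolded \<delta>_def] V0''(4,2,3)
        asym'[unfolded s1_def s2_def s_def \<mu>_def \<delta>_def] lower[unfolded s1_def s2_def s_def \<mu>_def \<delta>_def]]
    have P0: "P > 0" by (rule low(1))
    have lowP: "ln P + \<kappa> * sV \<ge> - Cl * (V * exp (V / (2 * \<kappa>)))"
      using low(2) by (simp only: Cl_def sV_def)
    have upP: "ln P + \<kappa> * sV \<le> Cu * (V * exp (V / (2 * \<kappa>)))"
      unfolding Cu_def sV_def
    proof (rule saddle_upper[OF \<kappa> C0(2) F1[of sV] V1 _ P0])
      show "ln (F sV) \<le> \<kappa> * saddle \<kappa> D V * (ln (saddle \<kappa> D V) + D) + C\<^sub>0 * ln (saddle \<kappa> D V)"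
        using asym[of sV] sV16 sV_le l_le by (simp add: abs_le_iff sV_def)
      have "exp_taylor n (sV * V) * P \<le> F sV + 2"
        unfolding P_def using sV16 V1 sV_le fam(1)[of sV]
        by (intro order_trans[OF prop_gt_upper[OF \<Omega>(1) n_even]]) auto
      moreover have "exp (sV * V) / 2 * P \<le> exp_taylor n (sV * V) * P"
        using trunc[of "sV * V"] range sV16 V1 P0 by (intro mult_right_mono) auto
      ultimately have "exp (sV * V) / 2 * P \<le> F sV + 2" by (rule order_trans[rotated])
      hence "exp (sV * V) * P \<le> 2 * (F sV + 2)" by (simp add: field_simps)
      hence "exp (sV * V) * P * exp (- sV * V) \<le> 2 * (F sV + 2) * exp (- sV * V)"
        by (rule mult_right_mono) simp
      moreover have "exp (sV * V) * P * exp (- sV * V) = P" by (simp add: exp_minus)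
      ultimately show "P \<le> 2 * (F sV + 2) * exp (- saddle \<kappa> D V * V)"
        by (simp only: sV_def)
    qed
    have R: "V * exp (V / (2 * \<kappa>)) \<ge> 0" using V1 by simp
    have "\<bar>ln P + \<kappa> * sV\<bar> \<le> max Cu Cl * (V * exp (V / (2 * \<kappa>)))"
      using lowP upP mult_right_mono[OF max.cobounded1[of Cu Cl] R] mult_right_mono[OF max.cobounded2[of Cl Cu] R]
      by (intro abs_leI) linarith+
    moreover have "\<kappa> * sV = A_zero M (X 1) N * exp (V / \<kappa>)"
      using A_zero_exp[of V] by (simp add: sV_def \<kappa>_def D_def)
    ultimately show "prop_gt \<Omega> (\<lambda>a. family_sum (signed_coeff \<sigma> m) m (\<phi> a)) V > 0 \<and>
      \<bar>ln (prop_gt \<Omega> (\<lambda>a. family_sum (signed_coeff \<sigma> m) m (\<phi> a)) V) + A_zero M (X 1) N * exp (V / \<kappa>)\<bar>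
        \<le> max Cu Cl * (V * exp (V / (2 * \<kappa>)))"
      using P0 by (simp add: P_def x_def c_def)
  qed
qed

end

theorem theorem7p1:
  fixes M :: "'w measure" and X :: "int \<Rightarrow> 'w \<Rightarrow> real"
    and N \<eta> C\<^sub>1 K :: real
  assumes "N > 0" and "\<eta> \<ge> 1/2" and "C\<^sub>1 > 1"
    and "iid_supported M X N"
    and "condition3a M (X 1) N"
    and "condition3b M (X 1)"
  shows "\<exists>C m\<^sub>0. \<forall>m\<ge>m\<^sub>0. \<forall>(\<Omega> :: 'a set) \<phi>.
    periodic_family m \<Omega> \<phi> \<longrightarrow> assumption2 N m \<Omega> \<phi> \<longrightarrow> moment_condition M X \<eta> C\<^sub>1 K m \<Omega> \<phi> \<longrightarrow>
    (\<forall>V. 1 \<le> V \<longrightarrow>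
      V \<le> N / pi * (ln (ln (real m)) - 2 * ln (ln (ln (real m))) - B_const M (X 1) N) \<longrightarrow>
      (\<exists>\<theta>. \<bar>\<theta>\<bar> \<le> C * (V * exp (- (pi * V / (2 * N)))) \<and>
        Psi_plus m \<Omega> \<phi> V = exp (- A_zero M (X 1) N * exp (pi / N * V) * (1 + \<theta>))) \<and>
      (\<exists>\<theta>. \<bar>\<theta>\<bar> \<le> C * (V * exp (- (pi * V / (2 * N)))) \<and>
        Psi_minus m \<Omega> \<phi> V = exp (- A_zero M (X 1) N * exp (pi / N * V) * (1 + \<theta>))))"
proof -
  interpret iid_model M X N
    using assms by unfold_locales auto
  define \<kappa> where "\<kappa> = N / pi"
  define A where "A = A_zero M (X 1) N"
  have \<kappa>: "\<kappa> > 0" using assms by (simp add: \<kappa>_def)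
  have A: "A > 0" unfolding A_def by (rule A_zero_pos)
  obtain V\<^sub>0 C m\<^sub>0 where V0: "V\<^sub>0 \<ge> 1" and C: "C \<ge> 0"
    and range: "\<And>m. m \<ge> m\<^sub>0 \<Longrightarrow> V\<^sub>0 \<le> \<kappa> * (ln (ln (real m)) - 2 * ln (ln (ln (real m))) - B_const M (X 1) N)"
    and est: "\<And>m (\<Omega> :: 'a set) \<phi> \<sigma> V. m \<ge> m\<^sub>0 \<Longrightarrow> periodic_family m \<Omega> \<phi> \<Longrightarrow> assumption2 N m \<Omega> \<phi> \<Longrightarrow>
      moment_condition M X \<eta> C\<^sub>1 K m \<Omega> \<phi> \<Longrightarrow> \<sigma> \<in> {1, -1} \<Longrightarrow> V\<^sub>0 \<le> V \<Longrightarrow>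
      V \<le> \<kappa> * (ln (ln (real m)) - 2 * ln (ln (ln (real m))) - B_const M (X 1) N) \<Longrightarrow>
      prop_gt \<Omega> (\<lambda>a. family_sum (signed_coeff \<sigma> m) m (\<phi> a)) V > 0 \<and>
      \<bar>ln (prop_gt \<Omega> (\<lambda>a. family_sum (signed_coeff \<sigma> m) m (\<phi> a)) V) + A * exp (V / \<kappa>)\<bar>
        \<le> C * (V * exp (V / (2 * \<kappa>)))"
    using family_tail_estimate[OF assms(3) assms(2), where 'a = 'a and K = K, folded \<kappa>_def A_def] by metis
  \<comment> \<open>For V below \<open>V\<^sub>0\<close> the proportion lies between its value at
    \<open>V\<^sub>0\<close> and 1, so the logarithm and the main term are bounded by the added
    constants, while \<open>V * exp (V / (2 * \<kappa>)) \<ge> 1\<close>.\<close>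
  define C' where "C' = C + 2 * A * exp (V\<^sub>0 / \<kappa>) + C * (V\<^sub>0 * exp (V\<^sub>0 / (2 * \<kappa>)))"
  have main: "\<exists>\<theta>. \<bar>\<theta>\<bar> \<le> C' / A * (V * exp (- (V / (2 * \<kappa>)))) \<and>
      prop_gt \<Omega> (\<lambda>a. family_sum (signed_coeff \<sigma> m) m (\<phi> a)) V = exp (- A * exp (V / \<kappa>) * (1 + \<theta>))"
    if m: "m \<ge> m\<^sub>0" and fam: "periodic_family m \<Omega> \<phi>" "assumption2 N m \<Omega> \<phi>" "moment_condition M X \<eta> C\<^sub>1 K m \<Omega> \<phi>"
      and \<sigma>: "\<sigma> \<in> {1, -1}" and V: "1 \<le> V"
      "V \<le> \<kappa> * (ln (ln (real m)) - 2 * ln (ln (ln (real m))) - B_const M (X 1) N)"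
    for m and \<Omega> :: "'a set" and \<phi> \<sigma> V
  proof -
    define P where "P = prop_gt \<Omega> (\<lambda>a. family_sum (signed_coeff \<sigma> m) m (\<phi> a))"
    have fin: "finite \<Omega>" using fam by (simp add: periodic_family_def)
    have R: "1 \<le> V * exp (V / (2 * \<kappa>))"
      using V(1) \<kappa> mult_mono[of 1 V 1 "exp (V / (2 * \<kappa>))"] by simp
    have E: "0 \<le> 2 * A * exp (V\<^sub>0 / \<kappa>)" "0 \<le> C * (V\<^sub>0 * exp (V\<^sub>0 / (2 * \<kappa>)))"
      using A C V0 by auto
    have "P V > 0 \<and> \<bar>ln (P V) + A * exp (V / \<kappa>)\<bar> \<le> C' * (V * exp (V / (2 * \<kappa>)))"
    proof (cases "V \<ge> V\<^sub>0")
      case True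
      have "C * (V * exp (V / (2 * \<kappa>))) \<le> C' * (V * exp (V / (2 * \<kappa>)))"
        using E R by (intro mult_right_mono) (auto simp: C'_def)
      thus ?thesis using est[OF m fam \<sigma> True V(2)] by (auto simp: P_def)
    next
      case False
      have e: "P V\<^sub>0 > 0" "\<bar>ln (P V\<^sub>0) + A * exp (V\<^sub>0 / \<kappa>)\<bar> \<le> C * (V\<^sub>0 * exp (V\<^sub>0 / (2 * \<kappa>)))"
        using est[OF m fam \<sigma> order_refl range[OF m]] by (auto simp: P_def)
      have le: "P V\<^sub>0 \<le> P V" unfolding P_def using False by (intro prop_gt_antimono fin) auto
      have P1: "P V \<le> 1" unfolding P_def by (rule prop_gt_le_1[OF fin])
      have "ln (P V\<^sub>0) \<le> ln (P V)" using le e by (intro ln_mono) auto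
      moreover have "ln (P V) \<le> 0" using P1 le e by simp
      moreover have "A * exp (V / \<kappa>) \<le> A * exp (V\<^sub>0 / \<kappa>)" "0 \<le> A * exp (V / \<kappa>)"
        using A \<kappa> False by (auto simp: divide_right_mono)
      ultimately have "\<bar>ln (P V) + A * exp (V / \<kappa>)\<bar> \<le> C'"
        using e(2) C E unfolding C'_def by (intro abs_leI) linarith+
      also have "\<dots> = C' * 1" by simp
      also have "\<dots> \<le> C' * (V * exp (V / (2 * \<kappa>)))"
        using R E C by (intro mult_left_mono) (auto simp: C'_def)
      finally show ?thesis using le e by simp
    qed
    thus ?thesis using exp_relative_error[OF A \<kappa>, of "P V" V C'] by (simp add: P_def)
  qed
  have eqs: "V / (2 * \<kappa>) = pi * V / (2 * N)" "V / \<kappa> = pi / N * V" for V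
    by (simp_all add: \<kappa>_def)
  show ?thesis
  proof (intro exI[of _ "C' / A"] exI[of _ m\<^sub>0] allI impI)
    fix m and \<Omega> :: "'a set" and \<phi> V
    assume *: "m\<^sub>0 \<le> m" "periodic_family m \<Omega> \<phi>" "assumption2 N m \<Omega> \<phi>" "moment_condition M X \<eta> C\<^sub>1 K m \<Omega> \<phi>" "1 \<le> V"
      "V \<le> N / pi * (ln (ln (real m)) - 2 * ln (ln (ln (real m))) - B_const M (X 1) N)"
    show "(\<exists>\<theta>. \<bar>\<theta>\<bar> \<le> C' / A * (V * exp (- (pi * V / (2 * N)))) \<and>
        Psi_plus m \<Omega> \<phi> V = exp (- A_zero M (X 1) N * exp (pi / N * V) * (1 + \<theta>))) \<and>
      (\<exists>\<theta>. \<bar>\<theta>\<bar> \<le> C' / A * (V * exp (- (pi * V / (2 * N)))) \<and>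
        Psi_minus m \<Omega> \<phi> V = exp (- A_zero M (X 1) N * exp (pi / N * V) * (1 + \<theta>)))"
      using main[OF *(1-4) _ *(5) *(6)[folded \<kappa>_def], of "-1"] main[OF *(1-4) _ *(5) *(6)[folded \<kappa>_def], of 1]
      unfolding Psi_eq_prop_gt[OF *(2,3)] eqs A_def by blast
  qed
qed

end
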